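(* Let $A$ and $B$ be two complex $n\times n$ matrices such that $A$ is normal, $\|B\|=1$ (operator norm induced by the Euclidean norm on $\mathbb{C}^n$), and $$\sigma_p(A,B,AB)=\{(x,y,z)\in\mathbb{C}^3: x^n+y^n+(-1)^{n-1}z^n=1\}.$$ a) If $n=3$, then the pair $(A,B)$ is unitarily equivalent either to $$\left(\begin{bmatrix}1&0&0\\0&e^{2\pi i/3}&0\\0&0&e^{4\pi i/3}\end{bmatrix},\ \begin{bmatrix}0&1&0\\0&0&1\\1&0&0\end{bmatrix}\right)$$ or to $$\left(\begin{bmatrix}1&0&0\\0&e^{2\pi i/3}&0\\0&0&e^{4\pi i/3}\end{bmatrix},\ \begin{bmatrix}0&0&1\\1&0&0\\0&1&0\end{bmatrix}\right).$$ b) If $n=4$ or $n=5$, there exists a permutation matrix $P$ of order $n$ such that the pair $(A,B)$ is unitarily equivalent to either $(P^*D_nP,\widehat{B}_n)$ or $(\widehat{B}_n,P^*D_nP)$, where $D_n=\mathrm{diag}(1,e^{2\pi i/n},\dots,e^{2\pi i(n-1)/n})$.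
   Context: For square matrices $A_1,\dots,A_k$ of the same size, $\sigma_p(A_1,\dots,A_k)=\{(x_1,\dots,x_k)\in\mathbb{C}^k: x_1A_1+\dots+x_kA_k-I \text{ is not invertible}\}$. Pairs $(A,B)$ and $(A',B')$ are unitarily equivalent if there is a single unitary $U$ with $A'=U^*AU$ and $B'=U^*BU$. $\widehat{B}_n$ is the $n\times n$ cyclic shift matrix with entries $1$ on the subdiagonal and in the upper right corner and $0$ elsewhere: $$\widehat{B}_n=\begin{bmatrix}0&0&\cdots&0&1\\1&0&\cdots&0&0\\ \vdots&\ddots& & &\vdots\\0&0&\cdots&1&0\end{bmatrix}.$$ Equivalently $\widehat{B}_n=\frac1nF_n^*D_nF_n$, where $F_n=[e^{2\pi i(k-1)(j-1)/n}]_{j,k=1}^n$. *)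

theory Defs
  imports "Jordan_Normal_Form.Schur_Decomposition" "HOL-Combinatorics.Permutations"
begin

definition unitary_mat :: "nat \<Rightarrow> complex mat \<Rightarrow> bool" where
  "unitary_mat n U \<longleftrightarrow> U \<in> carrier_mat n n
     \<and> mat_adjoint U * U = 1\<^sub>m n \<and> U * mat_adjoint U = 1\<^sub>m n"

definition normal_mat :: "complex mat \<Rightarrow> bool" where
  "normal_mat A \<longleftrightarrow> square_mat A \<and> A * mat_adjoint A = mat_adjoint A * A"

definition euclidean_norm :: "complex vec \<Rightarrow> real" where
  "euclidean_norm v = sqrt (\<Sum>i<dim_vec v. (cmod (v $ i))\<^sup>2)"

definition operator_norm :: "complex mat \<Rightarrow> real" where
  "operator_norm A =
     (SUP v \<in> {v \<in> carrier_vec (dim_col A). euclidean_norm v = 1}. euclidean_norm (A *\<^sub>v v))"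

definition matrix_pencil :: "nat \<Rightarrow> complex mat list \<Rightarrow> complex vec \<Rightarrow> complex mat" where
  "matrix_pencil n As x = mat n n (\<lambda>(i, j). \<Sum>k<length As. x $ k * (As ! k) $$ (i, j))"

text \<open>The joint spectrum of \<open>n \<times> n\<close> matrices \<open>A\<^sub>1, \<dots>, A\<^sub>k\<close>, given as a list;
  a point of the \<open>k\<close>-dimensional complex space is a vector of dimension \<open>k\<close>.\<close>

definition joint_spectrum :: "nat \<Rightarrow> complex mat list \<Rightarrow> complex vec set" where
  "joint_spectrum n As =
     {x \<in> carrier_vec (length As). \<not> invertible_mat (matrix_pencil n As x - 1\<^sub>m n)}"

definition unitarily_equivalent_pairs ::
  "nat \<Rightarrow> complex mat \<times> complex mat \<Rightarrow> complex mat \<times> complex mat \<Rightarrow> bool" where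
  "unitarily_equivalent_pairs n = (\<lambda>(A, B) (A', B').
     \<exists>U. unitary_mat n U \<and> A' = mat_adjoint U * A * U \<and> B' = mat_adjoint U * B * U)"

definition permutation_mat :: "nat \<Rightarrow> complex mat \<Rightarrow> bool" where
  "permutation_mat n P \<longleftrightarrow>
     (\<exists>p. p permutes {..<n} \<and> P = mat n n (\<lambda>(i, j). if i = p j then 1 else 0))"

definition roots_of_unity_diag :: "nat \<Rightarrow> complex mat" where
  "roots_of_unity_diag n = mat_diag n (\<lambda>k. cis (2 * pi * real k / real n))"

text \<open>Indices start at 0, so the entries 1 are at \<open>(j + 1, j)\<close> for \<open>j + 1 < n\<close> and at
  \<open>(0, n - 1)\<close>.\<close>

definition cyclic_shift_mat :: "nat \<Rightarrow> complex mat" where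
  "cyclic_shift_mat n = mat n n (\<lambda>(i, j). if i = (j + 1) mod n then 1 else 0)"

end

theory Submission
  imports Defs
begin

text \<open>Write \<open>D\<close> for the diagonal matrix of the \<open>n\<close>-th roots of unity. The joint spectrum fixes the
nonzero eigenvalues of \<open>M = x A + y B + z A B\<close>. They are the \<open>n\<close>-th roots of
\<open>s = x\<^sup>n + y\<^sup>n + (-1)\<^bsup>n-1\<^esup> z\<^sup>n\<close>, so \<open>det (1 - M) = 1 - s\<close> if \<open>s \<noteq> 0\<close> (\<open>det_pencil\<close>). In particular \<open>A\<close> and \<open>B\<close> have the \<open>n\<close>-th
roots of unity as simple eigenvalues. Eigenvectors of the normal matrix \<open>A\<close> are orthogonal; so are
those of the contraction \<open>B\<close>, because its eigenvalues have modulus 1. Thus \<open>A = V D V\<^sup>*\<close> and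
\<open>B = W D W\<^sup>*\<close> with unitary \<open>V\<close>, \<open>W\<close>, and the pair is determined by the unitary matrix
\<open>U = V\<^sup>* W\<close>: in the eigenbasis of \<open>A\<close> the pair is \<open>(D, U D U\<^sup>*)\<close>, in that of \<open>B\<close> it is
\<open>(U\<^sup>* D U, D)\<close>.

Let \<open>b j k\<close> be the entries of \<open>U D U\<^sup>*\<close> and \<open>\<alpha> j\<close> the roots of unity. Comparing the terms of order 1
and 2 in \<open>(y, z)\<close> of the determinant at the point \<open>x = 1 / \<alpha> j\<close>, where one row of \<open>1 - x D\<close> vanishes,
gives \<open>b j j = 0\<close>, \<open>\<Sum>k. b j k * b k j = 0\<close> and \<open>\<Sum>k. b j k * b k j / (\<alpha> j - \<alpha> k) = 0\<close>
(\<open>pencil_coefficients\<close>). The first two say that the diagonals of \<open>U D U\<^sup>*\<close> and of its square vanish,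
which for \<open>n \<le> 5\<close> determines all Fourier coefficients of the squared moduli in a row of \<open>U\<close>: these
moduli are all equal, so \<open>sqrt n * U\<close> is a complex Hadamard matrix
(\<open>flat_unitary_of_trace_conditions\<close>).

Complex Hadamard matrices of such small orders are rigid. In order 5 there is only the Fourier matrix, up to
permutations and phases (\<open>hadamard_5_is_fourier\<close>, a theorem of Haagerup); in order 4 the quotient of two
rows consists of two pairs of opposite numbers. Together with the equations for the products
\<open>b j k * b k j\<close> this leaves two possibilities: all entries of \<open>U D U\<^sup>*\<close>, or all entries of \<open>U\<^sup>* D U\<close>, are 0 or of modulus 1
(\<open>gram_shift_3_monomial\<close>, \<open>dichotomy_4\<close>, \<open>dichotomy_5\<close>); in order 3 the first one always occurs.
A monomial matrix of this kind, started at a basis vector, runs through all basis vectors up to phases.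
In the basis obtained in this way it is the cyclic shift while \<open>D\<close> is only permuted
(\<open>cyclic_basis\<close>).\<close>

section \<open>Roots of unity\<close>

text \<open>The exponent is an integer, so that differences of indices can be inserted without case distinctions.\<close>

definition zeta :: "nat \<Rightarrow> int \<Rightarrow> complex" where
  "zeta n k = cis (2 * pi * of_int k / of_nat n)"

lemma zeta_0 [simp]: "zeta n 0 = 1"
  by (simp add: zeta_def)

lemma zeta_add: "zeta n (k + l) = zeta n k * zeta n l"
  by (simp add: zeta_def cis_mult ring_distribs add_divide_distrib)

lemma cnj_zeta: "cnj (zeta n k) = zeta n (- k)"
  by (simp add: zeta_def cis_cnj)

lemma norm_zeta [simp]: "cmod (zeta n k) = 1"
  by (simp add: zeta_def)

lemma zeta_nonzero [simp]: "zeta n k \<noteq> 0"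
  using norm_zeta[of n k] by force

lemma zeta_diff: "zeta n (k - l) = zeta n k * cnj (zeta n l)"
  using zeta_add[of n k "- l"] by (simp add: cnj_zeta)

lemma zeta_power: "zeta n k ^ m = zeta n (k * int m)"
  by (simp add: zeta_def DeMoivre mult_ac)

lemma zeta_eq_1_iff:
  assumes "n > 0"
  shows "zeta n k = 1 \<longleftrightarrow> int n dvd k"
proof
  assume "zeta n k = 1"
  hence "cos (2 * pi * of_int k / real n) = 1"
    by (simp add: zeta_def complex_eq_iff)
  then obtain x :: int where "2 * pi * of_int k / real n = of_int x * 2 * pi"
    using cos_one_2pi_int by blast
  hence "of_int k = (of_int (x * int n) :: real)" using assms by (simp add: field_simps)
  hence "k = x * int n" by (simp only: of_int_eq_iff)
  thus "int n dvd k" by simp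
next
  assume "int n dvd k"
  then obtain x where "k = int n * x" by blast
  hence "2 * pi * of_int k / real n = 2 * pi * of_int x" using assms by simp
  thus "zeta n k = 1" by (simp only: zeta_def cis_multiple_2pi Ints_of_int)
qed

lemma zeta_eq_iff:
  assumes "n > 0"
  shows "zeta n k = zeta n l \<longleftrightarrow> int n dvd k - l"
proof -
  have "zeta n l * zeta n (- l) = 1" by (simp flip: zeta_add)
  hence "zeta n k = zeta n l \<longleftrightarrow> zeta n (k - l) = 1"
    by (metis zeta_add diff_add_cancel mult_1 cnj_zeta zeta_diff)
  thus ?thesis using assms by (simp add: zeta_eq_1_iff)
qed

lemma zeta_mod:
  assumes "n > 0" shows "zeta n (k mod int n) = zeta n k"
  using assms by (simp add: zeta_eq_iff mod_eq_dvd_iff[symmetric])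

lemma zeta_nat_inj:
  assumes "j < n" "k < n" "zeta n (int j) = zeta n (int k)" shows "j = k"
  using assms zeta_eq_iff[of n "int j" "int k"]
  by (metis gr_implies_not0 mod_eq_dvd_iff mod_pos_pos_trivial neq0_conv of_nat_0_le_iff
      of_nat_eq_iff of_nat_less_iff)

lemma dvd_int_diff_iff:
  assumes "j < n" "k < n" shows "int n dvd int j - int k \<longleftrightarrow> j = k"
  using zeta_eq_iff[of n "int j" "int k"] zeta_nat_inj[of j n k] assms by auto

lemma zeta_pow_n:
  assumes "n > 0" shows "zeta n k ^ n = 1"
  using assms by (simp add: zeta_power zeta_eq_1_iff)

lemma sum_zeta:
  assumes "n > 0"
  shows "(\<Sum>m<n. zeta n (k * int m)) = (if int n dvd k then of_nat n else 0)"
proof (cases "int n dvd k")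
  case True
  hence "zeta n (k * int m) = 1" for m using assms by (simp add: zeta_eq_1_iff)
  thus ?thesis using True by simp
next
  case False
  hence "zeta n k \<noteq> 1" using assms by (simp add: zeta_eq_1_iff)
  hence "(\<Sum>m<n. zeta n k ^ m) = (zeta n k ^ n - 1) / (zeta n k - 1)"
    by (rule geometric_sum)
  thus ?thesis using False assms by (simp add: zeta_power zeta_eq_1_iff)
qed

lemma sum_zeta_eq_0:
  assumes "0 < d" "d < n" shows "(\<Sum>m<n. zeta n (int d * int m)) = 0"
  using assms sum_zeta[of n "int d"] by (auto simp: zdvd_not_zless)

lemma fourier_inversion:
  fixes p :: "nat \<Rightarrow> complex"
  assumes "l < n"
  shows "of_nat n * p l = (\<Sum>b<n. zeta n (- (int b * int l)) * (\<Sum>m<n. zeta n (int b * int m) * p m))"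
proof -
  have n: "n > 0" using assms by simp
  have eq: "zeta n (- (int b * int l)) * zeta n (int b * int m) = zeta n ((int m - int l) * int b)"
    for b m
    by (simp flip: zeta_add add: algebra_simps)
  have dv: "int n dvd int m - int l \<longleftrightarrow> m = l" if "m < n" for m
    using that assms by (rule dvd_int_diff_iff)
  have "(\<Sum>b<n. zeta n (- (int b * int l)) * (\<Sum>m<n. zeta n (int b * int m) * p m))
      = (\<Sum>b<n. \<Sum>m<n. zeta n ((int m - int l) * int b) * p m)"
    by (simp add: sum_distrib_left mult.assoc[symmetric] eq)
  also have "\<dots> = (\<Sum>m<n. (\<Sum>b<n. zeta n ((int m - int l) * int b)) * p m)"
    by (subst sum.swap) (simp add: sum_distrib_right)
  also have "\<dots> = (\<Sum>m<n. if m = l then of_nat n * p m else 0)"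
    by (rule sum.cong) (simp_all add: sum_zeta[OF n] dv)
  also have "\<dots> = of_nat n * p l" using assms by simp
  finally show ?thesis by simp
qed

section \<open>Cross ratios in Hadamard matrices of order 5\<close>

text \<open>The difference of the two sides is the squared modulus of the permanent of the matrix with rows
\<open>(1, 1, 1)\<close>, \<open>p\<close>, \<open>q\<close>. For unimodular entries this modulus depends on the Gram matrix of the rows only:
\<open>|det|\<^sup>2\<close> is the Gram determinant, and the even and the odd half of the permanent overlap in cross
ratios, whose sum the Gram matrix knows.\<close>

lemma permanent_bound:
  fixes p q :: "nat \<Rightarrow> complex"
  assumes "\<And>i. i < 3 \<Longrightarrow> cmod (p i) = 1" "\<And>i. i < 3 \<Longrightarrow> cmod (q i) = 1"
  shows "(cmod (\<Sum>i<3. p i))\<^sup>2 + (cmod (\<Sum>i<3. q i))\<^sup>2 + (cmod (\<Sum>i<3. p i * cnj (q i)))\<^sup>2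
     \<le> 9 + 2 * Re (cnj (\<Sum>i<3. p i) * (\<Sum>i<3. p i * cnj (q i)) * (\<Sum>i<3. q i))"
proof -
  have 3: "{..<3} = {0, 1, 2::nat}" by auto
  define a b c d e f where abc: "a = p 0" "b = p 1" "c = p 2" "d = q 0" "e = q 1" "f = q 2"
  have nz: "a \<noteq> 0" "b \<noteq> 0" "c \<noteq> 0" "d \<noteq> 0" "e \<noteq> 0" "f \<noteq> 0"
    using assms[of 0] assms[of 1] assms[of 2] by (auto simp: abc)
  have inv: "cnj z = 1 / z" if "cmod z = 1" for z
    using that complex_div_cnj[of 1 z] by simp
  have cn: "cnj a = 1/a" "cnj b = 1/b" "cnj c = 1/c" "cnj d = 1/d" "cnj e = 1/e" "cnj f = 1/f"
    using assms[of 0] assms[of 1] assms[of 2] by (auto simp: abc intro: inv)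
  \<comment> \<open>The permanent; its conjugate is obtained by inverting every entry.\<close>
  define per where "per = a * e + a * f + b * d + b * f + c * d + c * e"
  define P where "P = a + b + c"
  define Q where "Q = d + e + f"
  define R where "R = a * cnj d + b * cnj e + c * cnj f"
  have "per * cnj per = 9 + cnj P * R * Q + P * cnj R * cnj Q - P * cnj P - Q * cnj Q - R * cnj R"
    unfolding per_def P_def Q_def R_def complex_cnj_add complex_cnj_mult complex_cnj_cnj unfolding cn
    using nz by (simp add: field_simps)
  hence "Re (per * cnj per) = Re (9 + cnj P * R * Q + P * cnj R * cnj Q - P * cnj P - Q * cnj Q - R * cnj R)"
    by simp
  hence "(cmod per)\<^sup>2 = 9 + 2 * Re (cnj P * R * Q) - (cmod P)\<^sup>2 - (cmod Q)\<^sup>2 - (cmod R)\<^sup>2"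
    by (simp only: complex_norm_square[symmetric] plus_complex.sel minus_complex.sel Re_complex_of_real)
       (simp add: algebra_simps)
  moreover have "(cmod per)\<^sup>2 \<ge> 0" by simp
  ultimately have "(cmod P)\<^sup>2 + (cmod Q)\<^sup>2 + (cmod R)\<^sup>2 \<le> 9 + 2 * Re (cnj P * R * Q)" by linarith
  thus ?thesis by (simp add: 3 P_def Q_def R_def abc add.assoc)
qed

lemma lessThan_5_split:
  assumes "p < 5" "q < (5::nat)" "p \<noteq> q"
  obtains r s t where "r < 5" "s < 5" "t < 5" "distinct [p, q, r, s, t]"
    "\<And>f :: nat \<Rightarrow> complex. sum f {..<5} = f p + f q + (f r + f s + f t)"
proof -
  have "card ({..<5} - {p, q}) = 3" using assms by (simp add: card_Diff_subset)
  then obtain r s t where rst: "{..<5} - {p, q} = {r, s, t}" "r \<noteq> s" "s \<noteq> t" "r \<noteq> t"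
    by (auto simp: card_3_iff)
  have un: "{..<5} = {p, q} \<union> {r, s, t}" using assms rst(1) by blast
  have "{p, q} \<inter> {r, s, t} = {}" using rst(1) by blast
  hence d: "p \<noteq> r" "p \<noteq> s" "p \<noteq> t" "q \<noteq> r" "q \<noteq> s" "q \<noteq> t" by auto
  have "r < 5" "s < 5" "t < 5" using rst(1) by blast+
  moreover have "sum f {..<5} = f p + f q + (f r + f s + f t)" for f :: "nat \<Rightarrow> complex"
    unfolding un using d rst assms by (simp add: add.assoc)
  ultimately show ?thesis using that d rst assms by simp
qed

text \<open>Three rows are cut into the columns \<open>m\<close>, \<open>l\<close> and the other three. By orthogonality the Gram matrices of
the two pieces have opposite entries off the diagonal. On the two columns these entries are, up
to phases, sums \<open>1 + u\<close> with a cross ratio \<open>u\<close>, and the permanent bound for the other three columns becomes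
\<open>Re (u + v + w) \<le> - 1 / 6\<close> for the three cross ratios.\<close>

lemma haagerup_triple:
  fixes h :: "nat \<Rightarrow> nat \<Rightarrow> complex"
  assumes uni: "\<And>j m. j < 5 \<Longrightarrow> m < 5 \<Longrightarrow> cmod (h j m) = 1"
    and rows: "\<And>j k. j < 5 \<Longrightarrow> k < 5 \<Longrightarrow> j \<noteq> k \<Longrightarrow> (\<Sum>m<5. h j m * cnj (h k m)) = 0"
    and ml: "m < 5" "l < 5" "m \<noteq> l"
    and rst: "r < 5" "s < 5" "t < 5" "r \<noteq> s" "s \<noteq> t" "r \<noteq> t"
  defines "z \<equiv> \<lambda>j. h j m * cnj (h j l)"
  shows "(cmod (z r + z s + z t))\<^sup>2 \<le> 8 / 3"
proof -
  obtain a b c where abc: "a < 5" "b < 5" "c < 5" "distinct [m, l, a, b, c]"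
    and split: "\<And>f :: nat \<Rightarrow> complex. sum f {..<5} = f m + f l + (f a + f b + f c)"
    using lessThan_5_split[OF ml] by blast
  define idx where "idx = (\<lambda>i::nat. if i = 0 then a else if i = 1 then b else c)"
  \<comment> \<open>Row phases normalized by row r; the indices run over all five columns.\<close>
  define p where "p = (\<lambda>i. h s i * cnj (h r i))"
  define q where "q = (\<lambda>i. h t i * cnj (h r i))"
  have inv: "x * cnj x = 1" "cnj x * x = 1" if "cmod x = 1" for x
    using that complex_norm_square[of x] by (simp_all add: mult.commute)
  have i5: "idx i < 5" for i using abc by (simp add: idx_def)
  have 3: "{..<3} = {0, 1, 2::nat}" by auto
  have pq: "p i * cnj (q i) = h s i * cnj (h t i)" if "i < 5" for i
    using inv(2)[OF uni[OF rst(1) that]] by (simp add: p_def q_def mult_ac)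
  define P where "P = p m + p l"
  define Q where "Q = q m + q l"
  define R where "R = p m * cnj (q m) + p l * cnj (q l)"
  have P: "(\<Sum>i<3. p (idx i)) = - P"
    using rows[of s r] rst split[of p] unfolding P_def
    by (simp add: p_def 3 idx_def add.assoc) (simp add: eq_neg_iff_add_eq_0 algebra_simps)
  have Q: "(\<Sum>i<3. q (idx i)) = - Q"
    using rows[of t r] rst split[of q] unfolding Q_def
    by (simp add: q_def 3 idx_def add.assoc) (simp add: eq_neg_iff_add_eq_0 algebra_simps)
  have "(\<Sum>i<5. p i * cnj (q i)) = 0" using rows[of s t] rst by (simp add: pq)
  hence R: "(\<Sum>i<3. p (idx i) * cnj (q (idx i))) = - R"
    using split[of "\<lambda>i. p i * cnj (q i)"] unfolding R_def
    by (simp add: 3 idx_def add.assoc) (simp add: eq_neg_iff_add_eq_0 algebra_simps)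
  have "(cmod (- P))\<^sup>2 + (cmod (- Q))\<^sup>2 + (cmod (- R))\<^sup>2 \<le> 9 + 2 * Re (cnj (- P) * (- R) * (- Q))"
    using permanent_bound[of "\<lambda>i. p (idx i)" "\<lambda>i. q (idx i)"] i5 uni rst
    unfolding P Q R by (auto simp: p_def q_def norm_mult)
  hence main: "(cmod P)\<^sup>2 + (cmod Q)\<^sup>2 + (cmod R)\<^sup>2 \<le> 9 - 2 * Re (cnj P * R * Q)" by simp
  define u where "u = z r * cnj (z s)"
  define v where "v = z s * cnj (z t)"
  define w where "w = z t * cnj (z r)"
  have n: "cmod (z r) = 1" "cmod (z s) = 1" "cmod (z t) = 1"
    using uni rst ml by (simp_all add: z_def norm_mult)
  note zz = inv[OF n(1)] inv[OF n(2)] inv[OF n(3)]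
  have nu: "cmod u = 1" "cmod v = 1" "cmod w = 1" using n by (simp_all add: u_def v_def w_def norm_mult)
  note uu = inv[OF nu(1)] inv[OF nu(2)] inv[OF nu(3)]
  have uvw: "u * v * w = 1"
    unfolding u_def v_def w_def using zz by (metis mult.assoc mult.commute mult_1)
  have hh: "h j i * cnj (h j i) = 1" "cnj (h j i) * h j i = 1" if "j < 5" "i < 5" for i j
    using inv[OF uni[OF that]] by auto
  have Pu: "P = p l * (1 + cnj u)"
    using hh(1)[of s l] hh(2)[of r l] rst ml
    by (simp add: P_def p_def u_def z_def ring_distribs) (metis mult.assoc mult.commute mult_1)
  have Qw: "Q = q l * (1 + w)"
    using hh(1)[of t l] hh(2)[of r l] rst ml
    by (simp add: Q_def q_def w_def z_def ring_distribs) (metis mult.assoc mult.commute mult_1)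
  have Rv: "R = p l * cnj (q l) * (1 + v)"
  proof -
    have "R = h s m * cnj (h t m) + h s l * cnj (h t l)" using pq ml by (simp add: R_def)
    also have "\<dots> = h s l * cnj (h t l) * (1 + v)"
      using hh(1)[of s l] hh(2)[of t l] rst ml
      by (simp add: v_def z_def ring_distribs) (metis mult.assoc mult.commute mult_1)
    finally show ?thesis using pq ml by simp
  qed
  have npq: "cmod (p l) = 1" "cmod (q l) = 1" using uni rst ml by (simp_all add: p_def q_def norm_mult)
  have sq: "(cmod (1 + x))\<^sup>2 = 2 + 2 * Re x" if "cmod x = 1" for x
  proof -
    have "(Re x)\<^sup>2 + (Im x)\<^sup>2 = 1" using that cmod_power2[of x] by simp
    thus ?thesis unfolding cmod_power2 by (simp add: power2_eq_square algebra_simps)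
  qed
  have "cnj P * R * Q = (1 + u) * (1 + v) * (1 + w)"
  proof -
    have "cnj P * R * Q = (cnj (p l) * p l) * (cnj (q l) * q l) * ((1 + u) * (1 + v) * (1 + w))"
      by (simp add: Pu Qw Rv mult_ac)
    thus ?thesis using inv[OF npq(1)] inv[OF npq(2)] by simp
  qed
  also have "\<dots> = 2 + (u + cnj u) + (v + cnj v) + (w + cnj w)"
  proof -
    have "u * v = cnj w" "v * w = cnj u" "u * w = cnj v"
      using uvw uu by (metis mult.assoc mult.commute mult_1)+
    thus ?thesis using uvw by (simp add: ring_distribs mult_ac)
  qed
  finally have "Re (cnj P * R * Q) = 2 + 2 * (Re u + Re v + Re w)" by simp
  moreover have "(cmod P)\<^sup>2 = 2 + 2 * Re u" "(cmod Q)\<^sup>2 = 2 + 2 * Re w" "(cmod R)\<^sup>2 = 2 + 2 * Re v"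
    using sq[of "cnj u"] sq[of w] sq[of v] nu npq by (simp_all add: Pu Qw Rv norm_mult)
  ultimately have C: "Re u + Re v + Re w \<le> - 1 / 6" using main by simp
  have "(z r + z s + z t) * cnj (z r + z s + z t) = 3 + (u + cnj u) + (v + cnj v) + (w + cnj w)"
    using zz by (simp add: u_def v_def w_def ring_distribs mult_ac)
  hence "complex_of_real ((cmod (z r + z s + z t))\<^sup>2) = 3 + (u + cnj u) + (v + cnj v) + (w + cnj w)"
    by (simp only: complex_norm_square)
  hence "Re (complex_of_real ((cmod (z r + z s + z t))\<^sup>2)) = Re (3 + (u + cnj u) + (v + cnj v) + (w + cnj w))"
    by simp
  hence "(cmod (z r + z s + z t))\<^sup>2 = 3 + 2 * (Re u + Re v + Re w)" by simp
  thus ?thesis using C by simp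
qed

text \<open>The five numbers \<open>z j\<close> add up to 0, so a pair of them has the same sum, up to sign, as the other three.\<close>

lemma haagerup_cross_ratio:
  fixes h :: "nat \<Rightarrow> nat \<Rightarrow> complex"
  assumes uni: "\<And>j m. j < 5 \<Longrightarrow> m < 5 \<Longrightarrow> cmod (h j m) = 1"
    and rows: "\<And>j k. j < 5 \<Longrightarrow> k < 5 \<Longrightarrow> j \<noteq> k \<Longrightarrow> (\<Sum>m<5. h j m * cnj (h k m)) = 0"
    and cols: "\<And>m l. m < 5 \<Longrightarrow> l < 5 \<Longrightarrow> m \<noteq> l \<Longrightarrow> (\<Sum>j<5. h j m * cnj (h j l)) = 0"
    and ml: "m < 5" "l < 5" "m \<noteq> l" and pq: "p < 5" "q < 5" "p \<noteq> q"
  shows "Re (h p m * cnj (h p l) * cnj (h q m * cnj (h q l))) \<le> 1 / 3"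
proof -
  define z where "z = (\<lambda>j. h j m * cnj (h j l))"
  obtain r s t where rst: "r < 5" "s < 5" "t < 5" "distinct [p, q, r, s, t]"
    and split: "\<And>f :: nat \<Rightarrow> complex. sum f {..<5} = f p + f q + (f r + f s + f t)"
    using lessThan_5_split[OF pq] by blast
  have "(cmod (z r + z s + z t))\<^sup>2 \<le> 8 / 3"
    using haagerup_triple[OF uni rows ml rst(1-3)] rst(4) unfolding z_def by simp
  moreover have "z r + z s + z t = - (z p + z q)"
    using cols[OF ml] split[of z] by (simp add: z_def eq_neg_iff_add_eq_0 algebra_simps)
  ultimately have le: "(cmod (z p + z q))\<^sup>2 \<le> 8 / 3" by (simp only: norm_minus_cancel)
  have n: "cmod (z p) = 1" "cmod (z q) = 1"
    using uni pq ml by (simp_all add: z_def norm_mult)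
  have "(cmod (z p + z q))\<^sup>2 = (cmod (z p))\<^sup>2 + (cmod (z q))\<^sup>2 + 2 * Re (z p * cnj (z q))"
    unfolding cmod_power2 by (simp add: power2_eq_square algebra_simps)
  thus ?thesis using le n by (simp add: z_def)
qed

section \<open>Almost regular pentagons\<close>

lemma cos_2pi_div_5: "cos (2 * pi / 5) = (sqrt 5 - 1) / 4"
proof -
  define c where "c = cos (2 * pi / 5)"
  have 5: "{..<5} = {0, 1, 2, 3, 4::nat}" by auto
  have "(\<Sum>m<5. zeta 5 (int m)) = 0" using sum_zeta_eq_0[of 1 5] by simp
  hence "Re (\<Sum>m<5. zeta 5 (int m)) = 0" by simp
  hence "1 + cos (2 * pi / 5) + cos (4 * pi / 5) + cos (6 * pi / 5) + cos (8 * pi / 5) = 0"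
    by (simp add: 5 zeta_def)
  moreover have "cos (8 * pi / 5) = cos (2 * pi / 5)"
    using cos_2pi_minus[of "2 * pi / 5"] by (simp add: field_simps)
  moreover have "cos (6 * pi / 5) = cos (4 * pi / 5)"
    using cos_2pi_minus[of "4 * pi / 5"] by (simp add: field_simps)
  moreover have "cos (4 * pi / 5) = 2 * c\<^sup>2 - 1"
    using cos_double_cos[of "2 * pi / 5"] by (simp add: c_def)
  ultimately have "4 * c\<^sup>2 + 2 * c = 1" by (simp add: c_def)
  hence "(4 * c + 1)\<^sup>2 = (sqrt 5)\<^sup>2" by (simp add: power2_eq_square algebra_simps)
  moreover have "c > 0" unfolding c_def by (rule cos_gt_zero_pi) (use pi_gt_zero in linarith)+
  ultimately have "4 * c + 1 = sqrt 5" by (subst (asm) power2_eq_iff_nonneg) auto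
  thus ?thesis by (simp add: c_def)
qed

text \<open>The angle \<open>2 * pi / 5 - 3 / 100\<close> is a lower bound for \<open>arccos (1 / 3)\<close> that deviates little from the
angle of the regular pentagon.\<close>

lemma pentagon_gap_cos:
  assumes "0 \<le> x" "x < 2 * pi / 5 - 3 / 100"
  shows "cos x > 1 / 3"
proof -
  define c where "c = cos (2 * pi / 5)"
  define s where "s = sin (2 * pi / 5)"
  have r5: "2.236 \<le> sqrt 5" "sqrt 5 \<le> 2.24" 
    by (rule real_le_rsqrt, simp add: power2_eq_square) (rule real_le_lsqrt, simp_all add: power2_eq_square)
  have c: "0.309 \<le> c" "c \<le> 0.31" using r5 by (auto simp: c_def cos_2pi_div_5)
  have "s\<^sup>2 = 1 - c\<^sup>2" by (simp add: c_def s_def sin_squared_eq)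
  moreover have "c\<^sup>2 \<le> 0.31\<^sup>2" by (rule power_mono) (use c in auto)
  ultimately have "0.95\<^sup>2 \<le> s\<^sup>2" by (simp add: power2_eq_square)
  moreover have "s > 0" unfolding s_def by (rule sin_gt_zero) (use pi_gt_zero in linarith)+
  ultimately have s: "0.95 \<le> s" using power2_le_imp_le[of "0.95" s] by simp
  have sin3: "\<bar>sin (3/100) - 3/100\<bar> \<le> inverse (6::real) * (3/100)^3"
    using Maclaurin_sin_bound[of "3/100" 3] by (simp add: numeral_3_eq_3 sin_coeff_def fact_numeral)
  have sl: "sin (3/100) \<ge> (0.0299::real)" using abs_le_D2[OF sin3] by (simp add: power3_eq_cube)
  have "sin (3/200) \<le> (3/200::real)" by (rule sin_x_le_x) simp
  moreover have "sin (3/200::real) \<ge> 0" by (rule sin_ge_zero) (use pi_ge_two in auto)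
  ultimately have "(sin (3/200::real))\<^sup>2 \<le> (3/200)\<^sup>2" by (rule power_mono)
  hence cl: "cos (3/100) \<ge> (0.9995::real)"
    using cos_double_sin[of "3/200::real"] by (simp add: power2_eq_square)
  have "cos (2 * pi / 5 - 3/100) = c * cos (3/100) + s * sin (3/100)"
    by (simp add: cos_diff c_def s_def)
  moreover have "c * cos (3/100) \<ge> 0.309 * 0.9995" by (rule mult_mono) (use c cl in auto)
  moreover have "s * sin (3/100) \<ge> 0.95 * 0.0299" by (rule mult_mono) (use s sl in auto)
  ultimately have "cos (2 * pi / 5 - 3/100) > 1 / 3" by simp
  moreover have "cos (2 * pi / 5 - 3/100) \<le> cos x"
    by (rule cos_monotone_0_pi_le) (use assms pi_ge_two in auto)
  ultimately show ?thesis by simp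
qed

lemma cmod_cis_diff_le: "cmod (cis a - cis b) \<le> \<bar>a - b\<bar>"
proof -
  have half: "2 * ((a - b) / 2) = a - b" by simp
  have "(cmod (cis a - cis b))\<^sup>2 = ((cos a)\<^sup>2 + (sin a)\<^sup>2) + ((cos b)\<^sup>2 + (sin b)\<^sup>2) - 2 * cos (a - b)"
    unfolding cmod_power2 cos_diff by (simp add: power2_eq_square algebra_simps)
  also have "\<dots> = (2 * sin ((a - b) / 2))\<^sup>2"
    using cos_double_sin[of "(a - b) / 2"] unfolding half by (simp add: power2_eq_square)
  also have "\<dots> \<le> (a - b)\<^sup>2"
    using abs_sin_x_le_abs_x[of "(a - b) / 2"] by (subst abs_le_square_iff[symmetric]) (simp add: abs_mult)
  finally show ?thesis by (metis abs_le_square_iff abs_norm_cancel)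
qed

text \<open>Five points on the circle with gaps of at least \<open>\<gamma>\<close>, which is slightly less than a fifth of a turn, almost
form a regular pentagon: a lower bound for all gaps bounds every arc from both sides. The label of a point is the
number of multiples of \<open>\<gamma>\<close> that fit between the point 0 and it. Since an arc of \<open>i\<close> gaps is at least
\<open>i * \<gamma>\<close> and its complement at least \<open>(5 - i) * \<gamma>\<close>, it deviates by at most 4 times 3/100 from the regular
one, also when it does not start at the point 0; this is why the estimate is made for all pairs.\<close>

lemma pentagon_labels:
  fixes z :: "nat \<Rightarrow> complex"
  assumes uni: "\<And>p. p < 5 \<Longrightarrow> cmod (z p) = 1"
    and sep: "\<And>p q. p < 5 \<Longrightarrow> q < 5 \<Longrightarrow> p \<noteq> q \<Longrightarrow> Re (z p * cnj (z q)) \<le> 1 / 3"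
  obtains k where "k 0 = 0" "bij_betw k {..<5} {..<5::nat}"
    "\<And>p q. p < 5 \<Longrightarrow> q < 5 \<Longrightarrow> cmod (z p * cnj (z q) - zeta 5 (int (k p) - int (k q))) \<le> 3 / 25"
proof -
  define \<gamma> where "\<gamma> = 2 * pi / 5 - 3 / 100"
  have \<gamma>: "\<gamma> > 0" using pi_ge_two unfolding \<gamma>_def by linarith
  have "\<exists>t. 0 \<le> t \<and> t < 2 * pi \<and> z p * cnj (z 0) = cis t \<and> (p = 0 \<longrightarrow> t = 0)" if "p < 5" for p
  proof (cases "p = 0")
    case True
    thus ?thesis using uni[of 0] complex_norm_square[of "z 0"] by (intro exI[of _ 0]) auto
  next
    case False
    have "cmod (z p * cnj (z 0)) = 1" using uni that by (simp add: norm_mult)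
    hence "(Re (z p * cnj (z 0)))\<^sup>2 + (Im (z p * cnj (z 0)))\<^sup>2 = 1"
      using cmod_power2[of "z p * cnj (z 0)"] by simp
    then obtain t where "0 \<le> t" "t < 2 * pi" "Re (z p * cnj (z 0)) = cos t" "Im (z p * cnj (z 0)) = sin t"
      by (rule sincos_total_2pi)
    thus ?thesis using False by (intro exI[of _ t]) (simp add: complex_eq_iff)
  qed
  then obtain t where t: "\<And>p. p < 5 \<Longrightarrow> 0 \<le> t p" "\<And>p. p < 5 \<Longrightarrow> t p < 2 * pi"
    "\<And>p. p < 5 \<Longrightarrow> z p * cnj (z 0) = cis (t p)" and t0: "t 0 = 0" by (metis zero_less_numeral)
  have ratio: "z p * cnj (z q) = cis (t p - t q)" if "p < 5" "q < 5" for p q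
  proof -
    have "z p * cnj (z q) = (z p * cnj (z 0)) * cnj (z q * cnj (z 0))"
      using uni[of 0] complex_norm_square[of "z 0"] by (simp add: mult.commute[of "cnj (z 0)"])
    also have "\<dots> = cis (t p) * cis (- t q)" using t(3) that by (simp add: cis_cnj)
    finally show ?thesis by (simp add: cis_mult)
  qed
  have c13: "cos (t p - t q) \<le> 1 / 3" if "p < 5" "q < 5" "p \<noteq> q" for p q
    using sep[OF that] ratio[OF that(1,2)] by simp
  have gap: "\<gamma> \<le> \<bar>t p - t q\<bar>" "\<bar>t p - t q\<bar> \<le> 2 * pi - \<gamma>" if "p < 5" "q < 5" "p \<noteq> q" for p q
  proof -
    show "\<gamma> \<le> \<bar>t p - t q\<bar>"
      using pentagon_gap_cos[of "\<bar>t p - t q\<bar>"] c13[OF that] unfolding \<gamma>_def by force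
    have "\<bar>t p - t q\<bar> \<le> 2 * pi" using t(1,2)[OF that(1)] t(1,2)[OF that(2)] by (simp add: abs_le_iff)
    moreover have "cos (2 * pi - \<bar>t p - t q\<bar>) = cos (t p - t q)" by (simp add: cos_2pi_minus)
    ultimately show "\<bar>t p - t q\<bar> \<le> 2 * pi - \<gamma>"
      using pentagon_gap_cos[of "2 * pi - \<bar>t p - t q\<bar>"] c13[OF that] unfolding \<gamma>_def by force
  qed
  \<comment> \<open>Labels are distinct because the gaps are at least gamma, and less than 5 because 6 * gamma exceeds a full turn.\<close>
  define k where "k = (\<lambda>p. nat \<lfloor>t p / \<gamma>\<rfloor>)"
  have k_bounds: "real (k p) * \<gamma> \<le> t p" "t p < (real (k p) + 1) * \<gamma>" if "p < 5" for p
  proof -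
    have "real (k p) = of_int \<lfloor>t p / \<gamma>\<rfloor>" using t(1)[OF that] \<gamma> by (simp add: k_def)
    hence "real (k p) \<le> t p / \<gamma>" "t p / \<gamma> < real (k p) + 1" by linarith+
    thus "real (k p) * \<gamma> \<le> t p" "t p < (real (k p) + 1) * \<gamma>" using \<gamma> by (simp_all add: field_simps)
  qed
  have k0: "k 0 = 0" by (simp add: k_def t0)
  have k5: "k p < 5" if "p < 5" for p
  proof (cases "p = 0")
    case False
    have "real (k p) * \<gamma> < 5 * \<gamma>"
      using k_bounds(1)[OF that] gap(2)[OF that _ False] t0 pi_ge_two unfolding \<gamma>_def by simp
    thus ?thesis using \<gamma> by simp
  qed (simp add: k0)
  have inj: "inj_on k {..<5}"
  proof (rule inj_onI, rule ccontr)
    fix p q assume pq: "p \<in> {..<5}" "q \<in> {..<5}" "k p = k q" "p \<noteq> q"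
    have "\<bar>t p - t q\<bar> < \<gamma>" using k_bounds[of p] k_bounds[of q] pq by (simp add: ring_distribs abs_less_iff)
    thus False using gap(1)[of p q] pq by simp
  qed
  have bij: "bij_betw k {..<5} {..<5}"
    using inj k5 endo_inj_surj[of "{..<5}" k] by (auto simp: bij_betw_def)
  define ob where "ob = inv_into {..<5} k"
  have ob: "ob i < 5" "k (ob i) = i" if "i < 5" for i
    using bij that inv_into_into[of i k "{..<5}"] f_inv_into_f[of i k "{..<5}"]
    by (auto simp: ob_def bij_betw_def)
  have obk: "ob (k p) = p" if "p < 5" for p using inj that by (simp add: ob_def)
  define T where "T = (\<lambda>i. t (ob i))"
  have T0: "T 0 = 0" using obk[of 0] t0 k0 by (simp add: T_def)
  have step: "T i + \<gamma> \<le> T (Suc i)" if "Suc i < 5" for i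
  proof -
    have "ob i \<noteq> ob (Suc i)" using ob(2)[of i] ob(2)[of "Suc i"] that by fastforce
    hence "\<gamma> \<le> \<bar>T i - T (Suc i)\<bar>" using gap(1) ob that by (simp add: T_def)
    moreover have "T i < T (Suc i)"
      using k_bounds(2)[of "ob i"] k_bounds(1)[of "ob (Suc i)"] ob[of i] ob[of "Suc i"] that
      by (simp add: T_def algebra_simps)
    ultimately show ?thesis by simp
  qed
  have "ob 4 \<noteq> 0" using ob(2)[of 4, simplified] k0 by (intro notI) simp
  hence T4: "T 4 \<le> 2 * pi - \<gamma>" using gap(2)[of "ob 4" 0] ob[of 4] t0 by (simp add: T_def)
  have chain: "T i + real (j - i) * \<gamma> \<le> T j" if "i \<le> j" "j < 5" for i j
    using that
  proof (induction j rule: dec_induct)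
    case (step m)
    hence "T i + real (m - i) * \<gamma> + \<gamma> \<le> T (Suc m)" using \<open>\<And>i. Suc i < 5 \<Longrightarrow> T i + \<gamma> \<le> T (Suc i)\<close>[of m] by simp
    thus ?case using step by (simp add: Suc_diff_le ring_distribs)
  qed simp
  have dev': "\<bar>T j - T i - 2 * pi * (real j - real i) / 5\<bar> \<le> 3 / 25" if "i < j" "j < 5" for i j
  proof -
    have "T i + (real j - real i) * \<gamma> \<le> T j" using chain[of i j] that by (simp add: of_nat_diff)
    moreover have "real i * \<gamma> \<le> T i" using chain[of 0 i] that T0 by simp
    moreover have "T j + (4 - real j) * \<gamma> \<le> T 4" using chain[of j 4] that by (simp add: of_nat_diff)
    moreover have "real j - real i \<le> 4" "1 \<le> real j - real i" using that by linarith+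
    ultimately show ?thesis using T4 unfolding \<gamma>_def abs_le_iff by (simp add: field_simps)
  qed
  have dev: "\<bar>T i - T j - 2 * pi * (real i - real j) / 5\<bar> \<le> 3 / 25" if "i < 5" "j < 5" for i j
  proof (cases i j rule: linorder_cases)
    case less
    have "T i - T j - 2 * pi * (real i - real j) / 5 = - (T j - T i - 2 * pi * (real j - real i) / 5)"
      by (simp add: field_simps)
    thus ?thesis using dev'[OF less that(2)] by (simp only: abs_minus_cancel)
  qed (use dev'[of j i] that in auto)
  have "cmod (z p * cnj (z q) - zeta 5 (int (k p) - int (k q))) \<le> 3 / 25" if "p < 5" "q < 5" for p q
  proof -
    have "cmod (cis (t p - t q) - cis (2 * pi * of_int (int (k p) - int (k q)) / 5)) \<le> 3 / 25"
      using order_trans[OF cmod_cis_diff_le dev[of "k p" "k q"]] k5 obk that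
      by (simp add: T_def)
    thus ?thesis using ratio[OF that] by (simp add: zeta_def)
  qed
  thus ?thesis using that k0 bij by blast
qed

text \<open>A permutation \<open>s\<close> of the residues modulo 5 whose difference with the identity is again injective is called
an orthomorphism; those fixing 0 are linear, by a finite check.\<close>

lemma orthomorphism_5_linear:
  fixes s :: "nat \<Rightarrow> nat"
  assumes s0: "s 0 = 0" and rng: "\<And>x. x < 5 \<Longrightarrow> s x < 5" and inj: "inj_on s {..<5}"
    and ortho: "\<And>x y. x < 5 \<Longrightarrow> y < 5 \<Longrightarrow> x \<noteq> y \<Longrightarrow>
      \<not> (5::int) dvd (int (s x) - int (s y)) - (int x - int y)"
  obtains c where "\<And>x. x < 5 \<Longrightarrow> s x = c * x mod 5"
proof -
  have check: "list_all (\<lambda>a. list_all (\<lambda>b. list_all (\<lambda>c. list_all (\<lambda>d.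
      distinct [a, b, c, d] \<and> distinct [0, (a + 4) mod 5, (b + 3) mod 5, (c + 2) mod 5, (d + 1) mod 5]
      \<longrightarrow> b = a * 2 mod 5 \<and> c = a * 3 mod 5 \<and> d = a * 4 mod 5)
      [1, 2, 3, 4]) [1, 2, 3, 4]) [1, 2, 3, 4]) [1, 2, 3, 4::nat]"
    by code_simp
  have o: "(s x + (5 - x)) mod 5 \<noteq> (s y + (5 - y)) mod 5" if "x < 5" "y < 5" "x \<noteq> y" for x y
  proof
    assume "(s x + (5 - x)) mod 5 = (s y + (5 - y)) mod 5"
    hence "int (s x + (5 - x)) mod 5 = int (s y + (5 - y)) mod 5"
      by (metis of_nat_mod of_nat_numeral)
    hence "5 dvd int (s x + (5 - x)) - int (s y + (5 - y))" by (simp only: mod_eq_dvd_iff)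
    thus False using ortho[OF that] that by (simp add: of_nat_diff algebra_simps)
  qed
  have mem: "s x \<in> set [1, 2, 3, 4]" if "0 < x" "x < 5" for x
  proof -
    have "s x \<noteq> 0" using inj s0 that by (auto dest: inj_onD[of s _ x 0])
    thus ?thesis using rng[OF that(2)] by auto
  qed
  have neq: "s x \<noteq> s y" if "x < 5" "y < 5" "x \<noteq> y" for x y
    using inj that by (auto simp: inj_on_eq_iff)
  have "distinct [s 1, s 2, s 3, s 4]" by (simp add: neq)
  moreover have "distinct [0, (s 1 + 4) mod 5, (s 2 + 3) mod 5, (s 3 + 2) mod 5, (s 4 + 1) mod 5]"
    using o[of 0 1] o[of 0 2] o[of 0 3] o[of 0 4] o[of 1 2] o[of 1 3] o[of 1 4] o[of 2 3] o[of 2 4]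
      o[of 3 4] s0 by simp
  moreover have "s 1 \<in> set [1, 2, 3, 4]" "s 2 \<in> set [1, 2, 3, 4]" "s 3 \<in> set [1, 2, 3, 4]" "s 4 \<in> set [1, 2, 3, 4]"
    by (rule mem; simp)+
  ultimately have "s 2 = s 1 * 2 mod 5 \<and> s 3 = s 1 * 3 mod 5 \<and> s 4 = s 1 * 4 mod 5"
    using check unfolding list_all_iff by blast
  hence "s x = s 1 * x mod 5" if "x \<in> {0, 1, 2, 3, 4}" for x
    using that s0 rng[of 1] by auto
  moreover have "x \<in> {0, 1, 2, 3, 4}" if "x < 5" for x :: nat using that by auto
  ultimately show ?thesis using that by blast
qed

section \<open>Rigidity of the Fourier matrix of order 5\<close>

text \<open>The last claim says that near 1 the distance of a unimodular number from 1 is almost its imaginary part.\<close>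

lemma unimodular_near_1:
  assumes "cmod g = 1" "cmod (g - 1) \<le> e"
  shows "0 \<le> 1 - Re g" "1 - Re g \<le> e\<^sup>2 / 2" "\<bar>Im g\<bar> \<le> e"
    and "e \<le> 3 / 25 \<Longrightarrow> cmod (g - 1) \<le> 101 / 100 * \<bar>Im g\<bar>"
proof -
  have gg: "(Re g)\<^sup>2 + (Im g)\<^sup>2 = 1" using assms(1) cmod_power2[of g] by simp
  have sq: "(cmod (g - 1))\<^sup>2 = 2 * (1 - Re g)"
    using gg unfolding cmod_power2 by (simp add: power2_eq_square algebra_simps)
  have "(cmod (g - 1))\<^sup>2 \<le> e\<^sup>2" by (rule power_mono) (use assms in auto)
  thus le: "1 - Re g \<le> e\<^sup>2 / 2" using sq by simp
  show "0 \<le> 1 - Re g" using complex_Re_le_cmod[of g] assms(1) by simp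
  show "\<bar>Im g\<bar> \<le> e" using abs_Im_le_cmod[of "g - 1"] assms(2) by simp
  assume e: "e \<le> 3 / 25"
  have "e \<ge> 0" by (rule order_trans[OF norm_ge_zero assms(2)])
  hence "e\<^sup>2 \<le> (3 / 25)\<^sup>2" using e by (intro power_mono)
  hence x: "1 - Re g \<le> 9 / 1250" using le by (simp add: power2_eq_square)
  have "(1 - Re g) * (1 - Re g) \<le> (1 - Re g) * (9 / 1250)"
    using x \<open>0 \<le> 1 - Re g\<close> by (rule mult_left_mono)
  hence "2 * (1 - Re g) \<le> (101 / 100)\<^sup>2 * (Im g)\<^sup>2"
    using gg \<open>0 \<le> 1 - Re g\<close> by (simp add: power2_eq_square algebra_simps)
  hence "(cmod (g - 1))\<^sup>2 \<le> (101 / 100 * \<bar>Im g\<bar>)\<^sup>2" using sq by (simp only: power_mult_distrib power2_abs)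
  thus "cmod (g - 1) \<le> 101 / 100 * \<bar>Im g\<bar>" by (rule power2_le_imp_le) simp
qed

text \<open>The entries of a Hadamard matrix divided by those of the Fourier matrix, with first row and column
normalized to 1.\<close>

locale twisted_fourier_5 =
  fixes g :: "nat \<Rightarrow> nat \<Rightarrow> complex"
  assumes uni: "\<And>j m. j < 5 \<Longrightarrow> m < 5 \<Longrightarrow> cmod (g j m) = 1"
    and row0: "\<And>m. m < 5 \<Longrightarrow> g 0 m = 1" and col0: "\<And>j. j < 5 \<Longrightarrow> g j 0 = 1"
    and orth: "\<And>a b. a < 5 \<Longrightarrow> b < 5 \<Longrightarrow> a \<noteq> b \<Longrightarrow>
      (\<Sum>m<5. g a m * cnj (g b m) * zeta 5 ((int a - int b) * int m)) = 0"
begin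

text \<open>Near 1 the imaginary part \<open>y\<close> of \<open>g\<close> is its deviation from 1 to first order; this is the Fourier
transform of \<open>y\<close> along a row.\<close>

definition yhat :: "nat \<Rightarrow> int \<Rightarrow> complex" where
  "yhat j d = (\<Sum>m<5. of_real (Im (g j m)) * zeta 5 (d * int m))"

lemma yhat_cong: "(5::int) dvd d - e \<Longrightarrow> yhat j d = yhat j e"
proof -
  assume "(5::int) dvd d - e"
  hence "zeta 5 (d * int m) = zeta 5 (e * int m)" for m
    by (simp add: zeta_eq_iff flip: left_diff_distrib)
  thus ?thesis by (simp add: yhat_def)
qed

lemma yhat_0: "yhat 0 d = 0"
  by (simp add: yhat_def row0)

text \<open>Orthogonality of two rows to first order: if \<open>g = 1 + i y\<close> up to quadratic terms, then the Fourier
coefficients of the \<open>y\<close> of rows \<open>a\<close> and \<open>b\<close> at the frequency \<open>a - b\<close> agree up to quadratic terms. The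
column 0 does not contribute to the error, hence the factor 4.\<close>

lemma yhat_step:
  assumes ab: "a < 5" "b < 5" "a \<noteq> b"
    and bound: "\<And>m. 0 < m \<Longrightarrow> m < 5 \<Longrightarrow>
      cmod (1 + \<i> * of_real (Im (g a m) - Im (g b m)) - g a m * cnj (g b m)) \<le> K"
  shows "cmod (yhat a (int a - int b) - yhat b (int a - int b)) \<le> 4 * K"
proof -
  define d where "d = int a - int b"
  define q where "q = (\<lambda>m. 1 + \<i> * of_real (Im (g a m) - Im (g b m)) - g a m * cnj (g b m))"
  have z: "(\<Sum>m<5. zeta 5 (d * int m)) = 0"
    using ab sum_zeta[of 5 d] dvd_int_diff_iff[of a 5 b] by (simp add: d_def)
  have "(\<Sum>m<5. q m * zeta 5 (d * int m)) = (\<Sum>m<5. zeta 5 (d * int m)) + \<i> * (yhat a d - yhat b d)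
      - (\<Sum>m<5. g a m * cnj (g b m) * zeta 5 (d * int m))"
    by (simp add: q_def yhat_def ring_distribs sum.distrib sum_subtractf sum_distrib_left mult_ac)
  hence "\<i> * (yhat a d - yhat b d) = (\<Sum>m<5. q m * zeta 5 (d * int m))"
    using z orth[OF ab] by (simp add: d_def)
  hence "cmod (yhat a d - yhat b d) = cmod (\<Sum>m<5. q m * zeta 5 (d * int m))"
    by (metis norm_mult norm_ii mult_1)
  also have "\<dots> \<le> (\<Sum>m<5. cmod (q m))" by (rule order_trans[OF norm_sum]) (simp add: norm_mult)
  also have "\<dots> = (\<Sum>m=1..<5. cmod (q m))"
  proof -
    have "{..<5} = insert 0 {1..<5::nat}" by auto
    thus ?thesis using col0 ab by (simp add: q_def)
  qed
  also have "\<dots> \<le> (\<Sum>m=1..<5::nat. K)" by (rule sum_mono) (use bound in \<open>auto simp: q_def\<close>)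
  finally show ?thesis by (simp add: d_def)
qed

text \<open>The real part of the defect is half the squared distance of \<open>u / v\<close> from 1; the imaginary part is of third
order.\<close>

lemma imag_defect:
  assumes "cmod u = 1" "cmod v = 1" "cmod (u - 1) \<le> e" "cmod (v - 1) \<le> e" "cmod (u * cnj v - 1) \<le> h"
  shows "cmod (1 + \<i> * of_real (Im u - Im v) - u * cnj v) \<le> h\<^sup>2 / 2 + e ^ 3"
proof -
  define q where "q = 1 + \<i> * of_real (Im u - Im v) - u * cnj v"
  note u = unimodular_near_1[OF assms(1,3)] and v = unimodular_near_1[OF assms(2,4)]
  have "cmod (u * cnj v) = 1" using assms by (simp add: norm_mult)
  note w = unimodular_near_1[OF this assms(5)]
  have "Re q = 1 - Re (u * cnj v)" by (simp add: q_def)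
  hence "\<bar>Re q\<bar> \<le> h\<^sup>2 / 2" using w by simp
  moreover have "\<bar>Im q\<bar> \<le> e ^ 3"
  proof -
    have "Im q = Im u * (1 - Re v) - Im v * (1 - Re u)" by (simp add: q_def algebra_simps)
    also have "\<bar>\<dots>\<bar> \<le> \<bar>Im u\<bar> * \<bar>1 - Re v\<bar> + \<bar>Im v\<bar> * \<bar>1 - Re u\<bar>"
      using abs_triangle_ineq4[of "Im u * (1 - Re v)" "Im v * (1 - Re u)"] by (simp add: abs_mult)
    also have "\<dots> \<le> e * (e\<^sup>2 / 2) + e * (e\<^sup>2 / 2)"
      by (intro add_mono mult_mono) (use u v in auto)
    finally show ?thesis by (simp add: power2_eq_square power3_eq_cube)
  qed
  ultimately show ?thesis using cmod_le[of q] by (simp add: q_def)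
qed

text \<open>As 5 is prime, for every frequency \<open>d \<noteq> 0\<close> steps by \<open>d\<close> lead from row \<open>j\<close> to row 0, where \<open>yhat\<close>
vanishes; at most two steps in one of the two directions suffice. Therefore all coefficients
\<open>yhat j d\<close> with \<open>d \<noteq> 0\<close> are small of second order, and so are the imaginary parts themselves, because
they vanish in column 0. Keeping the bound \<open>h\<close> for quotients of rows apart from \<open>e\<close> matters for the
constants: the pentagon estimate controls \<open>h\<close> as well as it controls \<open>e\<close>, whereas the triangle inequality
would only give \<open>h \<le> 2 * e\<close>.\<close>

lemma near_1_improve:
  assumes e: "\<And>j m. j < 5 \<Longrightarrow> m < 5 \<Longrightarrow> cmod (g j m - 1) \<le> e" and e12: "e \<le> 3 / 25"
    and h: "\<And>a b m. a < 5 \<Longrightarrow> b < 5 \<Longrightarrow> m < 5 \<Longrightarrow> cmod (g a m * cnj (g b m) - 1) \<le> h"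
    and jm: "j < 5" "m < 5"
  shows "cmod (g j m - 1) \<le> 101 / 250 * (8 * e\<^sup>2 + 4 * h\<^sup>2 + 8 * e ^ 3)"
proof (cases "j = 0")
  case True
  have "0 \<le> e" using order_trans[OF norm_ge_zero e[of 0 0]] by simp
  thus ?thesis using True jm by (simp add: row0)
next
  case False
  have step: "cmod (yhat a (int a - int b) - yhat b (int a - int b)) \<le> 2 * h\<^sup>2 + 4 * e ^ 3"
    if "a < 5" "b < 5" "a \<noteq> b" for a b
  proof -
    have "cmod (yhat a (int a - int b) - yhat b (int a - int b)) \<le> 4 * (h\<^sup>2 / 2 + e ^ 3)"
      by (rule yhat_step[OF that], rule imag_defect) (use uni e h that in auto)
    thus ?thesis by simp
  qed
  have base1: "cmod (1 + \<i> * of_real (Im u) - u) \<le> e\<^sup>2 / 2"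
    if "cmod u = 1" "cmod (u - 1) \<le> e" for u
  proof -
    have eq: "1 + \<i> * of_real (Im u) - u = of_real (1 - Re u)" by (simp add: complex_eq_iff)
    show ?thesis unfolding eq norm_of_real using unimodular_near_1(1,2)[OF that] by simp
  qed
  have base: "cmod (yhat a (int a)) \<le> 2 * e\<^sup>2" "cmod (yhat a (- int a)) \<le> 2 * e\<^sup>2"
    if a: "0 < a" "a < 5" for a
  proof -
    show "cmod (yhat a (int a)) \<le> 2 * e\<^sup>2"
      using yhat_step[of a 0 "e\<^sup>2 / 2"] base1[OF uni[OF a(2)] e[OF a(2)]] a by (simp add: yhat_0 row0)
    have "cmod (1 - \<i> * of_real (Im (g a m)) - cnj (g a m)) \<le> e\<^sup>2 / 2" if "m < 5" for m
    proof -
      have "1 - \<i> * of_real (Im (g a m)) - cnj (g a m) = cnj (1 + \<i> * of_real (Im (g a m)) - g a m)"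
        by simp
      thus ?thesis using base1[OF uni[OF a(2) that] e[OF a(2) that]] by (simp only: complex_mod_cnj)
    qed
    thus "cmod (yhat a (- int a)) \<le> 2 * e\<^sup>2"
      using yhat_step[of 0 a "e\<^sup>2 / 2"] a by (simp add: yhat_0 row0)
  qed
  define B where "B = 2 * e\<^sup>2 + (2 * h\<^sup>2 + 4 * e ^ 3)"
  \<comment> \<open>Two steps: from row j to a row i = d or i = - d, and from there to row 0.\<close>
  have two: "cmod (yhat j d) \<le> B"
    if i: "0 < i" "i < 5" "i \<noteq> j" and d: "cmod (yhat i d) \<le> 2 * e\<^sup>2"
      "cmod (yhat j d - yhat i d) \<le> 2 * h\<^sup>2 + 4 * e ^ 3" for i d
    using d norm_triangle_ineq[of "yhat j d - yhat i d" "yhat i d"] by (simp add: B_def)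
  have up: "cmod (yhat j d) \<le> B"
    if i: "0 < i" "i < 5" "i \<noteq> j" and d: "(5::int) dvd d - (int i)" "(5::int) dvd d - (int j - int i)" for i d
  proof (rule two[OF i])
    show "cmod (yhat i d) \<le> 2 * e\<^sup>2" unfolding yhat_cong[OF d(1)] by (rule base(1)[OF i(1,2)])
    show "cmod (yhat j d - yhat i d) \<le> 2 * h\<^sup>2 + 4 * e ^ 3"
      unfolding yhat_cong[OF d(2)] by (rule step) (use i jm in auto)
  qed
  have down: "cmod (yhat j d) \<le> B"
    if i: "0 < i" "i < 5" "i \<noteq> j" and d: "(5::int) dvd d - (- int i)" "(5::int) dvd d - (int i - int j)" for i d
  proof (rule two[OF i])
    show "cmod (yhat i d) \<le> 2 * e\<^sup>2" unfolding yhat_cong[OF d(1)] by (rule base(2)[OF i(1,2)])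
    show "cmod (yhat j d - yhat i d) \<le> 2 * h\<^sup>2 + 4 * e ^ 3"
      unfolding yhat_cong[OF d(2)] using step[of i j] i jm by (simp add: norm_minus_commute)
  qed
  have near: "cmod (yhat j d) \<le> 2 * e\<^sup>2" if d: "(5::int) dvd d - (int j) \<or> (5::int) dvd d - (- int j)" for d
    using d
  proof
    assume d: "(5::int) dvd d - (int j)"
    show ?thesis unfolding yhat_cong[OF d] by (rule base(1)) (use jm False in auto)
  next
    assume d: "(5::int) dvd d - (- int j)"
    show ?thesis unfolding yhat_cong[OF d] by (rule base(2)) (use jm False in auto)
  qed
  \<comment> \<open>The frequencies j and - j need one step, the two others need two.\<close>
  have total: "(\<Sum>d=1..<5. cmod (yhat j (int d))) \<le> 2 * (2 * e\<^sup>2) + 2 * B"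
  proof -
    have 4: "{1..<5} = {1, 2, 3, 4::nat}" by auto
    have "j \<in> {1, 2, 3, 4}" using jm False by auto
    thus ?thesis
    proof (elim insertE emptyE)
      assume j: "j = 1"
      show ?thesis unfolding 4 using near[of 1] near[of 4] up[of 3 3] down[of 3 2] j
        by simp
    next
      assume j: "j = 2"
      show ?thesis unfolding 4 using near[of 2] near[of 3] up[of 1 1] down[of 1 4] j
        by simp
    next
      assume j: "j = 3"
      show ?thesis unfolding 4 using near[of 2] near[of 3] up[of 4 4] down[of 4 1] j
        by simp
    next
      assume j: "j = 4"
      show ?thesis unfolding 4 using near[of 1] near[of 4] up[of 2 2] down[of 2 3] j
        by simp
    qed
  qed
  have inv: "5 * complex_of_real (Im (g j l)) = (\<Sum>d<5. zeta 5 (- (int d * int l)) * yhat j (int d))"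
    if "l < 5" for l
    using fourier_inversion[OF that, of "\<lambda>m. of_real (Im (g j m))"] by (simp add: yhat_def mult.commute)
  have "5 * complex_of_real (Im (g j m)) = 5 * complex_of_real (Im (g j m)) - 5 * complex_of_real (Im (g j 0))"
    using col0 jm by simp
  also have "\<dots> = (\<Sum>d<5. (zeta 5 (- (int d * int m)) - 1) * yhat j (int d))"
    unfolding inv[OF jm(2)] inv[of 0, simplified] by (simp add: ring_distribs sum_subtractf)
  also have "\<dots> = (\<Sum>d=1..<5. (zeta 5 (- (int d * int m)) - 1) * yhat j (int d))"
  proof -
    have "{..<5} = insert 0 {1..<5::nat}" by auto
    thus ?thesis by simp
  qed
  finally have "5 * \<bar>Im (g j m)\<bar> = cmod (\<Sum>d=1..<5. (zeta 5 (- (int d * int m)) - 1) * yhat j (int d))"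
    by (metis norm_mult norm_numeral norm_of_real)
  also have "\<dots> \<le> (\<Sum>d=1..<5. 2 * cmod (yhat j (int d)))"
  proof (rule order_trans[OF norm_sum], rule sum_mono)
    fix d :: nat
    have "cmod (zeta 5 (- (int d * int m)) - 1) \<le> 2"
      using norm_triangle_ineq4[of "zeta 5 (- (int d * int m))" 1] by simp
    thus "cmod ((zeta 5 (- (int d * int m)) - 1) * yhat j (int d)) \<le> 2 * cmod (yhat j (int d))"
      by (simp add: norm_mult mult_right_mono)
  qed
  also have "\<dots> \<le> 2 * (2 * (2 * e\<^sup>2) + 2 * B)"
    using total by (simp add: sum_distrib_left[symmetric])
  finally have "\<bar>Im (g j m)\<bar> \<le> 2 / 5 * (8 * e\<^sup>2 + 4 * h\<^sup>2 + 8 * e ^ 3)" by (simp add: B_def)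
  thus ?thesis using unimodular_near_1(4)[OF uni e e12] jm by fastforce
qed

text \<open>The quadratic estimate first improves the bound 3/25 to 19/250. With \<open>h \<le> 2 * e\<close>, it then reads
\<open>e \<le> 4 / 5 * e\<close>.\<close>

theorem rigidity:
  assumes near: "\<And>a b m. a < 5 \<Longrightarrow> b < 5 \<Longrightarrow> m < 5 \<Longrightarrow> cmod (g a m * cnj (g b m) - 1) \<le> 3 / 25"
    and jm: "j < 5" "m < 5"
  shows "g j m = 1"
proof -
  define e where "e = Max ((\<lambda>(a, l). cmod (g a l - 1)) ` ({..<5} \<times> {..<5}))"
  have e_ge: "cmod (g a l - 1) \<le> e" if "a < 5" "l < 5" for a l
    unfolding e_def using that by (intro Max_ge) (auto intro!: image_eqI[of _ _ "(a, l)"])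
  have "e \<in> (\<lambda>(a, l). cmod (g a l - 1)) ` ({..<5} \<times> {..<5})"
    unfolding e_def by (rule Max_in) (auto simp: lessThan_empty_iff)
  then obtain a l where al: "a < 5" "l < 5" "e = cmod (g a l - 1)" by auto
  have near1: "cmod (g a m - 1) \<le> 3 / 25" if "a < 5" "m < 5" for a m
    using near[OF that(1), of 0 m] that by (simp add: row0)
  have "e \<le> 101 / 250 * (8 * (3 / 25)\<^sup>2 + 4 * (3 / 25)\<^sup>2 + 8 * (3 / 25) ^ 3)"
    unfolding al(3) by (rule near_1_improve[OF near1 _ near al(1,2)]) auto
  hence e_small: "e \<le> 19 / 250" by (simp add: power2_eq_square power3_eq_cube)
  have e0: "0 \<le> e" using al by simp
  have "cmod (g a m * cnj (g b m) - 1) \<le> 2 * e" if "a < 5" "b < 5" "m < 5" for a b m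
  proof -
    have "g a m * cnj (g b m) - 1 = (g a m - 1) * cnj (g b m) + cnj (g b m - 1)" by (simp add: algebra_simps)
    hence "cmod (g a m * cnj (g b m) - 1) \<le> cmod ((g a m - 1) * cnj (g b m)) + cmod (cnj (g b m - 1))"
      by (simp only: norm_triangle_ineq)
    also have "\<dots> = cmod (g a m - 1) + cmod (g b m - 1)"
      using uni[OF that(2,3)] by (simp add: norm_mult del: complex_cnj_diff)
    finally show ?thesis using e_ge[OF that(1,3)] e_ge[OF that(2,3)] by simp
  qed
  hence "e \<le> 101 / 250 * (8 * e\<^sup>2 + 4 * (2 * e)\<^sup>2 + 8 * e ^ 3)"
    using near_1_improve[OF e_ge _ _ al(1,2), of "2 * e"] e_small al(3) by simp
  also have "\<dots> = e * (101 / 250 * (24 * e + 8 * (e * e)))"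
    by (simp add: power2_eq_square power3_eq_cube algebra_simps)
  also have "\<dots> \<le> e * (4 / 5)"
  proof (rule mult_left_mono[OF _ e0])
    have "e * e \<le> 19 / 250 * (19 / 250)" by (rule mult_mono) (use e0 e_small in auto)
    thus "101 / 250 * (24 * e + 8 * (e * e)) \<le> 4 / 5" using e_small by simp
  qed
  finally have "e = 0" using e0 by simp
  thus ?thesis using e_ge[OF jm] by simp
qed

end

section \<open>Hadamard matrices of order 5\<close>

text \<open>The quotient of any column by column 0 is almost a regular pentagon and carries labels. Increments of the
labels of two columns never agree, so in terms of the labels of column 1 the others are orthomorphisms,
hence linear.\<close>

lemma hadamard_5_labels:
  fixes h :: "nat \<Rightarrow> nat \<Rightarrow> complex"
  assumes uni: "\<And>j m. j < 5 \<Longrightarrow> m < 5 \<Longrightarrow> cmod (h j m) = 1"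
    and rows: "\<And>j k. j < 5 \<Longrightarrow> k < 5 \<Longrightarrow> j \<noteq> k \<Longrightarrow> (\<Sum>m<5. h j m * cnj (h k m)) = 0"
    and cols: "\<And>m l. m < 5 \<Longrightarrow> l < 5 \<Longrightarrow> m \<noteq> l \<Longrightarrow> (\<Sum>j<5. h j m * cnj (h j l)) = 0"
  obtains r s :: "nat \<Rightarrow> nat" where "bij_betw r {..<5} {..<5}" "bij_betw s {..<5} {..<5}" "r 0 = 0" "s 0 = 0"
    "\<And>j k m. j < 5 \<Longrightarrow> k < 5 \<Longrightarrow> m < 5 \<Longrightarrow>
       cmod (h j m * cnj (h j 0) * cnj (h k m * cnj (h k 0)) - zeta 5 ((int (r j) - int (r k)) * int (s m))) \<le> 3 / 25"
proof -
  define z where "z = (\<lambda>m j. h j m * cnj (h j 0))"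
  have zu: "cmod (z m j) = 1" if "m < 5" "j < 5" for m j using uni that by (simp add: z_def norm_mult)
  have hh: "h j m * cnj (h j m) = 1" if "j < 5" "m < 5" for j m
    using uni[OF that] complex_norm_square[of "h j m"] by simp
  have "\<exists>k. k 0 = 0 \<and> bij_betw k {..<5} {..<5::nat} \<and> (\<forall>p q. p < 5 \<longrightarrow> q < 5 \<longrightarrow>
      cmod (z m p * cnj (z m q) - zeta 5 (int (k p) - int (k q))) \<le> 3 / 25)"
    if m: "0 < m" "m < 5" for m
  proof -
    have "Re (z m p * cnj (z m q)) \<le> 1 / 3" if "p < 5" "q < 5" "p \<noteq> q" for p q
      using haagerup_cross_ratio[OF uni rows cols m(2) _ _ that, of 0] m by (simp add: z_def)
    then obtain k where "k 0 = 0" "bij_betw k {..<5} {..<5::nat}"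
      "\<And>p q. p < 5 \<Longrightarrow> q < 5 \<Longrightarrow> cmod (z m p * cnj (z m q) - zeta 5 (int (k p) - int (k q))) \<le> 3 / 25"
      using pentagon_labels[of "z m"] zu[OF m(2)] by blast
    thus ?thesis by blast
  qed
  then obtain K where K0: "\<And>m. 0 < m \<Longrightarrow> m < 5 \<Longrightarrow> K m 0 = 0"
    and Kbij: "\<And>m. 0 < m \<Longrightarrow> m < 5 \<Longrightarrow> bij_betw (K m) {..<5} {..<5::nat}"
    and Knear: "\<And>m p q. 0 < m \<Longrightarrow> m < 5 \<Longrightarrow> p < 5 \<Longrightarrow> q < 5 \<Longrightarrow>
      cmod (z m p * cnj (z m q) - zeta 5 (int (K m p) - int (K m q))) \<le> 3 / 25"
    by metis
  have K5: "K m j < 5" if "0 < m" "m < 5" "j < 5" for m j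
    using Kbij[OF that(1,2)] that(3) by (auto simp: bij_betw_def)
  \<comment> \<open>Two columns whose labels have equal increments would have a cross ratio close to 1.\<close>
  have K_diff: "\<not> (5::int) dvd (int (K m p) - int (K m q)) - (int (K l p) - int (K l q))"
    if ml: "0 < m" "m < 5" "0 < l" "l < 5" "m \<noteq> l" and pq: "p < 5" "q < 5" "p \<noteq> q" for m l p q
  proof
    assume "(5::int) dvd (int (K m p) - int (K m q)) - (int (K l p) - int (K l q))"
    hence eq: "zeta 5 (int (K m p) - int (K m q)) = zeta 5 (int (K l p) - int (K l q))"
      by (simp add: zeta_eq_iff)
    define u where "u = z m p * cnj (z m q)"
    define v where "v = z l p * cnj (z l q)"
    have "cmod (u - v) \<le> 6 / 25"
      using norm_triangle_ineq4[of "u - zeta 5 (int (K m p) - int (K m q))" "v - zeta 5 (int (K m p) - int (K m q))"]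
        Knear[OF ml(1,2) pq(1,2)] Knear[OF ml(3,4) pq(1,2)] unfolding u_def v_def eq by simp
    hence "(cmod (u - v))\<^sup>2 \<le> (6 / 25)\<^sup>2" by (intro power_mono) auto
    moreover have "(cmod (u - v))\<^sup>2 = (cmod u)\<^sup>2 + (cmod v)\<^sup>2 - 2 * Re (u * cnj v)"
      unfolding cmod_power2 by (simp add: power2_eq_square algebra_simps)
    moreover have "cmod u = 1" "cmod v = 1" using zu ml pq by (simp_all add: u_def v_def norm_mult)
    moreover have "u * cnj v = h p m * cnj (h p l) * cnj (h q m * cnj (h q l))"
    proof -
      have "u * cnj v = h p m * cnj (h p l) * cnj (h q m * cnj (h q l)) * (h p 0 * cnj (h p 0)) * (h q 0 * cnj (h q 0))"
        by (simp add: u_def v_def z_def mult_ac)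
      thus ?thesis using hh pq by simp
    qed
    ultimately show False
      using haagerup_cross_ratio[OF uni rows cols ml(2,4,5) pq] by (simp add: power2_eq_square)
  qed
  define r where "r = K 1"
  have r: "bij_betw r {..<5} {..<5}" "r 0 = 0" using Kbij[of 1] K0[of 1] by (simp_all add: r_def)
  have r5: "r j < 5" if "j < 5" for j using K5[of 1 j] that by (simp add: r_def)
  define J where "J = inv_into {..<5} r"
  have J: "J x < 5" "r (J x) = x" if "x < 5" for x
    using r(1) that inv_into_into[of x r "{..<5}"] f_inv_into_f[of x r "{..<5}"]
    by (auto simp: J_def bij_betw_def)
  have Jr: "J (r j) = j" if "j < 5" for j using r(1) that by (simp add: J_def bij_betw_def)
  have "\<exists>c. c < 5 \<and> (\<forall>j<5. K m j = c * r j mod 5)" if m: "0 < m" "m < 5" for m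
  proof (cases "m = 1")
    case True
    thus ?thesis using r5 by (intro exI[of _ 1]) (simp add: r_def)
  next
    case False
    have J0: "J 0 = 0" using Jr[of 0] r by simp
    have inj: "inj_on (\<lambda>x. K m (J x)) {..<5}"
    proof (rule inj_onI)
      fix x y assume xy: "x \<in> {..<5}" "y \<in> {..<5}" "K m (J x) = K m (J y)"
      hence "J x = J y"
        using inj_onD[OF bij_betw_imp_inj_on[OF Kbij[OF m]] xy(3)] J(1) by simp
      hence "r (J x) = r (J y)" by simp
      thus "x = y" using J(2) xy(1,2) by simp
    qed
    have ortho: "\<not> (5::int) dvd (int (K m (J x)) - int (K m (J y))) - (int x - int y)"
      if "x < 5" "y < 5" "x \<noteq> y" for x y
    proof -
      have "K 1 (J x) = x" "K 1 (J y) = y" using J(2) that by (simp_all add: r_def)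
      moreover have "J x \<noteq> J y" using J(2)[of x] J(2)[of y] that by metis
      ultimately show ?thesis using K_diff[OF m, of 1 "J x" "J y"] False J(1) that by simp
    qed
    have range: "K m (J x) < 5" if "x < 5" for x using K5[OF m] J(1)[OF that] by simp
    have "K m (J 0) = 0" using J0 K0[OF m] by simp
    from orthomorphism_5_linear[OF this range inj ortho]
    obtain c where c: "\<And>x. x < 5 \<Longrightarrow> K m (J x) = c * x mod 5" by blast
    have "K m j = (c mod 5) * r j mod 5" if "j < 5" for j
      using c[of "r j"] Jr[OF that] r5[OF that] by (simp add: mod_simps)
    thus ?thesis by (intro exI[of _ "c mod 5"]) auto
  qed
  then obtain c where c: "\<And>m. 0 < m \<Longrightarrow> m < 5 \<Longrightarrow> c m < 5"
    "\<And>m j. 0 < m \<Longrightarrow> m < 5 \<Longrightarrow> j < 5 \<Longrightarrow> K m j = c m * r j mod 5" by metis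
  define s where "s = (\<lambda>m. if m = 0 then 0 else c m)"
  have zK: "zeta 5 (int (K m j) - int (K m k)) = zeta 5 ((int (r j) - int (r k)) * int (s m))"
    if "0 < m" "m < 5" "j < 5" "k < 5" for m j k
  proof -
    have "zeta 5 (int (K m i)) = zeta 5 (int (r i) * int (s m))" if "i < 5" for i
    proof -
      have "int (K m i) = int (r i) * int (s m) mod int 5"
        using c(2)[OF \<open>0 < m\<close> \<open>m < 5\<close> that] \<open>0 < m\<close> by (simp add: s_def zmod_int mult.commute)
      thus ?thesis using zeta_mod[of 5 "int (r i) * int (s m)"] by simp
    qed
    thus ?thesis using that by (simp add: zeta_diff left_diff_distrib)
  qed
  have near: "cmod (z m j * cnj (z m k) - zeta 5 ((int (r j) - int (r k)) * int (s m))) \<le> 3 / 25"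
    if "j < 5" "k < 5" "m < 5" for j k m
  proof (cases "m = 0")
    case True
    thus ?thesis using hh that by (simp add: z_def s_def)
  next
    case False
    thus ?thesis using Knear[of m j k] zK[of m j k] that by simp
  qed
  have c_nz: "c m \<noteq> 0" if "0 < m" "m < 5" for m
  proof
    assume "c m = 0"
    hence "K m 0 = K m 1" using c(2)[OF that] by simp
    thus False using inj_onD[OF bij_betw_imp_inj_on[OF Kbij[OF that]], of 0 1] by simp
  qed
  have c_ne: "c m \<noteq> c l" if "0 < m" "m < 5" "0 < l" "l < 5" "m \<noteq> l" for m l
  proof
    assume "c m = c l"
    hence "K m 0 = K l 0" "K m 1 = K l 1" using c(2) that by simp_all
    thus False using K_diff[OF that, of 0 1] by simp
  qed
  have "inj_on s {..<5}"
  proof (rule inj_onI)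
    fix x y assume "x \<in> {..<5}" "y \<in> {..<5}" "s x = s y"
    thus "x = y" using c_nz[of x] c_nz[of y] c_ne[of x y]
      by (cases "x = 0"; cases "y = 0") (auto simp: s_def)
  qed
  moreover have "s ` {..<5} \<subseteq> {..<5}" using c(1) by (auto simp: s_def)
  ultimately have "bij_betw s {..<5} {..<5}"
    using endo_inj_surj[of "{..<5}" s] by (simp add: bij_betw_def)
  thus ?thesis using that[of r s] r near by (simp add: s_def z_def)
qed

text \<open>After sorting rows and columns by their labels and normalizing phases, the matrix is close enough to the
Fourier matrix for the rigidity theorem.\<close>

theorem hadamard_5_is_fourier:
  fixes h :: "nat \<Rightarrow> nat \<Rightarrow> complex"
  assumes uni: "\<And>j m. j < 5 \<Longrightarrow> m < 5 \<Longrightarrow> cmod (h j m) = 1"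
    and rows: "\<And>j k. j < 5 \<Longrightarrow> k < 5 \<Longrightarrow> j \<noteq> k \<Longrightarrow> (\<Sum>m<5. h j m * cnj (h k m)) = 0"
    and cols: "\<And>m l. m < 5 \<Longrightarrow> l < 5 \<Longrightarrow> m \<noteq> l \<Longrightarrow> (\<Sum>j<5. h j m * cnj (h j l)) = 0"
  obtains a b and r s :: "nat \<Rightarrow> nat" where "bij_betw r {..<5} {..<5}" "bij_betw s {..<5} {..<5}"
    "\<And>j. j < 5 \<Longrightarrow> cmod (a j) = 1" "\<And>m. m < 5 \<Longrightarrow> cmod (b m) = 1"
    "\<And>j m. j < 5 \<Longrightarrow> m < 5 \<Longrightarrow> h j m = a j * b m * zeta 5 (int (r j) * int (s m))"
proof -
  obtain r s :: "nat \<Rightarrow> nat" where rb: "bij_betw r {..<5} {..<5}"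
    and sb: "bij_betw s {..<5} {..<5}" and r0: "r 0 = 0" and s0: "s 0 = 0"
    and near: "\<And>j k m. j < 5 \<Longrightarrow> k < 5 \<Longrightarrow> m < 5 \<Longrightarrow>
       cmod (h j m * cnj (h j 0) * cnj (h k m * cnj (h k 0)) - zeta 5 ((int (r j) - int (r k)) * int (s m))) \<le> 3 / 25"
    by (rule hadamard_5_labels[OF uni rows cols]) (assumption | rule that)+
  note r = rb r0 and s = sb s0
  have hh: "h j m * cnj (h j m) = 1" "cnj (h j m) * h j m = 1" if "j < 5" "m < 5" for j m
    using uni[OF that] complex_norm_square[of "h j m"] by (simp_all add: mult.commute)
  define J where "J = inv_into {..<5} r"
  define C where "C = inv_into {..<5} s"
  have J: "J x < 5" "r (J x) = x" if "x < 5" for x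
    using r(1) that inv_into_into[of x r "{..<5}"] f_inv_into_f[of x r "{..<5}"]
    by (auto simp: J_def bij_betw_def)
  have C: "C x < 5" "s (C x) = x" if "x < 5" for x
    using s(1) that inv_into_into[of x s "{..<5}"] f_inv_into_f[of x s "{..<5}"]
    by (auto simp: C_def bij_betw_def)
  have Jr: "J (r j) = j" "r j < 5" if "j < 5" for j using r(1) that by (auto simp: J_def bij_betw_def)
  have Cs: "C (s j) = j" "s j < 5" if "j < 5" for j using s(1) that by (auto simp: C_def bij_betw_def)
  have bijC: "bij_betw C {..<5} {..<5}" unfolding C_def using s(1) by (rule bij_betw_inv_into)
  have J0: "J 0 = 0" "C 0 = 0" using Jr(1)[of 0] Cs(1)[of 0] r(2) s(2) by simp_all
  define w where "w = (\<lambda>j m. h j m * cnj (h j 0))"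
  have wu: "cmod (w j m) = 1" if "j < 5" "m < 5" for j m using uni that by (simp add: w_def norm_mult)
  have ww: "w j m * cnj (w j m) = 1" if "j < 5" "m < 5" for j m
    using wu[OF that] complex_norm_square[of "w j m"] by simp
  define g where "g = (\<lambda>x y. w (J x) (C y) * cnj (w 0 (C y)) * zeta 5 (- (int x * int y)))"
  have gg: "g a y * cnj (g b y) = w (J a) (C y) * cnj (w (J b) (C y)) * zeta 5 (- ((int a - int b) * int y))"
    if "a < 5" "b < 5" "y < 5" for a b y
  proof -
    have "g a y * cnj (g b y) = w (J a) (C y) * cnj (w (J b) (C y)) * (w 0 (C y) * cnj (w 0 (C y)))
        * (zeta 5 (- (int a * int y)) * zeta 5 (int b * int y))"
      by (simp add: g_def cnj_zeta mult_ac)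
    also have "zeta 5 (- (int a * int y)) * zeta 5 (int b * int y) = zeta 5 (- ((int a - int b) * int y))"
      by (simp add: zeta_add[symmetric] algebra_simps)
    finally show ?thesis using ww[of 0 "C y"] C that by simp
  qed
  have zz: "zeta 5 (- k) * zeta 5 k = 1" for k by (simp add: zeta_add[symmetric])
  interpret twisted_fourier_5 g
  proof
    fix j m :: nat assume jm: "j < 5" "m < 5"
    show "cmod (g j m) = 1" using wu J C jm by (simp add: g_def norm_mult)
  next
    fix m :: nat assume "m < 5"
    thus "g 0 m = 1" using ww[of 0 "C m"] C by (simp add: g_def J0)
  next
    fix j :: nat assume "j < 5"
    thus "g j 0 = 1" using hh J by (simp add: g_def J0 w_def)
  next
    fix a b :: nat assume ab: "a < 5" "b < 5" "a \<noteq> b"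
    have term_eq: "g a m * cnj (g b m) * zeta 5 ((int a - int b) * int m)
        = (cnj (h (J a) 0) * h (J b) 0) * (h (J a) (C m) * cnj (h (J b) (C m)))" if "m < 5" for m
    proof -
      have "g a m * cnj (g b m) * zeta 5 ((int a - int b) * int m) = w (J a) (C m) * cnj (w (J b) (C m))"
        unfolding gg[OF ab(1,2) that] mult.assoc zz by simp
      thus ?thesis by (simp add: w_def mult_ac)
    qed
    have "(\<Sum>m<5. g a m * cnj (g b m) * zeta 5 ((int a - int b) * int m))
        = (cnj (h (J a) 0) * h (J b) 0) * (\<Sum>m<5. h (J a) (C m) * cnj (h (J b) (C m)))"
      unfolding sum_distrib_left by (rule sum.cong[OF refl], rule term_eq) simp
    moreover have "(\<Sum>m<5. h (J a) (C m) * cnj (h (J b) (C m))) = (\<Sum>m<5. h (J a) m * cnj (h (J b) m))"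
      by (rule sum.reindex_bij_betw[OF bijC, of "\<lambda>m. h (J a) m * cnj (h (J b) m)"])
    moreover have "(\<Sum>m<5. h (J a) m * cnj (h (J b) m)) = 0"
    proof (rule rows)
      show "J a \<noteq> J b" using J(2)[OF ab(1)] J(2)[OF ab(2)] ab(3) by metis
    qed (rule J(1), rule ab)+
    ultimately show "(\<Sum>m<5. g a m * cnj (g b m) * zeta 5 ((int a - int b) * int m)) = 0"
      by (simp only: mult_zero_right)
  qed
  have "cmod (g a m * cnj (g b m) - 1) \<le> 3 / 25" if "a < 5" "b < 5" "m < 5" for a b m
  proof -
    define X where "X = (int a - int b) * int m"
    define Z where "Z = zeta 5 X"
    have g_eq: "g a m * cnj (g b m) = w (J a) (C m) * cnj (w (J b) (C m)) * zeta 5 (- X)"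
      unfolding X_def by (rule gg[OF that])
    have "g a m * cnj (g b m) - 1 = (w (J a) (C m) * cnj (w (J b) (C m)) - Z) * cnj Z"
      unfolding g_eq Z_def cnj_zeta left_diff_distrib
      using zz[of X] by (simp add: mult.commute)
    hence "cmod (g a m * cnj (g b m) - 1) = cmod (w (J a) (C m) * cnj (w (J b) (C m)) - Z)"
      by (simp add: norm_mult Z_def)
    also have "\<dots> \<le> 3 / 25"
      using near[of "J a" "J b" "C m"] J C that by (simp add: w_def Z_def X_def)
    finally show ?thesis .
  qed
  note g1 = rigidity[OF this]
  have "h j m = h j 0 * w 0 m * zeta 5 (int (r j) * int (s m))" if jm: "j < 5" "m < 5" for j m
  proof -
    define X where "X = int (r j) * int (s m)"
    have "g (r j) (s m) = 1" using g1 Jr Cs jm by simp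
    hence one: "w j m * cnj (w 0 m) * zeta 5 (- X) = 1" using Jr Cs jm by (simp add: g_def X_def)
    have "(w j m * cnj (w 0 m) * zeta 5 (- X)) * (w 0 m * zeta 5 X)
        = w j m * (w 0 m * cnj (w 0 m)) * (zeta 5 (- X) * zeta 5 X)"
      by (simp only: mult_ac)
    hence w_eq: "w 0 m * zeta 5 X = w j m" unfolding one using ww[of 0 m] jm zz[of X] by simp
    have "h j m = h j 0 * w j m" using hh[of j 0] jm by (simp add: w_def mult_ac)
    thus ?thesis unfolding w_eq[symmetric] by (simp add: X_def mult.assoc)
  qed
  note factored = this
  show ?thesis by (rule that[OF rb sb _ _ factored]) (simp_all add: assms(1) wu)
qed

section \<open>Shifts of Hadamard matrices\<close>

text \<open>If \<open>h = sqrt n * U\<close> with a unitary \<open>U\<close>, these are the entries of \<open>n * U D U\<^sup>*\<close>, where \<open>D\<close> is the diagonal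
matrix of the roots of unity.\<close>

definition gram_shift :: "nat \<Rightarrow> (nat \<Rightarrow> nat \<Rightarrow> complex) \<Rightarrow> nat \<Rightarrow> nat \<Rightarrow> complex" where
  "gram_shift n h j k = (\<Sum>m<n. zeta n (int m) * (h j m * cnj (h k m)))"

text \<open>The modulus \<open>n\<close> matches the factor \<open>n\<close> in \<open>gram_shift\<close>. For a matrix with rows of norm \<open>n\<close>
this means that every row has a single nonzero entry.\<close>

definition monomial_entries :: "nat \<Rightarrow> (nat \<Rightarrow> nat \<Rightarrow> complex) \<Rightarrow> bool" where
  "monomial_entries n M \<longleftrightarrow> (\<forall>j<n. \<forall>k<n. M j k = 0 \<or> cmod (M j k) = real n)"

lemma unimodular_mult_cnj: "cmod x = 1 \<Longrightarrow> x * cnj x = 1"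
  using complex_norm_square[of x] by simp

text \<open>If the roots of unity attached to the rows form a geometric progression in the row labels of a Fourier
matrix, then the shift in the dual basis is a sum over a single geometric progression.\<close>

lemma gram_shift_fourier_rows:
  assumes r: "bij_betw r {..<n} {..<n::nat}"
    and a: "\<And>j. j < n \<Longrightarrow> cmod (a j) = 1" and b: "\<And>m. m < n \<Longrightarrow> cmod (b m) = 1"
    and h: "\<And>j m. j < n \<Longrightarrow> m < n \<Longrightarrow> h j m = a j * b m * zeta n (int (r j) * S m)"
    and lin: "\<And>j. j < n \<Longrightarrow> zeta n (int j) = zeta n (k0 + t * int (r j))"
  shows "monomial_entries n (gram_shift n (\<lambda>m j. cnj (h j m)))"
  unfolding monomial_entries_def
proof (intro allI impI)
  fix m l assume ml: "m < n" "l < n"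
  have n: "n > 0" using ml by simp
  have term_eq: "zeta n (int j) * (cnj (h j m) * cnj (cnj (h j l)))
      = cnj (b m) * b l * zeta n k0 * zeta n ((t + S l - S m) * int (r j))" if "j < n" for j
  proof -
    have "zeta n (int j) * (cnj (h j m) * cnj (cnj (h j l)))
        = (a j * cnj (a j)) * (cnj (b m) * b l) *
          (zeta n (k0 + t * int (r j)) * zeta n (- (int (r j) * S m)) * zeta n (int (r j) * S l))"
      unfolding h[OF that ml(1)] h[OF that ml(2)] lin[OF that] by (simp add: cnj_zeta mult_ac)
    also have "zeta n (k0 + t * int (r j)) * zeta n (- (int (r j) * S m)) * zeta n (int (r j) * S l)
        = zeta n k0 * zeta n ((t + S l - S m) * int (r j))"
      unfolding zeta_add[symmetric] by (simp add: algebra_simps)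
    finally show ?thesis using unimodular_mult_cnj[OF a[OF that]] by (simp add: mult.assoc)
  qed
  have "gram_shift n (\<lambda>m j. cnj (h j m)) m l
      = cnj (b m) * b l * zeta n k0 * (\<Sum>j<n. zeta n ((t + S l - S m) * int (r j)))"
    unfolding gram_shift_def sum_distrib_left by (rule sum.cong[OF refl], rule term_eq) simp
  also have "(\<Sum>j<n. zeta n ((t + S l - S m) * int (r j))) = (\<Sum>y<n. zeta n ((t + S l - S m) * int y))"
    by (rule sum.reindex_bij_betw[OF r, of "\<lambda>y. zeta n ((t + S l - S m) * int y)"])
  finally show "gram_shift n (\<lambda>m j. cnj (h j m)) m l = 0 \<or> cmod (gram_shift n (\<lambda>m j. cnj (h j m)) m l) = real n"
    using b[OF ml(1)] b[OF ml(2)] by (simp add: sum_zeta[OF n] norm_mult)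
qed

text \<open>Up to the reindexing by \<open>s\<close>, \<open>f\<close> is the Fourier transform of a unimodular sequence, whose autocorrelation
is the transform of the constant 1.\<close>

lemma fourier_autocorrelation:
  assumes s: "bij_betw s {..<n} {..<n::nat}" and n: "n > 0"
    and x: "\<And>m. m < n \<Longrightarrow> cmod (x m) = 1"
  defines "f \<equiv> \<lambda>d :: int. \<Sum>m<n. x m * zeta n (d * int (s m))"
  shows "(\<Sum>d<n. f (int d) * cnj (f (int d + e))) = (if int n dvd e then (of_nat n)\<^sup>2 else 0)"
proof -
  have prod: "f (int d) * cnj (f (int d + e)) = (\<Sum>m<n. \<Sum>l<n.
      x m * cnj (x l) * zeta n (- e * int (s l)) * zeta n ((int (s m) - int (s l)) * int d))" for d
  proof -
    have "x m * zeta n (int d * int (s m)) * cnj (x l * zeta n ((int d + e) * int (s l)))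
        = x m * cnj (x l) * zeta n (- e * int (s l)) * zeta n ((int (s m) - int (s l)) * int d)" for m l
    proof -
      have "zeta n (int d * int (s m)) * zeta n (- ((int d + e) * int (s l)))
          = zeta n (- e * int (s l)) * zeta n ((int (s m) - int (s l)) * int d)"
        unfolding zeta_add[symmetric] by (simp add: algebra_simps)
      thus ?thesis unfolding complex_cnj_mult cnj_zeta by (metis (no_types, lifting) mult.assoc mult.left_commute)
    qed
    thus ?thesis by (simp only: f_def cnj_sum sum_product)
  qed
  have orth: "(\<Sum>d<n. zeta n ((int (s m) - int (s l)) * int d)) = (if m = l then of_nat n else 0)"
    if "m < n" "l < n" for m l
  proof -
    have "s m < n" "s l < n" using s that by (auto simp: bij_betw_def)
    moreover have "s m = s l \<longleftrightarrow> m = l" using s that by (auto simp: bij_betw_def inj_on_eq_iff)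
    ultimately show ?thesis using sum_zeta[OF n, of "int (s m) - int (s l)"] dvd_int_diff_iff by simp
  qed
  have "(\<Sum>d<n. f (int d) * cnj (f (int d + e))) = (\<Sum>m<n. \<Sum>l<n.
      x m * cnj (x l) * zeta n (- e * int (s l)) * (\<Sum>d<n. zeta n ((int (s m) - int (s l)) * int d)))"
  proof -
    have "(\<Sum>d<n. f (int d) * cnj (f (int d + e))) = (\<Sum>m<n. \<Sum>d<n. \<Sum>l<n.
      x m * cnj (x l) * zeta n (- e * int (s l)) * zeta n ((int (s m) - int (s l)) * int d))"
      unfolding prod by (rule sum.swap)
    also have "\<dots> = (\<Sum>m<n. \<Sum>l<n. \<Sum>d<n.
      x m * cnj (x l) * zeta n (- e * int (s l)) * zeta n ((int (s m) - int (s l)) * int d))"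
      by (rule sum.cong[OF refl], rule sum.swap)
    finally show ?thesis by (simp only: sum_distrib_left)
  qed
  also have "\<dots> = (\<Sum>m<n. \<Sum>l<n. if m = l then of_nat n * zeta n (- e * int (s l)) else 0)"
  proof (intro sum.cong refl)
    fix m l assume "m \<in> {..<n}" "l \<in> {..<n}"
    thus "x m * cnj (x l) * zeta n (- e * int (s l)) * (\<Sum>d<n. zeta n ((int (s m) - int (s l)) * int d))
        = (if m = l then of_nat n * zeta n (- e * int (s l)) else 0)"
      using orth[of m l] unimodular_mult_cnj[OF x[of l]] by simp
  qed
  also have "\<dots> = of_nat n * (\<Sum>m<n. zeta n (- e * int (s m)))"
    by (simp add: sum_distrib_left)
  also have "(\<Sum>m<n. zeta n (- e * int (s m))) = (\<Sum>y<n. zeta n (- e * int y))"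
    by (rule sum.reindex_bij_betw[OF s, of "\<lambda>y. zeta n (- e * int y)"])
  finally show ?thesis unfolding sum_zeta[OF n] by (simp add: power2_eq_square)
qed

lemma inverse_one_minus_unimodular:
  assumes "cmod x = 1" "x \<noteq> 1"
  shows "1 / (1 - x) + 1 / (1 - cnj x) = 1"
proof -
  have "x \<noteq> 0" using assms by auto
  hence "cnj x = 1 / x" using unimodular_mult_cnj[OF assms(1)] by (simp add: field_simps)
  thus ?thesis using assms(2) \<open>x \<noteq> 0\<close> by (simp add: divide_simps) (simp add: algebra_simps)
qed

text \<open>The terms are the numbers \<open>1 / (1 - x)\<close> for the fifth roots of unity \<open>x \<noteq> 1\<close>. They add up to 1 on each of
the two pairs of conjugate roots.\<close>

lemma sum_root_quotients_5:
  assumes "j < 5"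
  shows "(\<Sum>k\<in>{..<5} - {j}. zeta 5 (int j) / (zeta 5 (int j) - zeta 5 (int k))) = 2"
proof -
  define v where "v = (\<lambda>i :: int. 1 / (1 - zeta 5 i))"
  have q: "zeta 5 (int j) / (zeta 5 (int j) - zeta 5 (int k)) = v (int k - int j)" for k
  proof -
    have "zeta 5 (int k) = zeta 5 (int j) * zeta 5 (int k - int j)" by (simp add: zeta_add[symmetric])
    hence "zeta 5 (int j) - zeta 5 (int k) = zeta 5 (int j) * (1 - zeta 5 (int k - int j))"
      by (simp add: right_diff_distrib)
    thus ?thesis by (simp add: v_def)
  qed
  have neg: "v i + v (- i) = 1" if "\<not> 5 dvd i" for i
    using inverse_one_minus_unimodular[of "zeta 5 i"] that by (simp add: v_def cnj_zeta zeta_eq_1_iff)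
  have per: "v i = v (i - 5)" for i using zeta_eq_iff[of 5 i "i - 5"] by (simp add: v_def)
  have 5: "{..<5} = {0, 1, 2, 3, 4::nat}" by auto
  have "j \<in> {0, 1, 2, 3, 4}" using assms by auto
  moreover have "v (- 1) = 1 - v 1" "v (- 2) = 1 - v 2"
    using neg[of 1] neg[of 2] by (simp_all add: eq_diff_eq add.commute)
  moreover from this have "v 4 = 1 - v 1" "v 3 = 1 - v 2" using per[of 4] per[of 3] by simp_all
  moreover have "v (- 4) = v 1" "v (- 3) = v 2" using per[of 1] per[of 2] by simp_all
  ultimately show ?thesis unfolding q
    by (elim insertE emptyE) (simp_all add: 5 insert_Diff_if)
qed

section \<open>The dichotomy in order 5\<close>

text \<open>In terms of the labels \<open>r\<close>, the product \<open>gram_shift j k * gram_shift k j\<close> is an even function \<open>c\<close> of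
\<open>r j - r k\<close>. By the first family of equations its values are \<open>c 1\<close> and \<open>- c 1\<close>.
If they vanish, then \<open>f d * f (- d) = 0\<close> for the function \<open>f\<close> of differences that describes \<open>gram_shift\<close>,
and the autocorrelation leaves room for a single nonzero value of \<open>f\<close>.
If not, the second family says that the numbers \<open>A x / (A x - A y)\<close>, where \<open>A x\<close> is the root of unity
belonging to the row with label \<open>x\<close>, have the same sum over the two neighbours \<open>y\<close> of \<open>x\<close> as over the two
other labels. The total is 2, so both sums are 1, which means \<open>A (x - 1) * A (x + 1) = A x * A x\<close>: the
roots form a geometric progression.\<close>

theorem dichotomy_5:
  fixes h :: "nat \<Rightarrow> nat \<Rightarrow> complex"
  assumes uni: "\<And>j m. j < 5 \<Longrightarrow> m < 5 \<Longrightarrow> cmod (h j m) = 1"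
    and rows: "\<And>j k. j < 5 \<Longrightarrow> k < 5 \<Longrightarrow> j \<noteq> k \<Longrightarrow> (\<Sum>m<5. h j m * cnj (h k m)) = 0"
    and cols: "\<And>m l. m < 5 \<Longrightarrow> l < 5 \<Longrightarrow> m \<noteq> l \<Longrightarrow> (\<Sum>j<5. h j m * cnj (h j l)) = 0"
    and sum0: "\<And>j. j < 5 \<Longrightarrow> (\<Sum>k<5. gram_shift 5 h j k * gram_shift 5 h k j) = 0"
    and sum1: "\<And>j. j < 5 \<Longrightarrow> (\<Sum>k\<in>{..<5} - {j}. gram_shift 5 h j k * gram_shift 5 h k j
      / (zeta 5 (int j) - zeta 5 (int k))) = 0"
  shows "monomial_entries 5 (gram_shift 5 h) \<or> monomial_entries 5 (gram_shift 5 (\<lambda>m j. cnj (h j m)))"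
proof -
  obtain a b and r s :: "nat \<Rightarrow> nat" where r: "bij_betw r {..<5} {..<5}" and s: "bij_betw s {..<5} {..<5}"
    and a: "\<And>j. j < 5 \<Longrightarrow> cmod (a j) = 1" and b: "\<And>m. m < 5 \<Longrightarrow> cmod (b m) = 1"
    and h: "\<And>j m. j < 5 \<Longrightarrow> m < 5 \<Longrightarrow> h j m = a j * b m * zeta 5 (int (r j) * int (s m))"
    by (rule hadamard_5_is_fourier[OF uni rows cols]) (assumption | rule that)+
  have r5: "r j < 5" if "j < 5" for j using r that by (auto simp: bij_betw_def)
  define J where "J = inv_into {..<5} r"
  have J5: "J x < 5" and rJ: "r (J x) = x" if "x < 5" for x
    using r that inv_into_into[of x r "{..<5}"] f_inv_into_f[of x r "{..<5}"]
    by (auto simp: J_def bij_betw_def)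
  have Jr: "J (r j) = j" if "j < 5" for j using r that by (simp add: J_def bij_betw_def)
  have bijJ: "bij_betw J {..<5} {..<5}" unfolding J_def using r by (rule bij_betw_inv_into)
  define f where "f = (\<lambda>d :: int. \<Sum>m<5. zeta 5 (int m) * zeta 5 (d * int (s m)))"
  have per: "f d = f e" if "5 dvd d - e" for d e
  proof -
    have "zeta 5 (d * int m) = zeta 5 (e * int m)" for m
      using that by (simp add: zeta_eq_iff flip: left_diff_distrib)
    thus ?thesis by (simp add: f_def)
  qed
  have f0: "f 0 = 0" using sum_zeta_eq_0[of 1 5] by (simp add: f_def)
  have gs: "gram_shift 5 h j k = a j * cnj (a k) * f (int (r j) - int (r k))" if "j < 5" "k < 5" for j k
    unfolding gram_shift_def f_def sum_distrib_left
  proof (rule sum.cong[OF refl])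
    fix m :: nat assume "m \<in> {..<5}"
    hence m: "m < 5" by simp
    have "zeta 5 (int m) * (h j m * cnj (h k m)) = a j * cnj (a k) * (b m * cnj (b m)) *
        (zeta 5 (int m) * (zeta 5 (int (r j) * int (s m)) * zeta 5 (- (int (r k) * int (s m)))))"
      unfolding h[OF that(1) m] h[OF that(2) m] by (simp add: cnj_zeta mult_ac)
    also have "zeta 5 (int (r j) * int (s m)) * zeta 5 (- (int (r k) * int (s m)))
        = zeta 5 ((int (r j) - int (r k)) * int (s m))"
      unfolding zeta_add[symmetric] by (simp add: algebra_simps)
    finally show "zeta 5 (int m) * (h j m * cnj (h k m)) = a j * cnj (a k) *
        (zeta 5 (int m) * zeta 5 ((int (r j) - int (r k)) * int (s m)))"
      using unimodular_mult_cnj[OF b[OF m]] by (simp add: mult.assoc)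
  qed
  define c where "c = (\<lambda>d. f d * f (- d))"
  have prod: "gram_shift 5 h j k * gram_shift 5 h k j = c (int (r j) - int (r k))" if "j < 5" "k < 5" for j k
  proof -
    have "gram_shift 5 h j k * gram_shift 5 h k j
        = (a j * cnj (a j)) * (a k * cnj (a k)) * c (int (r j) - int (r k))"
      unfolding gs[OF that] gs[OF that(2,1)] c_def by (simp add: mult_ac)
    thus ?thesis using unimodular_mult_cnj[OF a[OF that(1)]] unimodular_mult_cnj[OF a[OF that(2)]] by simp
  qed
  have fper: "f 3 = f (- 2)" "f 4 = f (- 1)" "f (- 3) = f 2" "f (- 4) = f 1"
    by (rule per; simp)+
  have cs: "c 0 = 0" "c 3 = c 2" "c 4 = c 1" "c (- 1) = c 1" "c (- 2) = c 2" "c (- 3) = c 2" "c (- 4) = c 1"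
    by (simp_all add: c_def f0 fper mult.commute)
  have 5: "{..<5} = {0, 1, 2, 3, 4::nat}" by auto
  have "(\<Sum>k<5. gram_shift 5 h (J 0) k * gram_shift 5 h k (J 0)) = (\<Sum>k<5. c (- int (r k)))"
    using J5[of 0] rJ[of 0] by (intro sum.cong) (simp_all add: prod)
  also have "\<dots> = (\<Sum>y<5. c (- int y))" by (rule sum.reindex_bij_betw[OF r, of "\<lambda>y. c (- int y)"])
  finally have "(\<Sum>y<5. c (- int y)) = 0" using sum0[OF J5[of 0]] by simp
  hence "2 * (c 1 + c 2) = 0" by (simp add: 5 cs)
  hence "c 1 + c 2 = 0" unfolding mult_eq_0_iff by simp
  hence c2: "c 2 = - c 1" by (simp only: eq_neg_iff_add_eq_0 add.commute)
  show ?thesis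
  proof (cases "c 1 = 0")
    case True
    have corr: "(\<Sum>d<5. f (int d) * cnj (f (int d + e))) = (if 5 dvd e then 25 else 0)" for e
      using fourier_autocorrelation[OF s, of "\<lambda>m. zeta 5 (int m)" e] by (simp add: f_def)
    have f567: "f 5 = 0" "f 6 = f 1" using per[of 5 0] per[of 6 1] f0 by simp_all
    have "f 1 * cnj (f 1) + f 2 * cnj (f 2) + f 3 * cnj (f 3) + f 4 * cnj (f 4) = 25"
      using corr[of 0] by (simp add: 5 f0 add.assoc)
    hence "complex_of_real ((cmod (f 1))\<^sup>2 + (cmod (f 2))\<^sup>2 + (cmod (f 3))\<^sup>2 + (cmod (f 4))\<^sup>2) = of_real 25"
      by (simp only: of_real_add complex_norm_square of_real_numeral)
    hence tot: "(cmod (f 1))\<^sup>2 + (cmod (f 2))\<^sup>2 + (cmod (f 3))\<^sup>2 + (cmod (f 4))\<^sup>2 = 25"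
      by (simp only: of_real_eq_iff)
    have e1: "f 1 * cnj (f 2) + f 2 * cnj (f 3) + f 3 * cnj (f 4) = 0"
      using corr[of 1] by (simp add: 5 f0 f567 add.assoc)
    have e2: "f 1 * cnj (f 3) + f 2 * cnj (f 4) + f 4 * cnj (f 1) = 0"
      using corr[of 2] by (simp add: 5 f0 f567 add.assoc)
    have z14: "f 1 = 0 \<or> f 4 = 0" using True by (simp add: c_def fper)
    have "c 2 = 0" using True c2 by simp
    hence z23: "f 2 = 0 \<or> f 3 = 0" unfolding c_def fper mult_eq_0_iff .
    have sq25: "cmod z = 5" if "(cmod z)\<^sup>2 = 25" for z
      using that power2_eq_iff_nonneg[of "cmod z" 5] by simp
    have vals: "(f 1 = 0 \<or> cmod (f 1) = 5) \<and> (f 2 = 0 \<or> cmod (f 2) = 5) \<and> (f 3 = 0 \<or> cmod (f 3) = 5)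
        \<and> (f 4 = 0 \<or> cmod (f 4) = 5)"
      using z14 z23 e1 e2 tot by (auto intro: sq25)
    have f_vals: "f d = 0 \<or> cmod (f d) = 5" for d
    proof -
      have "f d = f (d mod 5)" by (rule per) (simp add: mod_eq_dvd_iff[symmetric])
      moreover have "d mod 5 \<in> {0, 1, 2, 3, 4}" by auto
      ultimately show ?thesis using vals f0 by auto
    qed
    have "monomial_entries 5 (gram_shift 5 h)"
      unfolding monomial_entries_def using gs a f_vals by (auto simp: norm_mult)
    thus ?thesis ..
  next
    case False
    define A where "A = (\<lambda>x. zeta 5 (int (J x)))"
    have A_ne: "A x \<noteq> A y" if "x < 5" "y < 5" "x \<noteq> y" for x y
    proof
      assume "A x = A y"
      hence "J x = J y" unfolding A_def by (rule zeta_nat_inj[OF J5[OF that(1)] J5[OF that(2)]])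
      thus False using rJ[OF that(1)] rJ[OF that(2)] that(3) by simp
    qed
    have bijx: "bij_betw J ({..<5} - {x}) ({..<5} - {J x})" if "x < 5" for x
      using bij_betw_DiffI[OF bijJ, of "{x}" "{J x}"] that J5[OF that] by (simp add: bij_betw_def)
    have w: "(\<Sum>y\<in>{..<5} - {x}. c (int x - int y) / (A x - A y)) = 0" if x: "x < 5" for x
    proof -
      have "(\<Sum>y\<in>{..<5} - {x}. c (int x - int y) / (A x - A y)) = (\<Sum>y\<in>{..<5} - {x}.
          gram_shift 5 h (J x) (J y) * gram_shift 5 h (J y) (J x) / (zeta 5 (int (J x)) - zeta 5 (int (J y))))"
        by (rule sum.cong[OF refl]) (simp add: prod J5 rJ x A_def)
      also have "\<dots> = (\<Sum>k\<in>{..<5} - {J x}.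
          gram_shift 5 h (J x) k * gram_shift 5 h k (J x) / (zeta 5 (int (J x)) - zeta 5 (int k)))"
        by (rule sum.reindex_bij_betw[OF bijx[OF x], of "\<lambda>k. gram_shift 5 h (J x) k * gram_shift 5 h k (J x)
          / (zeta 5 (int (J x)) - zeta 5 (int k))"])
      finally show ?thesis using sum1[OF J5[OF x]] by simp
    qed
    have tot: "(\<Sum>y\<in>{..<5} - {x}. A x / (A x - A y)) = 2" if x: "x < 5" for x
    proof -
      have "(\<Sum>y\<in>{..<5} - {x}. A x / (A x - A y))
          = (\<Sum>k\<in>{..<5} - {J x}. zeta 5 (int (J x)) / (zeta 5 (int (J x)) - zeta 5 (int k)))"
        unfolding A_def by (rule sum.reindex_bij_betw[OF bijx[OF x],
          of "\<lambda>k. zeta 5 (int (J x)) / (zeta 5 (int (J x)) - zeta 5 (int k))"])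
      thus ?thesis using sum_root_quotients_5[OF J5[OF x]] by simp
    qed
    \<comment> \<open>The neighbours p, q of x carry weight c 1, the other two positions the opposite weight.\<close>
    have geo: "A p * A q = A x * A x"
      if xpq: "x < 5" "p < 5" "q < 5" and ne: "x \<noteq> p" "x \<noteq> q"
        and near: "A x / (A x - A p) + A x / (A x - A q) = A x / (A x - A u) + A x / (A x - A v)"
        and all: "A x / (A x - A p) + A x / (A x - A q) + (A x / (A x - A u) + A x / (A x - A v)) = 2"
      for x p q u v
    proof -
      have half: "X = 1" if "X + X = 2" for X :: complex
        using that by (simp flip: mult_2)
      have "A x / (A x - A p) + A x / (A x - A q) = 1"
        using all unfolding near[symmetric] by (rule half)
      moreover have "A x - A p \<noteq> 0" "A x - A q \<noteq> 0" using A_ne xpq ne by simp_all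
      ultimately have "A x * (A x - A q) + A x * (A x - A p) = (A x - A p) * (A x - A q)"
        by (simp add: add_divide_eq_iff divide_add_eq_iff divide_eq_eq)
      thus ?thesis by (simp add: algebra_simps)
    qed
    have near: "A x / (A x - A p) + A x / (A x - A q) = A x / (A x - A u) + A x / (A x - A v)"
      if "c 1 / (A x - A p) + c 1 / (A x - A q) = c 1 / (A x - A u) + c 1 / (A x - A v)" for x p q u v
    proof -
      have "c 1 * (1 / (A x - A p) + 1 / (A x - A q)) = c 1 * (1 / (A x - A u) + 1 / (A x - A v))"
        using that by (simp add: ring_distribs)
      hence "1 / (A x - A p) + 1 / (A x - A q) = 1 / (A x - A u) + 1 / (A x - A v)"
        using False by simp
      hence "A x * (1 / (A x - A p) + 1 / (A x - A q)) = A x * (1 / (A x - A u) + 1 / (A x - A v))" by simp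
      thus ?thesis by (simp add: ring_distribs)
    qed
    have g1: "A 0 * A 2 = A 1 * A 1"
      by (rule geo[of 1 0 2 3 4]; (rule near)?; use w[of 1] tot[of 1] in
          \<open>simp add: 5 insert_Diff_if cs c2 algebra_simps\<close>)
    have g2: "A 1 * A 3 = A 2 * A 2"
      by (rule geo[of 2 1 3 0 4]; (rule near)?; use w[of 2] tot[of 2] in
          \<open>simp add: 5 insert_Diff_if cs c2 algebra_simps\<close>)
    have g3: "A 2 * A 4 = A 3 * A 3"
      by (rule geo[of 3 2 4 0 1]; (rule near)?; use w[of 3] tot[of 3] in
          \<open>simp add: 5 insert_Diff_if cs c2 algebra_simps\<close>)
    define t where "t = int (J 1) - int (J 0)"
    define \<rho> where "\<rho> = zeta 5 t"
    have Anz: "A x \<noteq> 0" for x by (simp add: A_def)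
    have A1: "A 1 = A 0 * \<rho>" by (simp add: A_def \<rho>_def t_def zeta_add[symmetric])
    have A2: "A 2 = A 0 * \<rho> ^ 2"
    proof -
      have "A 0 * A 2 = A 0 * (A 0 * \<rho> ^ 2)" unfolding g1 A1 by (simp add: power2_eq_square mult_ac)
      thus ?thesis using Anz by (simp only: mult_cancel_left) simp
    qed
    have A3: "A 3 = A 0 * \<rho> ^ 3"
    proof -
      have "A 1 * A 3 = A 1 * (A 0 * \<rho> ^ 3)" unfolding g2 A2 unfolding A1 by (simp add: eval_nat_numeral mult_ac)
      thus ?thesis using Anz by (simp only: mult_cancel_left) simp
    qed
    have A4: "A 4 = A 0 * \<rho> ^ 4"
    proof -
      have "A 2 * A 4 = A 2 * (A 0 * \<rho> ^ 4)" unfolding g3 A3 unfolding A2 by (simp add: eval_nat_numeral mult_ac)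
      thus ?thesis using Anz by (simp only: mult_cancel_left) simp
    qed
    have Ax: "A x = A 0 * \<rho> ^ x" if "x < 5" for x
    proof -
      have "x \<in> {0, 1, 2, 3, 4}" using that by auto
      thus ?thesis using A1 A2 A3 A4 by auto
    qed
    have lin: "zeta 5 (int j) = zeta 5 (int (J 0) + t * int (r j))" if "j < 5" for j
      using Ax[OF r5[OF that]] by (simp add: A_def Jr[OF that] \<rho>_def zeta_power zeta_add)
    have "monomial_entries 5 (gram_shift 5 (\<lambda>m j. cnj (h j m)))"
      by (rule gram_shift_fourier_rows[where a = a and b = b and S = "\<lambda>m. int (s m)", OF r])
        (rule a b h lin; assumption)+
    thus ?thesis ..
  qed
qed

section \<open>Orders 3 and 4\<close>

lemma cnj_unimodular: "cmod z = 1 \<Longrightarrow> cnj z = 1 / z"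
  using complex_div_cnj[of 1 z] by simp

text \<open>Three unimodular numbers with sum 0 form a geometric progression whose quotient is a primitive third root
of unity.\<close>

lemma gram_shift_3_monomial:
  fixes h :: "nat \<Rightarrow> nat \<Rightarrow> complex"
  assumes uni: "\<And>j m. j < 3 \<Longrightarrow> m < 3 \<Longrightarrow> cmod (h j m) = 1"
    and rows: "\<And>j k. j < 3 \<Longrightarrow> k < 3 \<Longrightarrow> j \<noteq> k \<Longrightarrow> (\<Sum>m<3. h j m * cnj (h k m)) = 0"
  shows "monomial_entries 3 (gram_shift 3 h)"
  unfolding monomial_entries_def
proof (intro allI impI)
  fix j k :: nat assume jk: "j < 3" "k < 3"
  define \<omega> where "\<omega> = zeta 3 1"
  have 3: "{..<3} = {0, 1, 2::nat}" by auto
  have w3: "\<omega> * \<omega> * \<omega> = 1"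
    unfolding \<omega>_def zeta_add[symmetric] by (simp add: zeta_eq_1_iff)
  have "(\<Sum>m<3. zeta 3 (int m)) = 0" using sum_zeta_eq_0[of 1 3] by simp
  hence w: "1 + \<omega> + \<omega> * \<omega> = 0" by (simp add: 3 \<omega>_def zeta_add[symmetric] add.assoc)
  define e where "e = (\<lambda>m. h j m * cnj (h k m))"
  have gs: "gram_shift 3 h j k = e 0 + \<omega> * e 1 + \<omega> * \<omega> * e 2"
    by (simp add: gram_shift_def 3 e_def \<omega>_def zeta_add[symmetric] add.assoc)
  have eu: "cmod (e m) = 1" if "m < 3" for m using uni jk that by (simp add: e_def norm_mult)
  show "gram_shift 3 h j k = 0 \<or> cmod (gram_shift 3 h j k) = real 3"
  proof (cases "j = k")
    case True
    have "e m = 1" if "m < 3" for m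
      using unimodular_mult_cnj[OF uni[OF jk(1) that]] True by (simp add: e_def)
    thus ?thesis using w by (simp add: gs)
  next
    case False
    have sum: "e 0 + e 1 + e 2 = 0" using rows[OF jk False] by (simp add: e_def 3 add.assoc)
    have inv: "cnj (e m) = 1 / e m" if "m < 3" for m
      using cnj_unimodular[OF eu[OF that]] .
    have "cnj (e 0 + e 1 + e 2) = 0" using sum by simp
    hence "1 / e 0 + 1 / e 1 + 1 / e 2 = 0" by (simp add: inv)
    hence "e 0 * e 1 * e 2 * (1 / e 0 + 1 / e 1 + 1 / e 2) = 0" by simp
    moreover have "e 0 \<noteq> 0" "e 1 \<noteq> 0" "e 2 \<noteq> 0" using eu[of 0] eu[of 1] eu[of 2] by auto
    ultimately have sym: "e 1 * e 2 + e 0 * e 2 + e 0 * e 1 = 0" by (simp add: distrib_left)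
    have e2: "e 2 = - e 0 - e 1" using sum by (simp add: eq_neg_iff_add_eq_0 algebra_simps)
    have "e 1 * e 2 + e 0 * e 2 + e 0 * e 1 = - (e 1 * e 1 + e 0 * e 1 + e 0 * e 0)"
      unfolding e2 by (simp add: algebra_simps)
    hence q: "e 1 * e 1 + e 0 * e 1 + e 0 * e 0 = 0" unfolding sym by (simp only: neg_0_equal_iff_equal)
    have "(e 1 - \<omega> * e 0) * (e 1 - \<omega> * \<omega> * e 0)
        = e 1 * e 1 - (\<omega> + \<omega> * \<omega>) * (e 0 * e 1) + (\<omega> * \<omega> * \<omega>) * (e 0 * e 0)"
      by (simp add: algebra_simps)
    also have "\<omega> + \<omega> * \<omega> = - 1" using w by (simp add: eq_neg_iff_add_eq_0 algebra_simps)
    finally have "(e 1 - \<omega> * e 0) * (e 1 - \<omega> * \<omega> * e 0) = 0" using q w3 by simp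
    \<comment> \<open>The first case makes the entry vanish, in the second one the three terms agree.\<close>
    then consider "e 1 = \<omega> * e 0" | "e 1 = \<omega> * \<omega> * e 0" by auto
    thus ?thesis
    proof cases
      case 1
      have "gram_shift 3 h j k = (1 - \<omega> * \<omega> + \<omega> * \<omega> - \<omega> * \<omega> * \<omega>) * e 0"
        unfolding gs e2 1 by (simp add: algebra_simps)
      thus ?thesis by (simp add: w3)
    next
      case 2
      have "gram_shift 3 h j k = (1 + \<omega> * \<omega> * \<omega> - \<omega> * \<omega> - (\<omega> * \<omega> * \<omega>) * \<omega>) * e 0"
        unfolding gs e2 2 by (simp add: algebra_simps)
      also have "1 + \<omega> * \<omega> * \<omega> - \<omega> * \<omega> - (\<omega> * \<omega> * \<omega>) * \<omega> = 3 - (1 + \<omega> + \<omega> * \<omega>)"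
        unfolding w3 by simp
      finally show ?thesis using eu[of 0] by (simp add: w norm_mult)
    qed
  qed
qed

text \<open>Conjugation turns the vanishing of the sum into that of the third elementary symmetric polynomial, and the
two together make \<open>(a + b) * (a + c) * (a + d)\<close> vanish.\<close>

lemma unimodular_quadruple:
  assumes u: "cmod a = 1" "cmod b = 1" "cmod c = 1" "cmod d = 1" and sum: "a + b + c + d = 0"
  shows "(c = - a \<and> d = - b) \<or> (b = - a \<and> d = - c) \<or> (d = - a \<and> c = - b)"
proof -
  have nz: "a \<noteq> 0" "b \<noteq> 0" "c \<noteq> 0" "d \<noteq> 0" using u by auto
  have "cnj (a + b + c + d) = 0" using sum by simp
  hence "1 / a + 1 / b + 1 / c + 1 / d = 0" using u by (simp add: cnj_unimodular)
  hence "a * b * c * d * (1 / a + 1 / b + 1 / c + 1 / d) = 0" by simp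
  hence e3: "b * c * d + a * c * d + a * b * d + a * b * c = 0" using nz by (simp add: distrib_left ac_simps)
  have d: "d = - a - b - c" using sum by (simp add: algebra_simps eq_neg_iff_add_eq_0)
  have "(a + b) * (a + c) * (a + d) = a * a * (a + b + c + d) + (b * c * d + a * c * d + a * b * d + a * b * c)"
    by (simp add: algebra_simps)
  hence "(a + b) * (a + c) * (a + d) = 0" using sum e3 by simp
  hence "b = - a \<or> c = - a \<or> d = - a" by (auto simp: eq_neg_iff_add_eq_0 add.commute)
  thus ?thesis
  proof (elim disjE)
    assume e: "b = - a"
    have "d = - c" using sum unfolding e by (simp add: eq_neg_iff_add_eq_0 add.commute)
    thus ?thesis using e by blast
  next
    assume e: "c = - a"
    have "d = - b" using sum unfolding e by (simp add: eq_neg_iff_add_eq_0 add.commute)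
    thus ?thesis using e by blast
  next
    assume e: "d = - a"
    have "c = - b" using sum unfolding e by (simp add: eq_neg_iff_add_eq_0 add.commute)
    thus ?thesis using e by blast
  qed
qed

lemma zeta_4: "zeta 4 1 = \<i>" "zeta 4 2 = - 1" "zeta 4 3 = - \<i>"
proof -
  show 1: "zeta 4 1 = \<i>" by (simp add: zeta_def complex_eq_iff)
  show "zeta 4 2 = - 1" using zeta_add[of 4 1 1] by (simp add: 1)
  thus "zeta 4 3 = - \<i>" using zeta_add[of 4 2 1] by (simp add: 1)
qed

text \<open>The quotient of two rows of a Hadamard matrix of order 4. The type \<open>T\<close> tells which entries are opposite to
each other; every value other than 1 and 2 is read as 3.\<close>

definition quad_row :: "nat \<Rightarrow> complex \<Rightarrow> complex \<Rightarrow> nat \<Rightarrow> complex" where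
  "quad_row T x y m = (if T = 1 then [x, y, - x, - y] ! m else if T = 2 then [x, - x, y, - y] ! m
     else [x, y, - y, - x] ! m)"

text \<open>The product \<open>gram_shift j k * gram_shift k j\<close>, divided by the imaginary unit, for two rows whose quotient is
\<open>quad_row T x y\<close> with \<open>r = Re (x * cnj y)\<close>.\<close>

definition quad_shift :: "nat \<Rightarrow> real \<Rightarrow> real" where
  "quad_shift T r = (if T = 1 then 8 * r else if T = 2 then - 4 * (1 - r) else 4 * (1 + r))"

lemma quad_row_exists:
  assumes u: "\<And>m. m < 4 \<Longrightarrow> cmod (e m) = 1" and sum: "(\<Sum>m<4. e m) = 0"
  obtains T x y where "T = 1 \<or> T = 2 \<or> T = (3::nat)" "cmod x = 1" "cmod y = 1"
    "\<And>m. m < 4 \<Longrightarrow> e m = quad_row T x y m"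
proof -
  have 4: "{..<4} = {0, 1, 2, 3::nat}" by auto
  have mem: "m = 0 \<or> m = 1 \<or> m = 2 \<or> m = 3" if "m < 4" for m :: nat using that by auto
  have n: "cmod (e 0) = 1" "cmod (e 1) = 1" "cmod (e 2) = 1" "cmod (e 3) = 1" by (simp_all add: u)
  have "e 0 + e 1 + e 2 + e 3 = 0" using sum by (simp add: 4 add.assoc)
  from unimodular_quadruple[OF n this] show ?thesis
  proof (elim disjE conjE)
    assume e: "e 2 = - e 0" "e 3 = - e 1"
    have H: "e m = quad_row 1 (e 0) (e 1) m" if "m < 4" for m
      using mem[OF that] by (elim disjE) (simp_all add: quad_row_def e[unfolded One_nat_def])
    show ?thesis by (rule that[of 1 "e 0" "e 1", OF _ n(1,2) H]) simp_all
  next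
    assume e: "e 1 = - e 0" "e 3 = - e 2"
    have H: "e m = quad_row 2 (e 0) (e 2) m" if "m < 4" for m
      using mem[OF that] by (elim disjE) (simp_all add: quad_row_def e[unfolded One_nat_def])
    show ?thesis by (rule that[of 2 "e 0" "e 2", OF _ n(1,3) H]) simp_all
  next
    assume e: "e 3 = - e 0" "e 2 = - e 1"
    have H: "e m = quad_row 3 (e 0) (e 1) m" if "m < 4" for m
      using mem[OF that] by (elim disjE) (simp_all add: quad_row_def e[unfolded One_nat_def])
    show ?thesis by (rule that[of 3 "e 0" "e 1", OF _ n(1,2) H]) simp_all
  qed
qed

text \<open>Here \<open>S\<close> is the sum of four entries weighted by the fourth roots of unity; with the quotient of two rows in
place of \<open>e\<close> it is \<open>gram_shift\<close>. In types 2 and 3 both factors vanish together, in type 1 the vanishing of one of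
them makes \<open>y\<close> a multiple of \<open>x\<close> for which the other one has modulus 4.\<close>

lemma quad_row_shift:
  assumes T: "T = 1 \<or> T = 2 \<or> T = (3::nat)" and u: "cmod x = 1" "cmod y = 1"
  defines "S \<equiv> \<lambda>e :: nat \<Rightarrow> complex. e 0 + \<i> * e 1 - e 2 - \<i> * e 3"
  shows "S (quad_row T x y) * S (\<lambda>m. cnj (quad_row T x y m)) = \<i> * of_real (quad_shift T (Re (x * cnj y)))"
    and "S (quad_row T x y) * S (\<lambda>m. cnj (quad_row T x y m)) = 0 \<Longrightarrow>
      S (quad_row T x y) = 0 \<or> cmod (S (quad_row T x y)) = 4"
proof -
  have xx: "x * cnj x = 1" "y * cnj y = 1" using u by (simp_all add: unimodular_mult_cnj)
  have re: "x * cnj y + y * cnj x = of_real (2 * Re (x * cnj y))" by (simp add: complex_eq_iff)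
  have ii: "\<i> * (\<i> * z) = - z" for z by (simp flip: mult.assoc)
  show "S (quad_row T x y) * S (\<lambda>m. cnj (quad_row T x y m)) = \<i> * of_real (quad_shift T (Re (x * cnj y)))"
    using T
  proof (elim disjE)
    assume T: "T = 1"
    have "S (quad_row T x y) * S (\<lambda>m. cnj (quad_row T x y m))
        = 4 * (x * cnj x - y * cnj y) + 4 * \<i> * (x * cnj y + y * cnj x)"
      by (simp add: T S_def quad_row_def algebra_simps ii)
    thus ?thesis unfolding xx re by (simp add: T quad_shift_def)
  next
    assume T: "T = 2"
    have "S (quad_row T x y) * S (\<lambda>m. cnj (quad_row T x y m))
        = - 2 * \<i> * (x * cnj x + y * cnj y - (x * cnj y + y * cnj x))"
      by (simp add: T S_def quad_row_def algebra_simps ii)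
    thus ?thesis unfolding xx re by (simp add: T quad_shift_def algebra_simps)
  next
    assume T: "T = 3"
    have "S (quad_row T x y) * S (\<lambda>m. cnj (quad_row T x y m))
        = 2 * \<i> * (x * cnj x + y * cnj y + (x * cnj y + y * cnj x))"
      by (simp add: T S_def quad_row_def algebra_simps ii)
    thus ?thesis unfolding xx re by (simp add: T quad_shift_def algebra_simps)
  qed
  assume "S (quad_row T x y) * S (\<lambda>m. cnj (quad_row T x y m)) = 0"
  hence z: "S (quad_row T x y) = 0 \<or> cnj (S (\<lambda>m. cnj (quad_row T x y m))) = 0" by simp
  have cc: "cnj (S (\<lambda>m. cnj (e m))) = e 0 - \<i> * e 1 - e 2 + \<i> * e 3" for e
    by (simp add: S_def)
  show "S (quad_row T x y) = 0 \<or> cmod (S (quad_row T x y)) = 4"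
    using T
  proof (elim disjE)
    assume T: "T = 1"
    have "S (quad_row T x y) = 2 * (x + \<i> * y)" by (simp add: T S_def quad_row_def)
    moreover have "cnj (S (\<lambda>m. cnj (quad_row T x y m))) = 2 * (x - \<i> * y)"
      unfolding cc by (simp add: T quad_row_def)
    ultimately show ?thesis using z u by (auto simp: norm_mult)
  next
    assume T: "T = 2"
    have "S (quad_row T x y) = (1 - \<i>) * (x - y)" by (simp add: T S_def quad_row_def algebra_simps)
    moreover have "cnj (S (\<lambda>m. cnj (quad_row T x y m))) = (1 + \<i>) * (x - y)"
      unfolding cc by (simp add: T quad_row_def algebra_simps)
    moreover have "1 + \<i> \<noteq> 0" by (simp add: complex_eq_iff)
    ultimately show ?thesis using z by auto
  next
    assume T: "T = 3"
    have "S (quad_row T x y) = (1 + \<i>) * (x + y)" by (simp add: T S_def quad_row_def algebra_simps)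
    moreover have "cnj (S (\<lambda>m. cnj (quad_row T x y m))) = (1 - \<i>) * (x + y)"
      unfolding cc by (simp add: T quad_row_def algebra_simps)
    moreover have "1 - \<i> \<noteq> 0" by (simp add: complex_eq_iff)
    ultimately show ?thesis using z by auto
  qed
qed

text \<open>For different types the inner product factors, so that one of the two rows has to be real up to a phase.\<close>

lemma quad_row_inner:
  assumes orth: "(\<Sum>m<4. quad_row T x y m * cnj (quad_row T' v w m)) = 0"
    and u: "cmod x = 1" "cmod y = 1" "cmod v = 1" "cmod w = 1"
  shows "T = T' \<Longrightarrow> x * cnj y = - (v * cnj w)"
    and "T = 1 \<Longrightarrow> T' = 2 \<Longrightarrow> x = y \<or> v = w"
    and "T = 1 \<Longrightarrow> T' = 3 \<Longrightarrow> x = - y \<or> v = - w"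
    and "T = 2 \<Longrightarrow> T' = 3 \<Longrightarrow> x = - y \<or> v = w"
proof -
  have 4: "{..<4} = {0, 1, 2, 3::nat}" by auto
  have yy: "y * cnj y = 1" "v * cnj v = 1" using u by (simp_all add: unimodular_mult_cnj)
  {
    assume "T = T'"
    have "2 * (x * cnj v + y * cnj w) = (\<Sum>m<4. quad_row T x y m * cnj (quad_row T' v w m))"
      using \<open>T = T'\<close> by (simp add: 4 quad_row_def)
    hence "x * cnj v + y * cnj w = 0" unfolding orth mult_eq_0_iff by simp
    hence "(x * cnj v + y * cnj w) * (cnj y * v) = 0" by simp
    hence "x * cnj y * (v * cnj v) + v * cnj w * (y * cnj y) = 0" by (simp add: algebra_simps)
    thus "x * cnj y = - (v * cnj w)" unfolding yy by (simp add: eq_neg_iff_add_eq_0)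
  next
    assume T: "T = 1" "T' = 2"
    have "(x - y) * (cnj v - cnj w) = (\<Sum>m<4. quad_row T x y m * cnj (quad_row T' v w m))"
      using T by (simp add: 4 quad_row_def algebra_simps)
    thus "x = y \<or> v = w" using orth by (auto simp flip: complex_cnj_diff)
  next
    assume T: "T = 1" "T' = 3"
    have "(x + y) * (cnj v + cnj w) = (\<Sum>m<4. quad_row T x y m * cnj (quad_row T' v w m))"
      using T by (simp add: 4 quad_row_def algebra_simps)
    thus "x = - y \<or> v = - w" using orth by (auto simp: eq_neg_iff_add_eq_0 simp flip: complex_cnj_add)
  next
    assume T: "T = 2" "T' = 3"
    have "(x + y) * (cnj v - cnj w) = (\<Sum>m<4. quad_row T x y m * cnj (quad_row T' v w m))"
      using T by (simp add: 4 quad_row_def algebra_simps)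
    thus "x = - y \<or> v = w" using orth by (auto simp: eq_neg_iff_add_eq_0 simp flip: complex_cnj_diff)
  }
qed

text \<open>What orthogonality of two quotients with the same denominator implies for the real parts
\<open>r = Re (x * cnj y)\<close>.\<close>

definition quad_compat :: "nat \<Rightarrow> real \<Rightarrow> nat \<Rightarrow> real \<Rightarrow> bool" where
  "quad_compat T r T' r' \<longleftrightarrow> (T = T' \<longrightarrow> r = - r') \<and> (T = 1 \<and> T' = 2 \<longrightarrow> r = 1 \<or> r' = 1)
     \<and> (T = 1 \<and> T' = 3 \<longrightarrow> r = - 1 \<or> r' = - 1) \<and> (T = 2 \<and> T' = 3 \<longrightarrow> r = - 1 \<or> r' = 1)"

lemma quad_compat_inner:
  assumes "(\<Sum>m<4. quad_row T x y m * cnj (quad_row T' v w m)) = 0"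
    and "cmod x = 1" "cmod y = 1" "cmod v = 1" "cmod w = 1"
  shows "quad_compat T (Re (x * cnj y)) T' (Re (v * cnj w))"
proof -
  note q = quad_row_inner[OF assms]
  have "Re (y * cnj y) = 1" "Re (w * cnj w) = 1" using assms by (simp_all add: unimodular_mult_cnj)
  thus ?thesis unfolding quad_compat_def using q by auto
qed

text \<open>A row that is real up to a phase has \<open>quad_shift\<close> equal to 0, 8 or -8, which is excluded for the rows 1 and 3
since 0 and values beyond 4 are. As different types would force one of two rows to be real, rows 1 and 3
have the same type, opposite \<open>r\<close> and therefore \<open>r = 0\<close>; and row 2 has to be a real row of another type.\<close>

lemma quad_types:
  assumes T: "T1 = 1 \<or> T1 = 2 \<or> T1 = (3::nat)" "T2 = 1 \<or> T2 = 2 \<or> T2 = (3::nat)"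
      "T3 = 1 \<or> T3 = 2 \<or> T3 = (3::nat)"
    and b: "\<bar>r1\<bar> \<le> 1" "\<bar>r2\<bar> \<le> 1" "\<bar>r3\<bar> \<le> 1"
    and c: "quad_compat T1 r1 T2 r2" "quad_compat T2 r2 T1 r1" "quad_compat T1 r1 T3 r3"
      "quad_compat T3 r3 T1 r1" "quad_compat T2 r2 T3 r3" "quad_compat T3 r3 T2 r2"
    and p: "quad_shift T1 r1 = p" "quad_shift T2 r2 = - 2 * p" "quad_shift T3 r3 = p" "p \<noteq> 0"
  shows "T3 = T1 \<and> r1 = 0 \<and> r3 = 0 \<and>
    (T1 = 2 \<and> (T2 = 1 \<or> T2 = 3) \<and> r2 = 1 \<or> T1 = 3 \<and> (T2 = 1 \<or> T2 = 2) \<and> r2 = - 1)"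
proof -
  have "\<bar>quad_shift T r\<bar> \<le> 8" if "\<bar>r\<bar> \<le> 1" for T r
    using that by (auto simp: quad_shift_def abs_le_iff)
  from this[OF b(2), of T2] have p4: "\<bar>p\<bar> \<le> 4" unfolding p(2) by simp
  have interior: "r \<noteq> 1 \<and> r \<noteq> - 1" if "quad_shift T r = p" for T r
    using that p4 p(4) by (auto simp: quad_shift_def split: if_splits)
  note i1 = interior[OF p(1)] and i3 = interior[OF p(3)]
  have T13: "T3 = T1"
    using T(1,3) c(3,4) i1 i3 by (elim disjE) (simp_all add: quad_compat_def)
  have r31: "r3 = - r1" using c(4) T13 by (simp add: quad_compat_def)
  have T21: "T2 \<noteq> T1"
  proof
    assume T2: "T2 = T1"
    have "r2 = - r1" "r2 = - r3" using c(2,5) T2 T13 by (simp_all add: quad_compat_def)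
    hence "r2 = r1" using r31 by simp
    thus False using p(1,2,4) T2 by simp
  qed
  have sh: "quad_shift T1 r1 = quad_shift T1 (- r1)" using p(1,3) T13 r31 by simp
  have r1: "r1 = 0" using sh by (auto simp: quad_shift_def split: if_splits)
  have "T1 \<noteq> 1" using p(1,4) r1 by (auto simp: quad_shift_def)
  thus ?thesis using T(1,2) T13 T21 r1 r31 c(1,2)
    by (elim disjE) (simp_all add: quad_compat_def)
qed

text \<open>The two families of equations in row 0 give the products \<open>p\<close>, \<open>- 2 * p\<close>, \<open>p\<close> for the pairs of row 0 with
the rows 1, 2, 3. If \<open>p = 0\<close>, all products vanish and every entry is 0 or of modulus 4. Otherwise the types
of the three quotients by row 0 are restricted so much that, up to phases, row \<open>k\<close> is the \<open>k\<close>-th power of a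
row consisting of the four fourth roots of unity; so the matrix is a Fourier matrix with the rows in their
natural order.\<close>

theorem dichotomy_4:
  fixes h :: "nat \<Rightarrow> nat \<Rightarrow> complex"
  assumes uni: "\<And>j m. j < 4 \<Longrightarrow> m < 4 \<Longrightarrow> cmod (h j m) = 1"
    and rows: "\<And>j k. j < 4 \<Longrightarrow> k < 4 \<Longrightarrow> j \<noteq> k \<Longrightarrow> (\<Sum>m<4. h j m * cnj (h k m)) = 0"
    and sum0: "\<And>j. j < 4 \<Longrightarrow> (\<Sum>k<4. gram_shift 4 h j k * gram_shift 4 h k j) = 0"
    and sum1: "\<And>j. j < 4 \<Longrightarrow> (\<Sum>k\<in>{..<4} - {j}. gram_shift 4 h j k * gram_shift 4 h k j
      / (zeta 4 (int j) - zeta 4 (int k))) = 0"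
  shows "monomial_entries 4 (gram_shift 4 h) \<or> monomial_entries 4 (gram_shift 4 (\<lambda>m j. cnj (h j m)))"
proof -
  have 4: "{..<4} = {0, 1, 2, 3::nat}" by auto
  have mem: "m = 0 \<or> m = 1 \<or> m = 2 \<or> m = 3" if "m < 4" for m :: nat using that by auto
  define S where "S = (\<lambda>e :: nat \<Rightarrow> complex. e 0 + \<i> * e 1 - e 2 - \<i> * e 3)"
  have gs: "gram_shift 4 h j k = S (\<lambda>m. h j m * cnj (h k m))" for j k
    by (simp add: gram_shift_def 4 S_def zeta_4[unfolded One_nat_def] zeta_4 algebra_simps)
  have gs': "gram_shift 4 h k j = S (\<lambda>m. cnj (h j m * cnj (h k m)))" for j k
    by (simp add: gs mult.commute)
  define c where "c = (\<lambda>j k. gram_shift 4 h j k * gram_shift 4 h k j)"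
  have diag: "gram_shift 4 h j j = 0" if "j < 4" for j
    by (simp add: gs S_def unimodular_mult_cnj uni that)
  have c_sym: "c j k = c k j" for j k by (simp add: c_def mult.commute)
  have c_diag: "c j j = 0" if "j < 4" for j using diag[OF that] by (simp add: c_def)
  have quad: "\<exists>T x y. (T = 1 \<or> T = 2 \<or> T = (3::nat)) \<and> cmod x = 1 \<and> cmod y = 1
      \<and> (\<forall>m<4. h j m * cnj (h k m) = quad_row T x y m)" if jk: "j < 4" "k < 4" "j \<noteq> k" for j k
  proof -
    have u: "cmod (h j m * cnj (h k m)) = 1" if "m < 4" for m using uni jk that by (simp add: norm_mult)
    obtain T x y where "T = 1 \<or> T = 2 \<or> T = (3::nat)" "cmod x = 1" "cmod y = 1"
      "\<And>m. m < 4 \<Longrightarrow> h j m * cnj (h k m) = quad_row T x y m"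
      by (rule quad_row_exists[OF u rows[OF jk]]) (assumption | rule that)+
    thus ?thesis by blast
  qed
  have S_cong: "S e = S e'" if "\<And>m. m < 4 \<Longrightarrow> e m = e' m" for e e' using that by (simp add: S_def)
  have gs_quad: "gram_shift 4 h j k = S (quad_row T x y)"
      "gram_shift 4 h k j = S (\<lambda>m. cnj (quad_row T x y m))"
    if "\<forall>m<4. h j m * cnj (h k m) = quad_row T x y m" for j k T x y
  proof -
    show "gram_shift 4 h j k = S (quad_row T x y)" unfolding gs by (rule S_cong) (use that in auto)
    show "gram_shift 4 h k j = S (\<lambda>m. cnj (quad_row T x y m))"
      unfolding gs'[of k j] by (rule S_cong) (use that in auto)
  qed
  have sum0c: "(\<Sum>k<4. c j k) = 0" if "j < 4" for j using sum0[OF that] by (simp add: c_def)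
  have sum1c: "(\<Sum>k\<in>{..<4} - {j}. c j k / (zeta 4 (int j) - zeta 4 (int k))) = 0" if "j < 4" for j
    using sum1[OF that] by (simp add: c_def)
  have s0: "c 0 1 + c 0 2 + c 0 3 = 0" "c 0 1 + c 1 2 + c 1 3 = 0" "c 0 2 + c 1 2 + c 2 3 = 0"
    "c 0 3 + c 1 3 + c 2 3 = 0"
    using sum0c[of 0] sum0c[of 1] sum0c[of 2] sum0c[of 3] c_diag[of 0] c_diag[of 1] c_diag[of 2] c_diag[of 3]
    unfolding 4 by (simp_all add: add.assoc c_sym[of 1 0] c_sym[of 2 0] c_sym[of 3 0]
      c_sym[of 2 1] c_sym[of 3 1] c_sym[of 3 2] c_sym[of "Suc 0" 0] c_sym[of 2 "Suc 0"] c_sym[of 3 "Suc 0"])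
  have s1: "c 0 1 / (1 - \<i>) + c 0 2 / 2 + c 0 3 / (1 + \<i>) = 0"
    using sum1c[of 0] unfolding 4
    by (simp add: insert_Diff_if zeta_4[unfolded One_nat_def] zeta_4 add.assoc)
  have inv: "1 / (1 - \<i>) = (1 + \<i>) / 2" "1 / (1 + \<i>) = (1 - \<i>) / 2"
    by (simp_all add: complex_eq_iff Re_divide Im_divide)
  have "c 0 1 * (1 / (1 - \<i>)) + c 0 2 / 2 + c 0 3 * (1 / (1 + \<i>)) = 0" using s1 by simp
  hence "c 0 1 * (1 + \<i>) / 2 + c 0 2 / 2 + c 0 3 * (1 - \<i>) / 2 = 0" unfolding inv by simp
  hence "(c 0 1 * (1 + \<i>) + c 0 2 + c 0 3 * (1 - \<i>)) / 2 = 0" by (simp only: add_divide_distrib)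
  hence "(c 0 1 + c 0 2 + c 0 3) + \<i> * (c 0 1 - c 0 3) = 0" by (simp add: algebra_simps)
  hence c03: "c 0 3 = c 0 1" unfolding s0(1) by simp
  have c02: "c 0 2 = - 2 * c 0 1"
    using s0(1) unfolding c03 by (simp add: eq_neg_iff_add_eq_0 algebra_simps)
  show ?thesis
  proof (cases "c 0 1 = 0")
    case True
    have z: "c 0 2 = 0" "c 0 3 = 0" using True c02 c03 by simp_all
    have "c 1 3 = - c 1 2" "c 2 3 = - c 1 2" "c 2 3 = - c 1 3"
      using s0(2-4) unfolding True z by (simp_all add: eq_neg_iff_add_eq_0 add.commute)
    hence "c 1 2 = 0" "c 1 3 = 0" "c 2 3 = 0" by simp_all
    hence all0: "c j k = 0" if "j < 4" "k < 4" for j k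
      using mem[OF that(1)] mem[OF that(2)] True z c_sym[of 1 0] c_sym[of 2 0] c_sym[of 3 0]
        c_sym[of 2 1] c_sym[of 3 1] c_sym[of 3 2] c_diag
      by (elim disjE) simp_all
    have "gram_shift 4 h j k = 0 \<or> cmod (gram_shift 4 h j k) = 4" if jk: "j < 4" "k < 4" for j k
    proof (cases "j = k")
      case False
      obtain T x y where T: "T = 1 \<or> T = 2 \<or> T = (3::nat)" and u: "cmod x = 1" "cmod y = 1"
        and e: "\<forall>m<4. h j m * cnj (h k m) = quad_row T x y m"
        using quad[OF jk False] by blast
      have "S (quad_row T x y) * S (\<lambda>m. cnj (quad_row T x y m)) = 0"
        using all0[OF jk] unfolding c_def gs_quad[OF e] .
      thus ?thesis using quad_row_shift(2)[OF T u] unfolding gs_quad[OF e] S_def by blast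
    qed (use diag jk in simp)
    thus ?thesis unfolding monomial_entries_def by simp
  next
    case False
    obtain T x y where T: "\<And>j. j = 1 \<or> j = 2 \<or> j = 3 \<Longrightarrow> T j = 1 \<or> T j = 2 \<or> T j = (3::nat)"
      and x: "\<And>j. j = 1 \<or> j = 2 \<or> j = 3 \<Longrightarrow> cmod (x j) = 1"
      and y: "\<And>j. j = 1 \<or> j = 2 \<or> j = 3 \<Longrightarrow> cmod (y j) = 1"
      and e: "\<And>j. j = 1 \<or> j = 2 \<or> j = 3 \<Longrightarrow> \<forall>m<4. h j m * cnj (h 0 m) = quad_row (T j) (x j) (y j) m"
    proof -
      define P where "P = (\<lambda>j t. (fst t = 1 \<or> fst t = 2 \<or> fst t = (3::nat)) \<and> cmod (fst (snd t)) = 1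
        \<and> cmod (snd (snd t)) = 1 \<and> (\<forall>m<4. h j m * cnj (h 0 m) = quad_row (fst t) (fst (snd t)) (snd (snd t)) m))"
      have "\<forall>j\<in>{1, 2, 3}. \<exists>t. P j t"
      proof
        fix j :: nat assume "j \<in> {1, 2, 3}"
        hence "j < 4" "(0::nat) < 4" "j \<noteq> 0" by auto
        from quad[OF this] obtain T x y where "(T = 1 \<or> T = 2 \<or> T = (3::nat)) \<and> cmod x = 1 \<and> cmod y = 1
          \<and> (\<forall>m<4. h j m * cnj (h 0 m) = quad_row T x y m)" by blast
        hence "P j (T, x, y)" by (simp add: P_def)
        thus "\<exists>t. P j t" ..
      qed
      then obtain t where "\<forall>j\<in>{1, 2, 3}. P j (t j)" by (rule bchoice[THEN exE])
      hence t: "P j (t j)" if "j = 1 \<or> j = 2 \<or> j = 3" for j using that by blast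
      show ?thesis
        by (rule that[of "\<lambda>j. fst (t j)" "\<lambda>j. fst (snd (t j))" "\<lambda>j. snd (snd (t j))"])
          (use t in \<open>unfold P_def, blast+\<close>)
    qed
    define r where "r = (\<lambda>j. Re (x j * cnj (y j)))"
    have r1: "\<bar>r j\<bar> \<le> 1" if "j = 1 \<or> j = 2 \<or> j = 3" for j
      using abs_Re_le_cmod[of "x j * cnj (y j)"] x[OF that] y[OF that] by (simp add: r_def norm_mult)
    have inner: "(\<Sum>m<4. quad_row (T j) (x j) (y j) m * cnj (quad_row (T k) (x k) (y k) m)) = 0"
      if j: "j = 1 \<or> j = 2 \<or> j = 3" and k: "k = 1 \<or> k = 2 \<or> k = 3" and "j \<noteq> k" for j k
    proof -
      have "(\<Sum>m<4. quad_row (T j) (x j) (y j) m * cnj (quad_row (T k) (x k) (y k) m))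
          = (\<Sum>m<4. h j m * cnj (h k m))"
      proof (rule sum.cong[OF refl])
        fix m :: nat assume "m \<in> {..<4}"
        hence m: "m < 4" by simp
        have "h j m * cnj (h 0 m) * cnj (h k m * cnj (h 0 m)) = h j m * cnj (h k m) * (h 0 m * cnj (h 0 m))"
          by (simp add: mult_ac)
        thus "quad_row (T j) (x j) (y j) m * cnj (quad_row (T k) (x k) (y k) m) = h j m * cnj (h k m)"
          using e[OF j] e[OF k] m unimodular_mult_cnj[OF uni[of 0 m]] by simp
      qed
      thus ?thesis using rows[of j k] that by auto
    qed
    have compat: "quad_compat (T j) (r j) (T k) (r k)"
      if j: "j = 1 \<or> j = 2 \<or> j = 3" and k: "k = 1 \<or> k = 2 \<or> k = 3" and "j \<noteq> k" for j k
      unfolding r_def by (rule quad_compat_inner[OF inner[OF that] x[OF j] y[OF j] x[OF k] y[OF k]])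
    have cq: "c 0 j = \<i> * of_real (quad_shift (T j) (r j))" if j: "j = 1 \<or> j = 2 \<or> j = 3" for j
      unfolding c_sym[of 0] unfolding c_def gs_quad[OF e[OF j]] r_def S_def
      by (rule quad_row_shift(1)[OF T[OF j] x[OF j] y[OF j]])
    define p where "p = quad_shift (T 1) (r 1)"
    have p1: "c 0 1 = \<i> * of_real p" using cq[of 1] by (simp add: p_def)
    have j: "(1::nat) = 1 \<or> (1::nat) = 2 \<or> (1::nat) = 3" "(2::nat) = 1 \<or> (2::nat) = 2 \<or> (2::nat) = 3"
      "(3::nat) = 1 \<or> (3::nat) = 2 \<or> (3::nat) = 3" by simp_all
    have p0: "p \<noteq> 0" using False p1 by auto
    have p3: "quad_shift (T 3) (r 3) = p"
      using cq[of 3] unfolding c03 p1 by simp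
    have p2: "quad_shift (T 2) (r 2) = - 2 * p"
    proof -
      have "\<i> * complex_of_real (quad_shift (T 2) (r 2)) = \<i> * of_real (- 2 * p)"
        using cq[of 2] unfolding c02 p1 by (simp add: mult.left_commute)
      thus ?thesis by (simp only: mult_cancel_left of_real_eq_iff) simp
    qed
    have "T 3 = T 1 \<and> r 1 = 0 \<and> r 3 = 0 \<and>
      (T 1 = 2 \<and> (T 2 = 1 \<or> T 2 = 3) \<and> r 2 = 1 \<or> T 1 = 3 \<and> (T 2 = 1 \<or> T 2 = 2) \<and> r 2 = - 1)"
    proof (rule quad_types[OF T[OF j(1)] T[OF j(2)] T[OF j(3)] r1[OF j(1)] r1[OF j(2)] r1[OF j(3)]
        compat[OF j(1,2)] compat[OF j(2,1)] compat[OF j(1,3)] compat[OF j(3,1)] compat[OF j(2,3)] compat[OF j(3,2)]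
        p_def[symmetric] p2 p3 p0])
    qed simp_all
    hence types: "T 3 = T 1" "r 1 = 0" "r 3 = 0"
      "T 1 = 2 \<and> (T 2 = 1 \<or> T 2 = 3) \<and> r 2 = 1 \<or> T 1 = 3 \<and> (T 2 = 1 \<or> T 2 = 2) \<and> r 2 = - 1"
      by blast+
    define \<kappa> where "\<kappa> = y 1 * cnj (x 1)"
    have \<kappa>: "\<kappa> = \<i> \<or> \<kappa> = - \<i>"
    proof -
      have "Re \<kappa> = 0" using types(2) by (simp add: \<kappa>_def r_def mult.commute)
      moreover have "(Re \<kappa>)\<^sup>2 + (Im \<kappa>)\<^sup>2 = 1"
        using x[OF j(1)] y[OF j(1)] cmod_power2[of \<kappa>] by (simp add: \<kappa>_def norm_mult)
      ultimately have "Im \<kappa> = 1 \<or> Im \<kappa> = - 1" by (simp add: power2_eq_1_iff)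
      thus ?thesis using \<open>Re \<kappa> = 0\<close> by (auto simp: complex_eq_iff)
    qed
    have xx: "x k * cnj (x k) = 1" "y k * cnj (y k) = 1" if "k = 1 \<or> k = 2 \<or> k = 3" for k
      using x[OF that] y[OF that] by (simp_all add: unimodular_mult_cnj)
    have "\<kappa> * x 1 = y 1 * (x 1 * cnj (x 1))" by (simp add: \<kappa>_def mult_ac)
    hence y1: "y 1 = \<kappa> * x 1" unfolding xx(1)[OF j(1)] by simp
    have y3: "y 3 = - \<kappa> * x 3"
    proof -
      have "x 3 * cnj (y 3) = - (x 1 * cnj (y 1))"
        using quad_row_inner(1)[OF inner[OF j(3,1)] x[OF j(3)] y[OF j(3)] x[OF j(1)] y[OF j(1)] types(1)] by simp
      hence "cnj (x 3 * cnj (y 3)) = cnj (- (x 1 * cnj (y 1)))" by simp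
      hence "y 3 * cnj (x 3) = - \<kappa>" by (simp add: \<kappa>_def mult.commute)
      hence "y 3 * (x 3 * cnj (x 3)) = - \<kappa> * x 3" by (simp add: mult_ac)
      thus ?thesis using xx[OF j(3)] by simp
    qed
    have unit_eq: "u = v" if "Re (u * cnj v) = 1" "cmod u = 1" "cmod v = 1" for u v
    proof -
      have "(cmod (u - v))\<^sup>2 = (cmod u)\<^sup>2 + (cmod v)\<^sup>2 - 2 * Re (u * cnj v)"
        unfolding cmod_power2 by (simp add: power2_eq_square algebra_simps)
      hence "(cmod (u - v))\<^sup>2 = 0" unfolding that by simp
      thus ?thesis by simp
    qed
    have h_eq: "h k m = quad_row (T k) (x k) (y k) m * h 0 m" if k: "k = 1 \<or> k = 2 \<or> k = 3" and m: "m < 4" for k m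
    proof -
      have "h k m * cnj (h 0 m) * h 0 m = h k m * (h 0 m * cnj (h 0 m))" by (simp add: mult_ac)
      thus ?thesis using e[OF k] m unimodular_mult_cnj[OF uni[of 0 m]] by simp
    qed
    \<comment> \<open>The exponent of the fourth root of unity kappa; kappa and - kappa = kappa^3 are the quotients in rows 1 and 3.\<close>
    define \<sigma> :: int where "\<sigma> = (if \<kappa> = \<i> then 1 else 3)"
    have z4: "zeta 4 k = zeta 4 (k mod 4)" for k using zeta_mod[of 4 k] by simp
    have z\<sigma>: "zeta 4 \<sigma> = \<kappa>" "zeta 4 (2 * \<sigma>) = - 1" "zeta 4 (3 * \<sigma>) = - \<kappa>"
      using \<kappa> z4[of 6] z4[of 9] by (auto simp: \<sigma>_def zeta_4)
    define S' where "S' = (\<lambda>m::nat. if T 1 = 2 then [0, 2, \<sigma>, \<sigma> + 2] ! m else [0, \<sigma>, \<sigma> + 2, 2] ! m)"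
    have z6: "zeta 4 4 = 1" "zeta 4 6 = - 1" using z4[of 4] z4[of 6] by (simp_all add: zeta_4)
    have zs: "zeta 4 (\<sigma> + 2) = - \<kappa>" "zeta 4 (2 * \<sigma> + 4) = - 1" "zeta 4 (3 * \<sigma> + 6) = \<kappa>"
      by (simp_all add: zeta_add z\<sigma> zeta_4 z6)
    \<comment> \<open>The exponents of row 1 for the types 2 and 3.\<close>
    define A where "A = (\<lambda>m::nat. [0, 2, \<sigma>, \<sigma> + 2] ! m)"
    define B where "B = (\<lambda>m::nat. [0, \<sigma>, \<sigma> + 2, 2] ! m)"
    have tabA: "quad_row 2 X (\<kappa> * X) m = X * zeta 4 (A m)" "quad_row 2 X (- \<kappa> * X) m = X * zeta 4 (3 * A m)"
        "quad_row 1 X X m = X * zeta 4 (2 * A m)" "quad_row 3 X X m = X * zeta 4 (2 * A m)"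
      if "m < 4" for m X
      using mem[OF that] by (elim disjE; simp add: quad_row_def A_def z\<sigma> zs zeta_4 z6)+
    have tabB: "quad_row 3 X (\<kappa> * X) m = X * zeta 4 (B m)" "quad_row 3 X (- \<kappa> * X) m = X * zeta 4 (3 * B m)"
        "quad_row 1 X (- X) m = X * zeta 4 (2 * B m)" "quad_row 2 X (- X) m = X * zeta 4 (2 * B m)"
      if "m < 4" for m X
      using mem[OF that] by (elim disjE; simp add: quad_row_def B_def z\<sigma> zs zeta_4 z6)+
    have n2: "cmod (x 2) = 1" "cmod (y 2) = 1" "cmod (- y 2) = 1" using x[OF j(2)] y[OF j(2)] by simp_all
    have y2: "r 2 = 1 \<Longrightarrow> y 2 = x 2" "r 2 = - 1 \<Longrightarrow> y 2 = - x 2"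
      using unit_eq[OF _ n2(1,2)] unit_eq[OF _ n2(1,3)] unfolding r_def by simp_all
    have fourier: "quad_row (T k) (x k) (y k) m = x k * zeta 4 (int k * S' m)"
      if k: "k = 1 \<or> k = 2 \<or> k = 3" and m: "m < 4" for k m
      using types(4)
    proof (elim disjE conjE)
      assume T1: "T 1 = 2" and T2: "T 2 = 1" and r2: "r 2 = 1"
      have S'A: "S' m = A m" by (simp add: S'_def A_def T1[unfolded One_nat_def])
      show ?thesis using k unfolding S'A
        by (elim disjE; hypsubst) (simp_all only: types(1) T1 T2 y1 y2(1)[OF r2] y3 tabA[OF m] of_nat_1 of_nat_numeral mult_1)
    next
      assume T1: "T 1 = 2" and T2: "T 2 = 3" and r2: "r 2 = 1"
      have S'A: "S' m = A m" by (simp add: S'_def A_def T1[unfolded One_nat_def])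
      show ?thesis using k unfolding S'A
        by (elim disjE; hypsubst) (simp_all only: types(1) T1 T2 y1 y2(1)[OF r2] y3 tabA[OF m] of_nat_1 of_nat_numeral mult_1)
    next
      assume T1: "T 1 = 3" and T2: "T 2 = 1" and r2: "r 2 = - 1"
      have S'B: "S' m = B m" by (simp add: S'_def B_def T1[unfolded One_nat_def])
      show ?thesis using k unfolding S'B
        by (elim disjE; hypsubst) (simp_all only: types(1) T1 T2 y1 y2(2)[OF r2] y3 tabB[OF m] of_nat_1 of_nat_numeral mult_1)
    next
      assume T1: "T 1 = 3" and T2: "T 2 = 2" and r2: "r 2 = - 1"
      have S'B: "S' m = B m" by (simp add: S'_def B_def T1[unfolded One_nat_def])
      show ?thesis using k unfolding S'B
        by (elim disjE; hypsubst) (simp_all only: types(1) T1 T2 y1 y2(2)[OF r2] y3 tabB[OF m] of_nat_1 of_nat_numeral mult_1)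
    qed
    define a where "a = (\<lambda>j. if j = 0 then 1 else x j)"
    have a: "cmod (a j) = 1" if "j < 4" for j
      using x[of j] mem[OF that] by (auto simp: a_def)
    have hS: "h j m = a j * h 0 m * zeta 4 (int (id j) * S' m)" if "j < 4" "m < 4" for j m
    proof (cases "j = 0")
      case False
      hence jj: "j = 1 \<or> j = 2 \<or> j = 3" using mem[OF that(1)] by auto
      show ?thesis using h_eq[OF jj that(2)] fourier[OF jj that(2)] False by (simp add: a_def)
    qed (simp add: a_def)
    have "monomial_entries 4 (gram_shift 4 (\<lambda>m j. cnj (h j m)))"
    proof (rule gram_shift_fourier_rows[where a = a and b = "h 0" and S = S' and r = id and ?k0.0 = 0 and t = 1])
      show "bij_betw id {..<4} {..<4::nat}" by simp
      show "\<And>m. m < 4 \<Longrightarrow> cmod (h 0 m) = 1" by (simp add: uni)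
      show "\<And>j m. j < 4 \<Longrightarrow> m < 4 \<Longrightarrow> h j m = a j * h 0 m * zeta 4 (int (id j) * S' m)" by (rule hS)
    qed (simp_all add: a)
    thus ?thesis ..
  qed
qed

section \<open>Unitary conjugation\<close>

lemma mat_adjoint_carrier [simp]: "A \<in> carrier_mat m k \<Longrightarrow> mat_adjoint A \<in> carrier_mat k m"
  by (auto simp: mat_adjoint_def)

lemma mat_adjoint_dim [simp]: "dim_row (mat_adjoint A) = dim_col A" "dim_col (mat_adjoint A) = dim_row A"
  by (simp_all add: mat_adjoint_def)

lemma square_mult_carrier [simp]:
  "A \<in> carrier_mat n n \<Longrightarrow> B \<in> carrier_mat n n \<Longrightarrow> A * B \<in> carrier_mat n n"
  by (rule mult_carrier_mat)

lemma square_eqI: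
  assumes "A \<in> carrier_mat n n" "B \<in> carrier_mat n n"
    and "\<And>i j. i < n \<Longrightarrow> j < n \<Longrightarrow> A $$ (i, j) = B $$ (i, j)"
  shows "A = B"
  using assms by (intro eq_matI) auto

lemma mat_adjoint_index [simp]:
  fixes A :: "complex mat"
  assumes "A \<in> carrier_mat m k" "i < k" "j < m"
  shows "mat_adjoint A $$ (i, j) = cnj (A $$ (j, i))"
  using assms by (auto simp: mat_adjoint_def mat_of_rows_index)

lemma mat_mult_index:
  assumes "A \<in> carrier_mat m k" "B \<in> carrier_mat k l" "i < m" "j < l"
  shows "(A * B) $$ (i, j) = (\<Sum>r<k. A $$ (i, r) * B $$ (r, j))"
  using assms by (auto simp: scalar_prod_def lessThan_atLeast0 intro!: sum.cong)

lemmas square_mult_index = mat_mult_index[where m = n and k = n and l = n for n]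

lemma mat_adjoint_adjoint [simp]:
  fixes A :: "complex mat"
  assumes "A \<in> carrier_mat m k" shows "mat_adjoint (mat_adjoint A) = A"
proof (rule eq_matI)
  fix i j assume "i < dim_row A" "j < dim_col A"
  hence "i < m" "j < k" using assms by auto
  thus "mat_adjoint (mat_adjoint A) $$ (i, j) = A $$ (i, j)"
    using assms mat_adjoint_index[OF mat_adjoint_carrier[OF assms], of i j] by simp
qed simp_all

lemma mat_adjoint_mult:
  fixes A B :: "complex mat"
  assumes A: "A \<in> carrier_mat m k" and B: "B \<in> carrier_mat k l"
  shows "mat_adjoint (A * B) = mat_adjoint B * mat_adjoint A"
proof (rule eq_matI)
  fix i j assume "i < dim_row (mat_adjoint B * mat_adjoint A)" "j < dim_col (mat_adjoint B * mat_adjoint A)"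
  hence ij: "i < l" "j < m" using mat_adjoint_carrier[OF A] mat_adjoint_carrier[OF B] by auto
  have "mat_adjoint (A * B) $$ (i, j) = cnj ((A * B) $$ (j, i))"
    using A B ij by (intro mat_adjoint_index[of _ m l]) auto
  also have "\<dots> = (\<Sum>r<k. mat_adjoint B $$ (i, r) * mat_adjoint A $$ (r, j))"
    unfolding mat_mult_index[OF A B ij(2,1)] using A B ij by (simp add: mult.commute)
  also have "\<dots> = (mat_adjoint B * mat_adjoint A) $$ (i, j)"
    using A B ij by (intro mat_mult_index[symmetric]) auto
  finally show "mat_adjoint (A * B) $$ (i, j) = (mat_adjoint B * mat_adjoint A) $$ (i, j)" .
qed (use assms in \<open>auto simp: mat_adjoint_def\<close>)

lemma unitary_matD:
  assumes "unitary_mat n U"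
  shows "U \<in> carrier_mat n n" "mat_adjoint U \<in> carrier_mat n n"
    "mat_adjoint U * U = 1\<^sub>m n" "U * mat_adjoint U = 1\<^sub>m n"
  using assms by (auto simp: unitary_mat_def)

lemma unitary_matI:
  assumes "U \<in> carrier_mat n n" "mat_adjoint U * U = 1\<^sub>m n"
  shows "unitary_mat n U"
  using assms mat_mult_left_right_inverse[of "mat_adjoint U" n U] by (simp add: unitary_mat_def)

lemma unitary_mat_adjoint:
  assumes U: "unitary_mat n U" shows "unitary_mat n (mat_adjoint U)"
  unfolding unitary_mat_def mat_adjoint_adjoint[OF unitary_matD(1)[OF U]]
  using unitary_matD[OF U] by blast

lemma unitary_mat_mult:
  assumes U: "unitary_mat n U" and W: "unitary_mat n W"
  shows "unitary_mat n (U * W)"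
proof (rule unitary_matI)
  note u = unitary_matD[OF U] and w = unitary_matD[OF W]
  show "U * W \<in> carrier_mat n n" using u w by simp
  have "mat_adjoint (U * W) * (U * W) = mat_adjoint W * mat_adjoint U * (U * W)"
    by (simp only: mat_adjoint_mult[OF u(1) w(1)])
  also have "\<dots> = mat_adjoint W * (mat_adjoint U * (U * W))"
    by (rule assoc_mult_mat[OF w(2) u(2) square_mult_carrier[OF u(1) w(1)]])
  also have "mat_adjoint U * (U * W) = mat_adjoint U * U * W"
    by (rule assoc_mult_mat[OF u(2,1) w(1), symmetric])
  also have "\<dots> = W" unfolding u(3) by (rule left_mult_one_mat[OF w(1)])
  finally show "mat_adjoint (U * W) * (U * W) = 1\<^sub>m n" by (simp only: w(3))
qed

lemma conj_mult_cancel: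
  assumes U: "unitary_mat n U" and X: "X \<in> carrier_mat n n" and Y: "Y \<in> carrier_mat n n"
  shows "(mat_adjoint U * X * U) * (mat_adjoint U * Y * U) = mat_adjoint U * (X * Y) * U"
proof -
  note u = unitary_matD[OF U]
  have c: "mat_adjoint U * X \<in> carrier_mat n n" "Y * U \<in> carrier_mat n n" "U * (mat_adjoint U * (Y * U)) \<in> carrier_mat n n"
    "mat_adjoint U * Y \<in> carrier_mat n n" "mat_adjoint U * (Y * U) \<in> carrier_mat n n" "X * Y \<in> carrier_mat n n"
    using u X Y by auto
  have "(mat_adjoint U * X * U) * (mat_adjoint U * Y * U) = (mat_adjoint U * X * U) * (mat_adjoint U * (Y * U))"
    by (simp only: assoc_mult_mat[OF u(2) Y u(1)])
  also have "\<dots> = (mat_adjoint U * X) * (U * (mat_adjoint U * (Y * U)))"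
    by (rule assoc_mult_mat[OF c(1) u(1) c(5)])
  also have "U * (mat_adjoint U * (Y * U)) = U * mat_adjoint U * (Y * U)"
    by (rule assoc_mult_mat[OF u(1,2) c(2), symmetric])
  also have "\<dots> = Y * U" unfolding u(4) by (rule left_mult_one_mat[OF c(2)])
  also have "mat_adjoint U * X * (Y * U) = mat_adjoint U * X * Y * U"
    by (rule assoc_mult_mat[OF c(1) Y u(1), symmetric])
  also have "mat_adjoint U * X * Y = mat_adjoint U * (X * Y)"
    by (rule assoc_mult_mat[OF u(2) X Y])
  finally show ?thesis .
qed

lemma conj_conj:
  assumes U: "unitary_mat n U" and W: "unitary_mat n W" and X: "X \<in> carrier_mat n n"
  shows "mat_adjoint W * (mat_adjoint U * X * U) * W = mat_adjoint (U * W) * X * (U * W)"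
proof -
  note u = unitary_matD[OF U] and w = unitary_matD[OF W]
  have c: "mat_adjoint U * X \<in> carrier_mat n n" "mat_adjoint W * mat_adjoint U \<in> carrier_mat n n"
    using u w X by auto
  have "mat_adjoint (U * W) * X * (U * W) = mat_adjoint W * mat_adjoint U * X * (U * W)"
    by (simp add: mat_adjoint_mult[OF u(1) w(1)])
  also have "\<dots> = mat_adjoint W * mat_adjoint U * X * U * W"
    by (rule assoc_mult_mat[symmetric, OF square_mult_carrier[OF c(2) X] u(1) w(1)])
  also have "mat_adjoint W * mat_adjoint U * X = mat_adjoint W * (mat_adjoint U * X)"
    by (rule assoc_mult_mat[OF w(2) u(2) X])
  also have "\<dots> * U = mat_adjoint W * (mat_adjoint U * X * U)"
    by (rule assoc_mult_mat[OF w(2) c(1) u(1)])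
  finally show ?thesis by simp
qed

lemma conj_inverse:
  assumes U: "unitary_mat n U" and X: "X \<in> carrier_mat n n" and eq: "X * U = U * Y" and Y: "Y \<in> carrier_mat n n"
  shows "mat_adjoint U * X * U = Y"
proof -
  note u = unitary_matD[OF U]
  have "mat_adjoint U * X * U = mat_adjoint U * (X * U)" by (rule assoc_mult_mat[OF u(2) X u(1)])
  also have "\<dots> = mat_adjoint U * U * Y" unfolding eq by (rule assoc_mult_mat[OF u(2,1) Y, symmetric])
  also have "\<dots> = Y" unfolding u(3) by (rule left_mult_one_mat[OF Y])
  finally show ?thesis .
qed

definition root_diag :: "nat \<Rightarrow> complex mat" where
  "root_diag n = mat_diag n (\<lambda>k. zeta n (int k))"

lemma root_diag_eq: "roots_of_unity_diag n = root_diag n"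
  by (simp add: roots_of_unity_diag_def root_diag_def zeta_def)

lemma root_diag_carrier [simp]: "root_diag n \<in> carrier_mat n n"
  by (simp add: root_diag_def)

lemma root_diag_index: "i < n \<Longrightarrow> j < n \<Longrightarrow> root_diag n $$ (i, j) = (if i = j then zeta n (int i) else 0)"
  by (simp add: root_diag_def mat_diag_def)

lemma conj_root_diag_index:
  assumes Q: "Q \<in> carrier_mat n n" and ij: "i < n" "j < n"
  shows "(Q * root_diag n * mat_adjoint Q) $$ (i, j) = (\<Sum>m<n. zeta n (int m) * (Q $$ (i, m) * cnj (Q $$ (j, m))))"
proof -
  have QD: "Q * root_diag n = mat n n (\<lambda>(i, j). Q $$ (i, j) * zeta n (int j))"
    unfolding root_diag_def by (rule mat_diag_mult_right[OF Q])
  show ?thesis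
    unfolding square_mult_index[OF square_mult_carrier[OF Q root_diag_carrier] mat_adjoint_carrier[OF Q] ij]
    unfolding QD using Q ij by (intro sum.cong) (simp_all add: mult_ac)
qed

lemma unitary_entries:
  assumes Q: "unitary_mat n Q" and ij: "i < n" "j < n"
  shows "(\<Sum>m<n. Q $$ (i, m) * cnj (Q $$ (j, m))) = (if i = j then 1 else 0)"
    "(\<Sum>m<n. cnj (Q $$ (m, i)) * Q $$ (m, j)) = (if i = j then 1 else 0)"
proof -
  note q = unitary_matD[OF Q]
  have "(Q * mat_adjoint Q) $$ (i, j) = (\<Sum>m<n. Q $$ (i, m) * cnj (Q $$ (j, m)))"
    unfolding square_mult_index[OF q(1,2) ij] using q(1) ij by (intro sum.cong) simp_all
  moreover have "(Q * mat_adjoint Q) $$ (i, j) = (if i = j then 1 else 0)"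
    unfolding q(4) using ij by simp
  ultimately show "(\<Sum>m<n. Q $$ (i, m) * cnj (Q $$ (j, m))) = (if i = j then 1 else 0)" by simp
  have "(mat_adjoint Q * Q) $$ (i, j) = (\<Sum>m<n. cnj (Q $$ (m, i)) * Q $$ (m, j))"
    unfolding square_mult_index[OF q(2,1) ij] using q(1) ij by (intro sum.cong) simp_all
  moreover have "(mat_adjoint Q * Q) $$ (i, j) = (if i = j then 1 else 0)"
    unfolding q(3) using ij by simp
  ultimately show "(\<Sum>m<n. cnj (Q $$ (m, i)) * Q $$ (m, j)) = (if i = j then 1 else 0)" by simp
qed

section \<open>Cyclic bases\<close>

text \<open>Let \<open>M = Q D Q\<^sup>*\<close>. The columns of \<open>F\<close> are the vectors \<open>M\<^sup>i e\<close> for the first basis vector \<open>e\<close>. In the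
eigenbasis of \<open>M\<close> they form a Fourier matrix whose rows are scaled by numbers of the same modulus, because
\<open>Q\<close> is flat; hence they are orthonormal, and \<open>M\<close> shifts them cyclically. A matrix \<open>M\<close> with entries of
modulus 0 or 1 sends basis vectors to multiples of basis vectors. So every column of \<open>F\<close> is such a multiple,
and \<open>F\<close> turns \<open>D\<close> into a permuted diagonal matrix.\<close>

lemma cyclic_basis:
  assumes Q: "unitary_mat n Q" and n: "n > 0"
    and flat: "\<And>j m. j < n \<Longrightarrow> m < n \<Longrightarrow> (cmod (Q $$ (j, m)))\<^sup>2 = 1 / real n"
    and mono: "\<And>j k. j < n \<Longrightarrow> k < n \<Longrightarrow> (Q * root_diag n * mat_adjoint Q) $$ (j, k) = 0
      \<or> cmod ((Q * root_diag n * mat_adjoint Q) $$ (j, k)) = 1"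
  obtains P F where "permutation_mat n P" "unitary_mat n F"
    "mat_adjoint F * (Q * root_diag n * mat_adjoint Q) * F = cyclic_shift_mat n"
    "mat_adjoint F * root_diag n * F = mat_adjoint P * root_diag n * P"
proof -
  note q = unitary_matD[OF Q]
  \<comment> \<open>The vectors in the eigenbasis of M, that is, X = Q^* F.\<close>
  define X where "X = mat n n (\<lambda>(m, i). cnj (Q $$ (0, m)) * zeta n (int m * int i))"
  define M where "M = Q * root_diag n * mat_adjoint Q"
  have X [simp]: "X \<in> carrier_mat n n" by (simp add: X_def)
  have M [simp]: "M \<in> carrier_mat n n" using q unfolding M_def by (intro mult_carrier_mat) auto
  have shift [simp]: "cyclic_shift_mat n \<in> carrier_mat n n" by (simp add: cyclic_shift_mat_def)
  have uX: "unitary_mat n X"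
  proof (rule unitary_matI[OF X], rule square_eqI)
    fix i l assume il: "i < n" "l < n"
    have "(mat_adjoint X * X) $$ (i, l) = (\<Sum>m<n. mat_adjoint X $$ (i, m) * X $$ (m, l))"
      using il by (intro square_mult_index) simp_all
    also have "\<dots> = (\<Sum>m<n. (1 / of_nat n) * zeta n ((int l - int i) * int m))"
    proof (rule sum.cong[OF refl])
      fix m assume "m \<in> {..<n}"
      hence m: "m < n" by simp
      have "Q $$ (0, m) * cnj (Q $$ (0, m)) = of_real (1 / real n)"
        using flat[OF n m] by (simp flip: complex_norm_square)
      moreover have "zeta n (- (int m * int i)) * zeta n (int m * int l) = zeta n ((int l - int i) * int m)"
        unfolding zeta_add[symmetric] by (simp add: algebra_simps)
      moreover have "mat_adjoint X $$ (i, m) * X $$ (m, l)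
          = (Q $$ (0, m) * cnj (Q $$ (0, m))) * (zeta n (- (int m * int i)) * zeta n (int m * int l))"
        unfolding mat_adjoint_index[OF X il(1) m] using il m by (simp add: X_def cnj_zeta mult_ac)
      ultimately show "mat_adjoint X $$ (i, m) * X $$ (m, l) = (1 / of_nat n) * zeta n ((int l - int i) * int m)"
        by simp
    qed
    also have "\<dots> = (1 / of_nat n) * (\<Sum>m<n. zeta n ((int l - int i) * int m))"
      by (simp only: sum_distrib_left)
    also have "\<dots> = 1\<^sub>m n $$ (i, l)"
      unfolding sum_zeta[OF n] using dvd_int_diff_iff[OF il(2,1)] il n by auto
    finally show "(mat_adjoint X * X) $$ (i, l) = 1\<^sub>m n $$ (i, l)" .
  qed simp_all
  define F where "F = Q * X"
  have uF: "unitary_mat n F" unfolding F_def by (rule unitary_mat_mult[OF Q uX])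
  note f = unitary_matD[OF uF]
  have DX: "root_diag n * X = X * cyclic_shift_mat n"
  proof (rule square_eqI)
    fix m i assume mi: "m < n" "i < n"
    have "(root_diag n * X) $$ (m, i) = zeta n (int m) * X $$ (m, i)"
      unfolding root_diag_def mat_diag_mult_left[OF X] using mi by simp
    also have "\<dots> = cnj (Q $$ (0, m)) * zeta n (int m * (int i + 1))"
      using mi by (simp add: X_def ring_distribs zeta_add mult_ac)
    also have "zeta n (int m * (int i + 1)) = zeta n (int m * int ((i + 1) mod n))"
    proof -
      have "int n dvd (int i + 1) - int ((i + 1) mod n)"
        by (simp add: zmod_int mod_eq_dvd_iff[symmetric] add.commute)
      hence "int n dvd int m * (int i + 1) - int m * int ((i + 1) mod n)"
        by (simp flip: right_diff_distrib)
      thus ?thesis using zeta_eq_iff[OF n] by blast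
    qed
    also have "cnj (Q $$ (0, m)) * zeta n (int m * int ((i + 1) mod n)) = X $$ (m, (i + 1) mod n)"
      using mi n by (simp add: X_def)
    also have "\<dots> = (\<Sum>k<n. if k = (i + 1) mod n then X $$ (m, k) else 0)"
      using n by simp
    also have "\<dots> = (\<Sum>k<n. X $$ (m, k) * cyclic_shift_mat n $$ (k, i))"
      using mi by (intro sum.cong) (simp_all add: cyclic_shift_mat_def)
    also have "\<dots> = (X * cyclic_shift_mat n) $$ (m, i)"
      using mi by (intro square_mult_index[symmetric]) simp_all
    finally show "(root_diag n * X) $$ (m, i) = (X * cyclic_shift_mat n) $$ (m, i)" .
  qed simp_all
  have MF: "M * F = F * cyclic_shift_mat n"
  proof -
    have QD: "Q * root_diag n \<in> carrier_mat n n" using q(1) by simp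
    have "M * F = Q * root_diag n * (mat_adjoint Q * (Q * X))"
      unfolding M_def F_def by (rule assoc_mult_mat[OF QD q(2) square_mult_carrier[OF q(1) X]])
    also have "mat_adjoint Q * (Q * X) = mat_adjoint Q * Q * X"
      by (rule assoc_mult_mat[OF q(2,1) X, symmetric])
    also have "\<dots> = X" unfolding q(3) by (rule left_mult_one_mat[OF X])
    also have "Q * root_diag n * X = Q * (root_diag n * X)" by (rule assoc_mult_mat[OF q(1) root_diag_carrier X])
    also have "\<dots> = F * cyclic_shift_mat n"
      unfolding DX F_def by (rule assoc_mult_mat[OF q(1) X shift, symmetric])
    finally show ?thesis .
  qed
  have conjM: "mat_adjoint F * M * F = cyclic_shift_mat n"
    by (rule conj_inverse[OF uF M MF shift])
  have step: "F $$ (k, Suc i) = (\<Sum>l<n. M $$ (k, l) * F $$ (l, i))" if "k < n" "Suc i < n" for k i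
  proof -
    have "F $$ (k, Suc i) = (\<Sum>r<n. if r = Suc i then F $$ (k, r) else 0)" using that by simp
    also have "\<dots> = (\<Sum>r<n. F $$ (k, r) * cyclic_shift_mat n $$ (r, i))"
      using that by (intro sum.cong) (simp_all add: cyclic_shift_mat_def)
    also have "\<dots> = (F * cyclic_shift_mat n) $$ (k, i)"
      using that f(1) by (intro square_mult_index[symmetric]) simp_all
    also have "\<dots> = (M * F) $$ (k, i)" by (simp only: MF)
    also have "\<dots> = (\<Sum>l<n. M $$ (k, l) * F $$ (l, i))" using that f(1) by (intro square_mult_index) simp_all
    finally show ?thesis .
  qed
  have col_norm: "(\<Sum>k<n. (cmod (F $$ (k, i)))\<^sup>2) = 1" if "i < n" for i
  proof -
    have "complex_of_real (\<Sum>k<n. (cmod (F $$ (k, i)))\<^sup>2) = (\<Sum>k<n. cnj (F $$ (k, i)) * F $$ (k, i))"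
      by (simp only: of_real_sum complex_norm_square mult.commute)
    also have "\<dots> = of_real 1" using unitary_entries(2)[OF uF that that] by simp
    finally show ?thesis by (simp only: of_real_eq_iff)
  qed
  have single: "\<exists>p<n. cmod (F $$ (p, i)) = 1 \<and> (\<forall>k<n. k \<noteq> p \<longrightarrow> F $$ (k, i) = 0)"
    if i: "i < n" and vals: "\<And>k. k < n \<Longrightarrow> F $$ (k, i) = 0 \<or> cmod (F $$ (k, i)) = 1" for i
  proof -
    \<comment> \<open>Entries of modulus 0 or 1 in a column of norm 1.\<close>
    have "\<exists>p<n. F $$ (p, i) \<noteq> 0"
    proof (rule ccontr)
      assume "\<not> ?thesis"
      hence "(\<Sum>k<n. (cmod (F $$ (k, i)))\<^sup>2) = 0" by simp
      thus False using col_norm[OF i] by simp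
    qed
    then obtain p where p: "p < n" "F $$ (p, i) \<noteq> 0" by blast
    have p1: "cmod (F $$ (p, i)) = 1" using vals[OF p(1)] p(2) by simp
    have "(\<Sum>k\<in>{..<n} - {p}. (cmod (F $$ (k, i)))\<^sup>2) = 0"
      using col_norm[OF i] sum.remove[of "{..<n}" p "\<lambda>k. (cmod (F $$ (k, i)))\<^sup>2"] p(1) p1 by simp
    hence "\<forall>k\<in>{..<n} - {p}. (cmod (F $$ (k, i)))\<^sup>2 = 0"
      by (subst (asm) sum_nonneg_eq_0_iff) auto
    thus ?thesis using p(1) p1 by auto
  qed
  have mono': "M $$ (j, k) = 0 \<or> cmod (M $$ (j, k)) = 1" if "j < n" "k < n" for j k
    using mono[OF that] by (simp add: M_def)
  have cols: "\<exists>p<n. cmod (F $$ (p, i)) = 1 \<and> (\<forall>k<n. k \<noteq> p \<longrightarrow> F $$ (k, i) = 0)" if "i < n" for i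
    using that
  proof (induction i)
    case 0
    have "F $$ (k, 0) = (if k = 0 then 1 else 0)" if "k < n" for k
    proof -
      have "F $$ (k, 0) = (\<Sum>m<n. Q $$ (k, m) * X $$ (m, 0))"
        unfolding F_def using that n q(1) by (intro square_mult_index) simp_all
      also have "\<dots> = (\<Sum>m<n. Q $$ (k, m) * cnj (Q $$ (0, m)))"
        using n by (intro sum.cong) (simp_all add: X_def)
      finally show ?thesis using unitary_entries(1)[OF Q that n] by simp
    qed
    thus ?case using n by (intro exI[of _ 0]) simp
  next
    case (Suc i)
    then obtain p where p: "p < n" "cmod (F $$ (p, i)) = 1" "\<And>k. k < n \<Longrightarrow> k \<noteq> p \<Longrightarrow> F $$ (k, i) = 0"
      using Suc_lessD by blast
    have "F $$ (k, Suc i) = M $$ (k, p) * F $$ (p, i)" if "k < n" for k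
    proof -
      have "F $$ (k, Suc i) = (\<Sum>l<n. if l = p then M $$ (k, l) * F $$ (l, i) else 0)"
        unfolding step[OF that Suc.prems] using p(3) by (intro sum.cong) auto
      thus ?thesis using p(1) by simp
    qed
    hence "F $$ (k, Suc i) = 0 \<or> cmod (F $$ (k, Suc i)) = 1" if "k < n" for k
      using mono'[OF that p(1)] p(2) that by (auto simp: norm_mult)
    thus ?case by (rule single[OF Suc.prems])
  qed
  define p where "p = (\<lambda>i. if i < n then SOME p. p < n \<and> cmod (F $$ (p, i)) = 1 \<and> (\<forall>k<n. k \<noteq> p \<longrightarrow> F $$ (k, i) = 0) else i)"
  have p: "p i < n" "cmod (F $$ (p i, i)) = 1" "\<And>k. k < n \<Longrightarrow> k \<noteq> p i \<Longrightarrow> F $$ (k, i) = 0" if "i < n" for i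
    using someI_ex[OF cols[OF that]] that by (auto simp: p_def)
  have inner: "(\<Sum>k<n. c k * (cnj (F $$ (k, i)) * F $$ (k, l))) = (if p i = p l then c (p i) * (cnj (F $$ (p i, i)) * F $$ (p i, l)) else 0)"
    if "i < n" "l < n" for i l and c :: "nat \<Rightarrow> complex"
  proof -
    have "(\<Sum>k<n. c k * (cnj (F $$ (k, i)) * F $$ (k, l)))
        = (\<Sum>k<n. if k = p i then c k * (cnj (F $$ (k, i)) * F $$ (k, l)) else 0)"
      using p(3)[OF that(1)] by (intro sum.cong) auto
    also have "\<dots> = c (p i) * (cnj (F $$ (p i, i)) * F $$ (p i, l))" using p(1)[OF that(1)] by simp
    finally show ?thesis using p(3)[OF that(2) p(1)[OF that(1)]] by auto
  qed
  have inj: "inj_on p {..<n}"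
  proof (rule inj_onI, rule ccontr)
    fix i l assume il: "i \<in> {..<n}" "l \<in> {..<n}" "p i = p l" "i \<noteq> l"
    have "cnj (F $$ (p i, i)) * F $$ (p i, l) = 0"
      using inner[of i l "\<lambda>_. 1"] unitary_entries(2)[OF uF, of i l] il by simp
    moreover have "cmod (F $$ (p i, i)) = 1" "cmod (F $$ (p i, l)) = 1" using p(2)[of i] p(2)[of l] il by auto
    ultimately show False by auto
  qed
  have "bij_betw p {..<n} {..<n}"
    using inj p(1) endo_inj_surj[of "{..<n}" p] by (auto simp: bij_betw_def)
  hence perm: "p permutes {..<n}" by (rule bij_imp_permutes) (simp add: p_def)
  define P where "P = mat n n (\<lambda>(i, j). if i = p j then 1 else 0 :: complex)"
  have P [simp]: "P \<in> carrier_mat n n" by (simp add: P_def)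
  have diag: "mat_adjoint F * root_diag n * F = mat_adjoint P * root_diag n * P"
  proof (rule square_eqI)
    fix i l assume il: "i < n" "l < n"
    have entry: "(mat_adjoint G * root_diag n * G) $$ (i, l) = (\<Sum>k<n. zeta n (int k) * (cnj (G $$ (k, i)) * G $$ (k, l)))"
      if G: "G \<in> carrier_mat n n" for G
      using conj_root_diag_index[OF mat_adjoint_carrier[OF G] il] G il by simp
    have peq: "p i = p l \<longleftrightarrow> i = l" using inj il by (auto simp: inj_on_eq_iff)
    have "(mat_adjoint F * root_diag n * F) $$ (i, l) = (if i = l then zeta n (int (p i)) else 0)"
    proof -
      have "cnj (F $$ (p i, i)) * F $$ (p i, i) = 1"
        using unimodular_mult_cnj[OF p(2)[OF il(1)]] by (simp add: mult.commute)
      thus ?thesis unfolding entry[OF f(1)] inner[OF il] peq by auto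
    qed
    also have "\<dots> = (\<Sum>k<n. if k = p i then zeta n (int k) * (if k = p l then 1 else 0) else 0)"
      using p(1)[OF il(1)] peq by simp
    also have "\<dots> = (\<Sum>k<n. zeta n (int k) * (cnj (P $$ (k, i)) * P $$ (k, l)))"
      using il by (intro sum.cong) (simp_all add: P_def)
    finally show "(mat_adjoint F * root_diag n * F) $$ (i, l) = (mat_adjoint P * root_diag n * P) $$ (i, l)"
      unfolding entry[OF P] .
  qed (simp_all add: f(1))
  have "permutation_mat n P" unfolding permutation_mat_def P_def using perm by blast
  thus ?thesis using that uF conjM diag unfolding M_def by blast
qed

section \<open>Low order coefficients of the pencil\<close>

lemma det_zero_kernel:
  fixes A :: "complex mat"
  assumes A: "A \<in> carrier_mat n n" and "det A = 0"
  obtains v where "\<exists>i<n. v i \<noteq> 0" "\<And>i. i < n \<Longrightarrow> (\<Sum>k<n. A $$ (i, k) * v k) = 0"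
proof -
  obtain w where w: "w \<in> carrier_vec n" "w \<noteq> 0\<^sub>v n" "A *\<^sub>v w = 0\<^sub>v n"
    using det_0_iff_vec_prod_zero_field[OF A] assms(2) by blast
  have "\<exists>i<n. w $ i \<noteq> 0"
  proof (rule ccontr)
    assume "\<not> ?thesis"
    hence "w = 0\<^sub>v n" using w(1) by (intro eq_vecI) auto
    thus False using w(2) by simp
  qed
  moreover have "(\<Sum>k<n. A $$ (i, k) * w $ k) = 0" if "i < n" for i
  proof -
    have "(A *\<^sub>v w) $ i = (\<Sum>k<n. A $$ (i, k) * w $ k)"
      using A w(1) that by (auto simp: scalar_prod_def lessThan_atLeast0 intro!: sum.cong)
    thus ?thesis using w(3) that by simp
  qed
  ultimately show ?thesis using that by blast
qed

lemma det_mat_diag: "det (mat_diag n f) = (\<Prod>i<n. f i)"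
proof -
  have "det (mat_diag n f) = prod_list (diag_mat (mat_diag n f))"
    by (rule det_upper_triangular[of _ n]) (auto simp: mat_diag_def)
  also have "diag_mat (mat_diag n f) = map f [0..<n]"
    by (rule nth_equalityI) (auto simp: diag_mat_def mat_diag_def)
  finally show ?thesis by (simp add: prod.list_conv_set_nth lessThan_atLeast0)
qed

text \<open>This replaces the extraction of coefficients from the Leibniz formula: the determinant is continuous, so the
limiting matrix is singular, and its kernel yields the desired equation.\<close>

lemma kernel_of_limit:
  fixes E :: "complex \<Rightarrow> nat \<Rightarrow> nat \<Rightarrow> complex"
  assumes cont: "\<And>i k. i < n \<Longrightarrow> k < n \<Longrightarrow> ((\<lambda>t. E t i k) \<longlongrightarrow> E 0 i k) (at 0)"
    and det: "\<forall>\<^sub>F t in at 0. det (mat n n (\<lambda>(i, k). E t i k)) = t ^ d * c" and d: "d > 0"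
  obtains v where "\<exists>i<n. v i \<noteq> 0" "\<And>i. i < n \<Longrightarrow> (\<Sum>k<n. E 0 i k * v k) = 0"
proof -
  define M where "M = (\<lambda>t. mat n n (\<lambda>(i, k). E t i k))"
  have M: "M t \<in> carrier_mat n n" for t by (simp add: M_def)
  have dM: "det (M t) = (\<Sum>p | p permutes {0..<n}. signof p * (\<Prod>i = 0..<n. E t i (p i)))" for t
    unfolding det_def'[OF M] by (intro sum.cong prod.cong refl arg_cong2[where f = "(*)"])
      (auto simp: M_def permutes_in_image)
  have "((\<lambda>t. det (M t)) \<longlongrightarrow> det (M 0)) (at 0)"
    unfolding dM by (intro tendsto_sum tendsto_mult tendsto_const tendsto_prod cont)
      (auto simp: permutes_in_image)
  moreover have "((\<lambda>t. det (M t)) \<longlongrightarrow> 0) (at 0)"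
  proof -
    have "((\<lambda>t :: complex. t ^ d * c) \<longlongrightarrow> 0 ^ d * c) (at 0)" by (intro tendsto_intros)
    hence "((\<lambda>t :: complex. t ^ d * c) \<longlongrightarrow> 0) (at 0)" using d by (simp add: power_0_left)
    thus ?thesis by (rule Lim_transform_eventually)
      (use det in \<open>simp add: M_def eq_commute\<close>)
  qed
  ultimately have "det (M 0) = 0" by (rule tendsto_unique[rotated]) simp
  then obtain v where "\<exists>i<n. v i \<noteq> 0" "\<And>i. i < n \<Longrightarrow> (\<Sum>k<n. M 0 $$ (i, k) * v k) = 0"
    using det_zero_kernel[OF M] by blast
  thus ?thesis using that[of v] by (simp add: M_def)
qed

text \<open>The matrix is \<open>1 - x A - y B - z A B\<close> at \<open>x = 1 / \<alpha> j\<close>, \<open>y = t\<close>, \<open>z = \<kappa> t\<close> in the eigenbasis of \<open>A\<close>, and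
its determinant is of order \<open>t\<^sup>n\<close>. Row \<open>j\<close> is divisible by \<open>t\<close>, and once \<open>b j j = 0\<close> is known, so is
column \<open>j\<close>. What remains after division tends to a matrix that is diagonal with nonzero entries outside
row and column \<open>j\<close>, and it is still singular in the limit because \<open>n > 2\<close>. Eliminating the other unknowns
from a kernel vector gives a linear relation for the products \<open>b j k * b k j\<close> with weights
\<open>(1 + \<kappa> * \<alpha> k) / (\<alpha> j - \<alpha> k)\<close>; two values of \<open>\<kappa>\<close> separate the two sums.\<close>

lemma pencil_coefficients:
  fixes \<alpha> :: "nat \<Rightarrow> complex" and b :: "nat \<Rightarrow> nat \<Rightarrow> complex"
  assumes n: "n \<ge> 3" and j: "j < n"
    and unit: "\<And>k. k < n \<Longrightarrow> cmod (\<alpha> k) = 1" and dist: "\<And>k. k < n \<Longrightarrow> k \<noteq> j \<Longrightarrow> \<alpha> k \<noteq> \<alpha> j"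
    and det: "\<And>\<kappa>. \<exists>c. \<forall>\<^sub>F t in at 0. det (mat n n (\<lambda>(i, k).
      (if i = k then 1 - cnj (\<alpha> j) * \<alpha> i else 0) - t * (1 + \<kappa> * \<alpha> i) * b i k)) = t ^ n * c"
  shows "b j j = 0" "(\<Sum>k<n. b j k * b k j) = 0"
    "(\<Sum>k\<in>{..<n} - {j}. b j k * b k j / (\<alpha> j - \<alpha> k)) = 0"
proof -
  define \<delta> where "\<delta> = (\<lambda>i. 1 - cnj (\<alpha> j) * \<alpha> i)"
  have aj: "\<alpha> j * cnj (\<alpha> j) = 1" "\<alpha> j \<noteq> 0" using unimodular_mult_cnj[OF unit[OF j]] unit[OF j] by auto
  have \<delta>: "\<delta> i * \<alpha> j = \<alpha> j - \<alpha> i" for i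
  proof -
    have "\<delta> i * \<alpha> j = \<alpha> j - (\<alpha> j * cnj (\<alpha> j)) * \<alpha> i" by (simp add: \<delta>_def algebra_simps)
    thus ?thesis using aj by simp
  qed
  have \<delta>j: "\<delta> j = 0" using aj by (simp add: \<delta>_def mult.commute)
  have \<delta>_nz: "\<delta> i \<noteq> 0" if "i < n" "i \<noteq> j" for i using \<delta>[of i] dist[OF that] by auto
  define N where "N = (\<lambda>\<kappa> t. mat n n (\<lambda>(i, k). (if i = k then \<delta> i else 0) - t * (1 + \<kappa> * \<alpha> i) * b i k))"
  have N: "\<exists>c. \<forall>\<^sub>F t in at 0. det (N \<kappa> t) = t ^ n * c" for \<kappa>
    unfolding N_def \<delta>_def by (rule det)
  have prodj: "(\<Prod>i<n. if i = j then z else 1) = z" for z :: complex using j by simp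
  show bjj: "b j j = 0"
  proof -
    define E where "E = (\<lambda>t i k. if i = j then b j k else (if i = k then \<delta> i else 0) - t * b i k)"
    have fac: "N 0 t = mat_diag n (\<lambda>i. if i = j then - t else 1) * mat n n (\<lambda>(i, k). E t i k)" for t
      by (subst mat_diag_mult_left[of _ n n]) (auto simp: N_def E_def \<delta>j intro!: eq_matI)
    have detN: "det (N 0 t) = - t * det (mat n n (\<lambda>(i, k). E t i k))" for t
      unfolding fac by (subst det_mult[of _ n]) (simp_all add: det_mat_diag prodj)
    obtain c where c: "\<forall>\<^sub>F t in at 0. det (N 0 t) = t ^ n * c" using N by blast
    have "\<forall>\<^sub>F t in at 0. det (mat n n (\<lambda>(i, k). E t i k)) = t ^ (n - 1) * (- c)"
      using c eventually_neq_at_within[of 0]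
    proof eventually_elim
      case (elim t)
      have "t ^ n = t * t ^ (n - 1)" using n by (simp flip: power_Suc)
      hence "- t * det (mat n n (\<lambda>(i, k). E t i k)) = - t * (t ^ (n - 1) * (- c))"
        using elim(1) unfolding detN by simp
      thus ?case using elim(2) by (simp only: mult_cancel_left neg_equal_0_iff_equal) simp
    qed
    then obtain v where v: "\<exists>i<n. v i \<noteq> 0" "\<And>i. i < n \<Longrightarrow> (\<Sum>k<n. E 0 i k * v k) = 0"
      by (rule kernel_of_limit[rotated]) (use n in \<open>auto simp: E_def intro!: tendsto_eq_intros\<close>)
    have v0: "v i = 0" if "i < n" "i \<noteq> j" for i
    proof -
      have "(\<Sum>k<n. E 0 i k * v k) = (\<Sum>k<n. if k = i then \<delta> i * v i else 0)"
        using that by (intro sum.cong) (auto simp: E_def)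
      thus ?thesis using v(2)[OF that(1)] \<delta>_nz[OF that] that by simp
    qed
    have "(\<Sum>k<n. E 0 j k * v k) = (\<Sum>k<n. if k = j then b j j * v j else 0)"
    proof (rule sum.cong[OF refl])
      fix k assume "k \<in> {..<n}"
      thus "E 0 j k * v k = (if k = j then b j j * v j else 0)" using v0[of k] by (auto simp: E_def)
    qed
    hence "b j j * v j = 0" using v(2)[OF j] j by simp
    moreover from v(1) obtain i where i: "i < n" "v i \<noteq> 0" by blast
    hence "v j \<noteq> 0" using v0[OF i(1)] by (cases "i = j") auto
    ultimately show ?thesis by simp
  qed
  have weighted: "(\<Sum>k\<in>{..<n} - {j}. b j k * b k j * ((1 + \<kappa> * \<alpha> k) / (\<alpha> j - \<alpha> k))) = 0"
    if wj: "1 + \<kappa> * \<alpha> j \<noteq> 0" for \<kappa>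
  proof -
    define w where "w = (\<lambda>i. 1 + \<kappa> * \<alpha> i)"
    define E where "E = (\<lambda>t i k. if i = j then (if k = j then 0 else b j k)
      else if k = j then - w i * b i j else (if i = k then \<delta> i else 0) - t * w i * b i k)"
    have fac: "N \<kappa> t = mat_diag n (\<lambda>i. if i = j then - t * w j else 1) * mat n n (\<lambda>(i, k). E t i k)
        * mat_diag n (\<lambda>i. if i = j then t else 1)" for t
      by (subst mat_diag_mult_right[of _ n n], simp)
        (subst mat_diag_mult_left[of _ n n], auto simp: N_def E_def \<delta>j bjj w_def algebra_simps intro!: eq_matI)
    have detN: "det (N \<kappa> t) = - (t * t) * w j * det (mat n n (\<lambda>(i, k). E t i k))" for t
      unfolding fac by (subst det_mult[of _ n], simp, simp, subst det_mult[of _ n])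
        (simp_all add: det_mat_diag prodj mult_ac)
    obtain c where c: "\<forall>\<^sub>F t in at 0. det (N \<kappa> t) = t ^ n * c" using N by blast
    have "\<forall>\<^sub>F t in at 0. det (mat n n (\<lambda>(i, k). E t i k)) = t ^ (n - 2) * (- c / w j)"
      using c eventually_neq_at_within[of 0]
    proof eventually_elim
      case (elim t)
      have "2 + (n - 2) = n" using n by simp
      hence "t ^ n = (t * t) * t ^ (n - 2)"
        using power_add[of t 2 "n - 2"] by (simp only: power2_eq_square)
      hence "- (t * t) * w j * det (mat n n (\<lambda>(i, k). E t i k)) = (t * t) * t ^ (n - 2) * c"
        using elim(1) unfolding detN by simp
      also have "\<dots> = - (t * t) * w j * (t ^ (n - 2) * (- c / w j))"
        using wj by (simp add: w_def)
      finally have "- (t * t) * w j * det (mat n n (\<lambda>(i, k). E t i k)) = - (t * t) * w j * (t ^ (n - 2) * (- c / w j))" .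
      moreover have "- (t * t) * w j \<noteq> 0" using elim(2) wj by (simp add: w_def)
      ultimately show ?case by (simp only: mult_cancel_left) simp
    qed
    then obtain v where v: "\<exists>i<n. v i \<noteq> 0" "\<And>i. i < n \<Longrightarrow> (\<Sum>k<n. E 0 i k * v k) = 0"
      by (rule kernel_of_limit[rotated]) (use n in \<open>auto simp: E_def intro!: tendsto_eq_intros\<close>)
    have vi: "\<delta> i * v i = w i * b i j * v j" if "i < n" "i \<noteq> j" for i
    proof -
      have "(\<Sum>k<n. E 0 i k * v k) = (\<Sum>k<n. (if k = i then \<delta> i * v i else 0) + (if k = j then - w i * b i j * v j else 0))"
        using that by (intro sum.cong) (auto simp: E_def)
      also have "\<dots> = \<delta> i * v i - w i * b i j * v j" using that j by (simp add: sum.distrib)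
      finally show ?thesis using v(2)[OF that(1)] by simp
    qed
    have vj: "v j \<noteq> 0"
    proof
      assume "v j = 0"
      from v(1) obtain i where i: "i < n" "v i \<noteq> 0" by blast
      hence "i \<noteq> j" using \<open>v j = 0\<close> by blast
      thus False using vi[OF i(1)] \<delta>_nz[OF i(1)] i(2) \<open>v j = 0\<close> by simp
    qed
    have split: "(\<Sum>k<n. f k) = f j + (\<Sum>k\<in>{..<n} - {j}. f k)" for f :: "nat \<Rightarrow> complex"
      using j by (simp add: sum.remove)
    have "(\<Sum>k\<in>{..<n} - {j}. b j k * v k) = 0"
      using v(2)[OF j] unfolding split by (simp add: E_def)
    moreover have term_eq: "b j k * v k = \<alpha> j * v j * (b j k * b k j * ((1 + \<kappa> * \<alpha> k) / (\<alpha> j - \<alpha> k)))"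
      if "k \<in> {..<n} - {j}" for k
    proof -
      have k: "k < n" "k \<noteq> j" using that by auto
      have ne: "\<alpha> j - \<alpha> k \<noteq> 0" using dist[OF k] by simp
      have "(\<alpha> j - \<alpha> k) * v k = \<alpha> j * (w k * b k j * v j)"
        unfolding \<delta>[symmetric] using vi[OF k] by (simp add: mult_ac)
      hence "v k = \<alpha> j * (w k * b k j * v j) / (\<alpha> j - \<alpha> k)" using ne by (simp add: nonzero_eq_divide_eq mult.commute)
      thus ?thesis by (simp add: w_def)
    qed
    ultimately have "\<alpha> j * v j * (\<Sum>k\<in>{..<n} - {j}. b j k * b k j * ((1 + \<kappa> * \<alpha> k) / (\<alpha> j - \<alpha> k))) = 0"
      unfolding sum_distrib_left using sum.cong[OF refl term_eq] by simp
    thus ?thesis using vj aj(2) by simp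
  qed
  have w0: "(\<Sum>k\<in>{..<n} - {j}. b j k * b k j * (1 / (\<alpha> j - \<alpha> k))) = 0" using weighted[of 0] by simp
  thus "(\<Sum>k\<in>{..<n} - {j}. b j k * b k j / (\<alpha> j - \<alpha> k)) = 0" by simp
  have "1 + cnj (\<alpha> j) * \<alpha> j \<noteq> 0" using aj by (simp add: mult.commute)
  note w1 = weighted[OF this]
  have "b j k * b k j = 2 * (b j k * b k j * (1 / (\<alpha> j - \<alpha> k)) * \<alpha> j)
      - b j k * b k j * ((1 + cnj (\<alpha> j) * \<alpha> k) / (\<alpha> j - \<alpha> k)) * \<alpha> j" if "k \<in> {..<n} - {j}" for k
  proof -
    have ne: "\<alpha> j - \<alpha> k \<noteq> 0" using dist[of k] that by simp
    have "(1 + cnj (\<alpha> j) * \<alpha> k) * \<alpha> j = \<alpha> j + (\<alpha> j * cnj (\<alpha> j)) * \<alpha> k" by (simp add: algebra_simps)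
    hence e: "(1 + cnj (\<alpha> j) * \<alpha> k) * \<alpha> j = \<alpha> j + \<alpha> k" using aj by simp
    have one: "2 * (\<alpha> j / (\<alpha> j - \<alpha> k)) - (1 + cnj (\<alpha> j) * \<alpha> k) * \<alpha> j / (\<alpha> j - \<alpha> k) = 1"
    proof -
      have "2 * (\<alpha> j / (\<alpha> j - \<alpha> k)) - (\<alpha> j + \<alpha> k) / (\<alpha> j - \<alpha> k)
          = (2 * \<alpha> j - (\<alpha> j + \<alpha> k)) / (\<alpha> j - \<alpha> k)"
        by (simp only: diff_divide_distrib times_divide_eq_right)
      also have "2 * \<alpha> j - (\<alpha> j + \<alpha> k) = \<alpha> j - \<alpha> k" by simp
      also have "(\<alpha> j - \<alpha> k) / (\<alpha> j - \<alpha> k) = 1" using ne by (rule divide_self)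
      finally show ?thesis unfolding e .
    qed
    have gen: "2 * (c * (1 / D) * a) - c * (W / D) * a = c * (2 * (a / D) - W * a / D)" for c D a W :: complex
      by (simp add: right_diff_distrib mult_ac)
    show ?thesis unfolding gen one by simp
  qed
  hence "(\<Sum>k\<in>{..<n} - {j}. b j k * b k j) = (\<Sum>k\<in>{..<n} - {j}. 2 * (b j k * b k j * (1 / (\<alpha> j - \<alpha> k)) * \<alpha> j)
      - b j k * b k j * ((1 + cnj (\<alpha> j) * \<alpha> k) / (\<alpha> j - \<alpha> k)) * \<alpha> j)"
    by (rule sum.cong[OF refl])
  also have "\<dots> = 2 * ((\<Sum>k\<in>{..<n} - {j}. b j k * b k j * (1 / (\<alpha> j - \<alpha> k))) * \<alpha> j)
      - (\<Sum>k\<in>{..<n} - {j}. b j k * b k j * ((1 + cnj (\<alpha> j) * \<alpha> k) / (\<alpha> j - \<alpha> k))) * \<alpha> j"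
    by (simp only: sum_subtractf sum_distrib_left sum_distrib_right)
  also have "\<dots> = 0" unfolding w0 w1 by simp
  finally show "(\<Sum>k<n. b j k * b k j) = 0" using j bjj by (simp add: sum.remove[of "{..<n}" j])
qed

section \<open>Orthogonal eigenvectors\<close>

definition cinner :: "nat \<Rightarrow> complex vec \<Rightarrow> complex vec \<Rightarrow> complex" where
  "cinner n v w = (\<Sum>i<n. v $ i * cnj (w $ i))"

lemma mult_mat_vec_index:
  assumes "A \<in> carrier_mat n n" "v \<in> carrier_vec n" "i < n"
  shows "(A *\<^sub>v v) $ i = (\<Sum>k<n. A $$ (i, k) * v $ k)"
  using assms by (auto simp: scalar_prod_def lessThan_atLeast0 intro!: sum.cong)

lemma cinner_adjoint:
  assumes A: "A \<in> carrier_mat n n" and v: "v \<in> carrier_vec n" and w: "w \<in> carrier_vec n"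
  shows "cinner n (A *\<^sub>v v) w = cinner n v (mat_adjoint A *\<^sub>v w)"
proof -
  have "cinner n (A *\<^sub>v v) w = (\<Sum>i<n. \<Sum>k<n. A $$ (i, k) * v $ k * cnj (w $ i))"
    unfolding cinner_def by (rule sum.cong[OF refl]) (simp only: lessThan_iff mult_mat_vec_index[OF A v] sum_distrib_right)
  also have "\<dots> = (\<Sum>k<n. \<Sum>i<n. A $$ (i, k) * v $ k * cnj (w $ i))" by (rule sum.swap)
  also have "\<dots> = cinner n v (mat_adjoint A *\<^sub>v w)"
    unfolding cinner_def
  proof (rule sum.cong[OF refl])
    fix k assume "k \<in> {..<n}"
    hence k: "k < n" by simp
    have "cnj ((mat_adjoint A *\<^sub>v w) $ k) = (\<Sum>i<n. A $$ (i, k) * cnj (w $ i))"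
      unfolding mult_mat_vec_index[OF mat_adjoint_carrier[OF A] w k] cnj_sum
      by (rule sum.cong[OF refl]) (simp add: mat_adjoint_index[OF A k])
    thus "(\<Sum>i<n. A $$ (i, k) * v $ k * cnj (w $ i)) = v $ k * cnj ((mat_adjoint A *\<^sub>v w) $ k)"
      by (simp add: sum_distrib_left mult_ac)
  qed
  finally show ?thesis .
qed

lemma cinner_smult_left:
  "v \<in> carrier_vec n \<Longrightarrow> cinner n (c \<cdot>\<^sub>v v) w = c * cinner n v w"
  by (simp add: cinner_def sum_distrib_left mult.assoc)

lemma cinner_smult_right:
  "w \<in> carrier_vec n \<Longrightarrow> cinner n v (c \<cdot>\<^sub>v w) = cnj c * cinner n v w"
  by (simp add: cinner_def sum_distrib_left mult_ac)

lemma cinner_commute: "cinner n w v = cnj (cinner n v w)"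
  by (simp add: cinner_def mult.commute)

lemma cinner_self:
  assumes "v \<in> carrier_vec n"
  shows "cinner n v v = of_real ((euclidean_norm v)\<^sup>2)"
proof -
  have "(euclidean_norm v)\<^sup>2 = (\<Sum>i<n. (cmod (v $ i))\<^sup>2)"
    using assms by (simp add: euclidean_norm_def sum_nonneg)
  thus ?thesis by (simp only: cinner_def of_real_sum complex_norm_square)
qed

lemma euclidean_norm_pos:
  assumes v: "v \<in> carrier_vec n" and "v \<noteq> 0\<^sub>v n"
  shows "euclidean_norm v > 0"
proof -
  obtain i where i: "i < n" "v $ i \<noteq> 0"
  proof (rule ccontr)
    assume "\<not> thesis"
    hence "v = 0\<^sub>v n" using v that by (intro eq_vecI) auto
    thus False using assms(2) by simp
  qed
  have "(\<Sum>j<n. (cmod (v $ j))\<^sup>2) > 0" using i by (intro sum_pos2[of _ i]) auto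
  thus ?thesis using v by (simp add: euclidean_norm_def)
qed

lemma euclidean_norm_smult:
  assumes "v \<in> carrier_vec n" shows "euclidean_norm (c \<cdot>\<^sub>v v) = cmod c * euclidean_norm v"
  using assms by (simp add: euclidean_norm_def norm_mult power_mult_distrib sum_distrib_left[symmetric] real_sqrt_mult)

text \<open>The vector \<open>z\<close>, the image of \<open>w\<close> under the adjoint, is \<open>cnj \<mu>\<close> times \<open>w\<close>: by normality it has the length
that makes the squared distance of the two vectors vanish.\<close>

lemma normal_eigenvectors_orthogonal:
  assumes A: "A \<in> carrier_mat n n" and normal: "normal_mat A"
    and v: "v \<in> carrier_vec n" "A *\<^sub>v v = \<alpha> \<cdot>\<^sub>v v" and w: "w \<in> carrier_vec n" "A *\<^sub>v w = \<mu> \<cdot>\<^sub>v w"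
    and ne: "\<alpha> \<noteq> \<mu>"
  shows "cinner n v w = 0"
proof -
  note Ad = mat_adjoint_carrier[OF A]
  define z where "z = mat_adjoint A *\<^sub>v w"
  have z: "z \<in> carrier_vec n" unfolding z_def using Ad w(1) by simp
  have zz: "cinner n z z = \<mu> * cnj \<mu> * cinner n w w"
  proof -
    have "cinner n z z = cinner n (A *\<^sub>v z) w"
      unfolding cinner_adjoint[OF A z w(1)] by (simp add: z_def)
    also have "A *\<^sub>v z = mat_adjoint A *\<^sub>v (A *\<^sub>v w)"
      unfolding z_def using assoc_mult_mat_vec[OF A Ad w(1)] assoc_mult_mat_vec[OF Ad A w(1)] normal
      by (simp add: normal_mat_def)
    also have "cinner n \<dots> w = cinner n (A *\<^sub>v w) (A *\<^sub>v w)"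
      using cinner_adjoint[OF Ad _ w(1), of "A *\<^sub>v w"] A w(1) by (simp add: mat_adjoint_adjoint[OF A])
    finally show ?thesis by (simp add: w cinner_smult_left cinner_smult_right)
  qed
  have wz: "cinner n w z = \<mu> * cinner n w w"
    unfolding z_def cinner_adjoint[OF A w(1,1), symmetric] by (simp add: w cinner_smult_left)
  have zw: "cinner n z w = cnj \<mu> * cinner n w w"
    using wz cinner_commute[of n z w] cinner_commute[of n w w] by simp
  have "(\<Sum>i<n. (z $ i - cnj \<mu> * w $ i) * cnj (z $ i - cnj \<mu> * w $ i))
      = cinner n z z - \<mu> * cinner n z w - cnj \<mu> * cinner n w z + \<mu> * cnj \<mu> * cinner n w w"
    by (simp add: cinner_def algebra_simps sum.distrib sum_subtractf sum_distrib_left)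
  also have "\<dots> = 0" unfolding zz wz zw by (simp add: mult_ac)
  finally have "complex_of_real (\<Sum>i<n. (cmod (z $ i - cnj \<mu> * w $ i))\<^sup>2) = of_real 0"
    by (simp only: of_real_sum complex_norm_square of_real_0)
  hence "(\<Sum>i<n. (cmod (z $ i - cnj \<mu> * w $ i))\<^sup>2) = 0" by (simp only: of_real_eq_iff)
  hence zi: "z $ i = cnj \<mu> * w $ i" if "i < n" for i
    using that by (subst (asm) sum_nonneg_eq_0_iff) auto
  have "\<alpha> * cinner n v w = cinner n v z"
    unfolding z_def cinner_adjoint[OF A v(1) w(1), symmetric] by (simp add: v cinner_smult_left)
  also have "\<dots> = \<mu> * cinner n v w"
    unfolding cinner_def sum_distrib_left by (rule sum.cong[OF refl]) (simp add: zi mult_ac)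
  finally show ?thesis using ne by simp
qed

text \<open>Since \<open>B\<close> preserves the lengths of \<open>v\<close> and \<open>w\<close>, the inequality for \<open>v + c w\<close> compares only the mixed terms:
\<open>Re (cnj c * (z * (\<alpha> * cnj \<mu> - 1))) \<le> 0\<close> with \<open>z\<close> the inner product. Taking for \<open>c\<close> the factor next to
\<open>cnj c\<close> makes the left side a squared modulus.\<close>

lemma contraction_eigenvectors_orthogonal:
  assumes B: "B \<in> carrier_mat n n"
    and contr: "\<And>v. v \<in> carrier_vec n \<Longrightarrow> euclidean_norm (B *\<^sub>v v) \<le> euclidean_norm v"
    and v: "v \<in> carrier_vec n" "B *\<^sub>v v = \<alpha> \<cdot>\<^sub>v v" and w: "w \<in> carrier_vec n" "B *\<^sub>v w = \<mu> \<cdot>\<^sub>v w"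
    and unit: "cmod \<alpha> = 1" "cmod \<mu> = 1" and ne: "\<alpha> \<noteq> \<mu>"
  shows "cinner n v w = 0"
proof -
  define z where "z = cinner n v w"
  define c where "c = z * (\<alpha> * cnj \<mu> - 1)"
  have len: "(euclidean_norm (a \<cdot>\<^sub>v v + b \<cdot>\<^sub>v w))\<^sup>2
      = (cmod a)\<^sup>2 * (euclidean_norm v)\<^sup>2 + (cmod b)\<^sup>2 * (euclidean_norm w)\<^sup>2 + 2 * Re (a * cnj b * z)" for a b
  proof -
    have "complex_of_real ((euclidean_norm (a \<cdot>\<^sub>v v + b \<cdot>\<^sub>v w))\<^sup>2) = cinner n (a \<cdot>\<^sub>v v + b \<cdot>\<^sub>v w) (a \<cdot>\<^sub>v v + b \<cdot>\<^sub>v w)"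
      by (rule cinner_self[symmetric]) (simp add: v(1) w(1))
    also have "\<dots> = a * cnj a * cinner n v v + b * cnj b * cinner n w w + (a * cnj b * z + cnj (a * cnj b * z))"
    proof -
      have "cinner n (a \<cdot>\<^sub>v v + b \<cdot>\<^sub>v w) (a \<cdot>\<^sub>v v + b \<cdot>\<^sub>v w)
          = (\<Sum>i<n. (a * v $ i + b * w $ i) * cnj (a * v $ i + b * w $ i))"
        unfolding cinner_def by (rule sum.cong[OF refl]) (use v(1) w(1) in auto)
      thus ?thesis
        by (simp add: cinner_def z_def algebra_simps sum.distrib sum_distrib_left)
    qed
    also have "\<dots> = of_real ((cmod a)\<^sup>2 * (euclidean_norm v)\<^sup>2 + (cmod b)\<^sup>2 * (euclidean_norm w)\<^sup>2 + 2 * Re (a * cnj b * z))"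
      unfolding complex_norm_square[symmetric] cinner_self[OF v(1)] cinner_self[OF w(1)] complex_add_cnj by simp
    finally show ?thesis by (simp only: of_real_eq_iff)
  qed
  have vec: "1 \<cdot>\<^sub>v v + c \<cdot>\<^sub>v w \<in> carrier_vec n" using v(1) w(1) by simp
  have "B *\<^sub>v (1 \<cdot>\<^sub>v v + c \<cdot>\<^sub>v w) = B *\<^sub>v (1 \<cdot>\<^sub>v v) + B *\<^sub>v (c \<cdot>\<^sub>v w)"
    by (rule mult_add_distrib_mat_vec[OF B]) (use v w in auto)
  also have "\<dots> = \<alpha> \<cdot>\<^sub>v v + (c * \<mu>) \<cdot>\<^sub>v w"
    using mult_mat_vec[OF B v(1), of 1] mult_mat_vec[OF B w(1), of c] v w by (simp add: smult_smult_assoc)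
  finally have im: "B *\<^sub>v (1 \<cdot>\<^sub>v v + c \<cdot>\<^sub>v w) = \<alpha> \<cdot>\<^sub>v v + (c * \<mu>) \<cdot>\<^sub>v w" .
  have "euclidean_norm (\<alpha> \<cdot>\<^sub>v v + (c * \<mu>) \<cdot>\<^sub>v w) \<le> euclidean_norm (1 \<cdot>\<^sub>v v + c \<cdot>\<^sub>v w)"
    using contr[OF vec] unfolding im .
  hence "(euclidean_norm (\<alpha> \<cdot>\<^sub>v v + (c * \<mu>) \<cdot>\<^sub>v w))\<^sup>2 \<le> (euclidean_norm (1 \<cdot>\<^sub>v v + c \<cdot>\<^sub>v w))\<^sup>2"
    by (rule power_mono) (simp add: euclidean_norm_def sum_nonneg)
  hence "Re (\<alpha> * cnj (c * \<mu>) * z) \<le> Re (1 * cnj c * z)"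
    unfolding len using unit by (simp add: norm_mult)
  hence "Re (\<alpha> * cnj (c * \<mu>) * z - 1 * cnj c * z) \<le> 0" by (simp only: minus_complex.sel)
  also have "\<alpha> * cnj (c * \<mu>) * z - 1 * cnj c * z = cnj c * (z * (\<alpha> * cnj \<mu> - 1))"
    by (simp add: algebra_simps)
  also have "\<dots> = of_real ((cmod (z * (\<alpha> * cnj \<mu> - 1)))\<^sup>2)"
    by (simp only: complex_norm_square c_def mult.commute)
  finally have "z * (\<alpha> * cnj \<mu> - 1) = 0" by (simp del: mult_eq_0_iff)
  moreover have "\<alpha> * cnj \<mu> \<noteq> 1"
  proof
    assume "\<alpha> * cnj \<mu> = 1"
    hence "\<alpha> * (\<mu> * cnj \<mu>) = \<mu>" by (simp add: mult.left_commute)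
    thus False using ne unimodular_mult_cnj[OF unit(2)] by simp
  qed
  ultimately show ?thesis by (simp add: z_def)
qed

text \<open>The supremum in \<open>operator_norm\<close> is meaningful only for a bounded set; the entries of \<open>B\<close> bound it.\<close>

lemma operator_norm_bound:
  assumes B: "B \<in> carrier_mat n n" and v: "v \<in> carrier_vec n"
  shows "euclidean_norm (B *\<^sub>v v) \<le> operator_norm B * euclidean_norm v"
proof (cases "v = 0\<^sub>v n")
  case True
  have "B *\<^sub>v 0\<^sub>v n = 0\<^sub>v n" using B by (intro eq_vecI) auto
  thus ?thesis using True by (simp add: euclidean_norm_def)
next
  case False
  define S where "S = {v \<in> carrier_vec (dim_col B). euclidean_norm v = 1}"
  define K where "K = sqrt (\<Sum>i<n. (\<Sum>j<n. cmod (B $$ (i, j)))\<^sup>2)"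
  have "euclidean_norm (B *\<^sub>v w) \<le> K" if "w \<in> S" for w
  proof -
    have w: "w \<in> carrier_vec n" "euclidean_norm w = 1" using that B by (auto simp: S_def)
    have comp: "cmod (w $ j) \<le> 1" if "j < n" for j
    proof -
      have "(cmod (w $ j))\<^sup>2 \<le> (\<Sum>i<n. (cmod (w $ i))\<^sup>2)"
        using that by (intro member_le_sum) auto
      also have "\<dots> = 1\<^sup>2" using w by (simp add: euclidean_norm_def)
      finally show ?thesis by (rule power2_le_imp_le) simp
    qed
    have "cmod ((B *\<^sub>v w) $ i) \<le> (\<Sum>j<n. cmod (B $$ (i, j)))" if "i < n" for i
      unfolding mult_mat_vec_index[OF B w(1) that]
    proof (rule order_trans[OF norm_sum], rule sum_mono)
      fix j assume "j \<in> {..<n}"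
      thus "cmod (B $$ (i, j) * w $ j) \<le> cmod (B $$ (i, j))"
        using comp[of j] by (simp add: norm_mult mult_left_le)
    qed
    hence "(\<Sum>i<n. (cmod ((B *\<^sub>v w) $ i))\<^sup>2) \<le> (\<Sum>i<n. (\<Sum>j<n. cmod (B $$ (i, j)))\<^sup>2)"
      by (intro sum_mono power_mono) auto
    thus ?thesis using B by (simp add: euclidean_norm_def K_def)
  qed
  hence bdd: "bdd_above ((\<lambda>v. euclidean_norm (B *\<^sub>v v)) ` S)" by (rule bdd_aboveI2)
  define r where "r = euclidean_norm v"
  have r: "r > 0" unfolding r_def using v False by (rule euclidean_norm_pos)
  define w where "w = complex_of_real (1 / r) \<cdot>\<^sub>v v"
  have nr: "cmod (complex_of_real (1 / r)) = 1 / r" unfolding norm_of_real using r by simp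
  have "euclidean_norm w = 1"
    unfolding w_def euclidean_norm_smult[OF v] nr using r by (simp add: r_def)
  hence "w \<in> S" using v B by (simp add: S_def w_def)
  hence "euclidean_norm (B *\<^sub>v w) \<le> operator_norm B"
    unfolding operator_norm_def S_def[symmetric] using bdd by (rule cSUP_upper)
  moreover have "B *\<^sub>v w = complex_of_real (1 / r) \<cdot>\<^sub>v (B *\<^sub>v v)"
    unfolding w_def by (rule mult_mat_vec[OF B v])
  moreover have "B *\<^sub>v v \<in> carrier_vec n" using B v by simp
  ultimately have "1 / r * euclidean_norm (B *\<^sub>v v) \<le> operator_norm B"
    by (simp only: euclidean_norm_smult nr)
  thus ?thesis using r by (simp add: r_def[symmetric] field_simps)
qed

text \<open>The eigenvalues are ordered as in \<open>root_diag\<close>, so the same diagonal matrix serves for both \<open>A\<close> and \<open>B\<close>.\<close>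

lemma unitary_diagonalization:
  assumes A: "A \<in> carrier_mat n n"
    and ev: "\<And>j. j < n \<Longrightarrow> \<exists>v \<in> carrier_vec n. v \<noteq> 0\<^sub>v n \<and> A *\<^sub>v v = zeta n (int j) \<cdot>\<^sub>v v"
    and orth: "\<And>v w \<alpha> \<mu>. v \<in> carrier_vec n \<Longrightarrow> w \<in> carrier_vec n \<Longrightarrow> A *\<^sub>v v = \<alpha> \<cdot>\<^sub>v v \<Longrightarrow> A *\<^sub>v w = \<mu> \<cdot>\<^sub>v w
      \<Longrightarrow> cmod \<alpha> = 1 \<Longrightarrow> cmod \<mu> = 1 \<Longrightarrow> \<alpha> \<noteq> \<mu> \<Longrightarrow> cinner n v w = 0"
  obtains V where "unitary_mat n V" "mat_adjoint V * A * V = root_diag n" "A = V * root_diag n * mat_adjoint V"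
proof -
  have "\<exists>v \<in> carrier_vec n. euclidean_norm v = 1 \<and> A *\<^sub>v v = zeta n (int j) \<cdot>\<^sub>v v" if j: "j < n" for j
  proof -
    obtain v where v: "v \<in> carrier_vec n" "v \<noteq> 0\<^sub>v n" "A *\<^sub>v v = zeta n (int j) \<cdot>\<^sub>v v" using ev[OF j] by blast
    define r where "r = euclidean_norm v"
    have r: "r > 0" unfolding r_def using v(1,2) by (rule euclidean_norm_pos)
    have "A *\<^sub>v (complex_of_real (1 / r) \<cdot>\<^sub>v v) = zeta n (int j) \<cdot>\<^sub>v (complex_of_real (1 / r) \<cdot>\<^sub>v v)"
      unfolding mult_mat_vec[OF A v(1)] v(3) smult_smult_assoc by (simp add: mult.commute)
    moreover have "euclidean_norm (complex_of_real (1 / r) \<cdot>\<^sub>v v) = 1"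
      unfolding euclidean_norm_smult[OF v(1)] norm_of_real using r by (simp add: r_def)
    moreover have "complex_of_real (1 / r) \<cdot>\<^sub>v v \<in> carrier_vec n" using v(1) by simp
    ultimately show ?thesis by blast
  qed
  hence "\<forall>j\<in>{..<n}. \<exists>v. v \<in> carrier_vec n \<and> euclidean_norm v = 1 \<and> A *\<^sub>v v = zeta n (int j) \<cdot>\<^sub>v v" by blast
  then obtain x where xall: "\<forall>j\<in>{..<n}. x j \<in> carrier_vec n \<and> euclidean_norm (x j) = 1 \<and> A *\<^sub>v x j = zeta n (int j) \<cdot>\<^sub>v x j"
    by (rule bchoice[THEN exE])
  have x: "x j \<in> carrier_vec n" "euclidean_norm (x j) = 1" "A *\<^sub>v x j = zeta n (int j) \<cdot>\<^sub>v x j" if "j < n" for j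
    using xall that by auto
  define V where "V = mat n n (\<lambda>(i, j). x j $ i)"
  have V: "V \<in> carrier_mat n n" by (simp add: V_def)
  have uV: "unitary_mat n V"
  proof (rule unitary_matI[OF V], rule square_eqI)
    fix i j assume ij: "i < n" "j < n"
    have "(mat_adjoint V * V) $$ (i, j) = cinner n (x j) (x i)"
      unfolding square_mult_index[OF mat_adjoint_carrier[OF V] V ij] cinner_def
      by (rule sum.cong[OF refl]) (simp only: lessThan_iff mat_adjoint_index[OF V ij(1)], simp add: V_def ij mult.commute)
    also have "\<dots> = (if i = j then 1 else 0)"
    proof (cases "i = j")
      case True
      thus ?thesis using cinner_self[OF x(1)[OF ij(2)]] x(2)[OF ij(2)] by simp
    next
      case False
      hence "zeta n (int j) \<noteq> zeta n (int i)" using zeta_nat_inj[OF ij(2,1)] by blast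
      thus ?thesis using orth[OF x(1)[OF ij(2)] x(1)[OF ij(1)] x(3)[OF ij(2)] x(3)[OF ij(1)]] False by simp
    qed
    finally show "(mat_adjoint V * V) $$ (i, j) = 1\<^sub>m n $$ (i, j)" using ij by simp
  qed (simp_all add: V)
  have AV: "A * V = V * root_diag n"
  proof (rule square_eqI)
    fix i j assume ij: "i < n" "j < n"
    have "(A * V) $$ (i, j) = (\<Sum>k<n. A $$ (i, k) * x j $ k)"
      unfolding square_mult_index[OF A V ij] by (rule sum.cong[OF refl]) (simp add: V_def ij)
    also have "\<dots> = (A *\<^sub>v x j) $ i" using mult_mat_vec_index[OF A x(1)[OF ij(2)] ij(1)] by simp
    also have "\<dots> = x j $ i * zeta n (int j)" using x(1,3)[OF ij(2)] ij by simp
    also have "\<dots> = (V * root_diag n) $$ (i, j)"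
      unfolding root_diag_def mat_diag_mult_right[OF V] using ij by (simp add: V_def)
    finally show "(A * V) $$ (i, j) = (V * root_diag n) $$ (i, j)" .
  qed (simp_all add: A V)
  note u = unitary_matD[OF uV]
  have "V * root_diag n * mat_adjoint V = A * (V * mat_adjoint V)"
    unfolding AV[symmetric] by (rule assoc_mult_mat[OF A u(1,2)])
  also have "\<dots> = A" unfolding u(4) by (rule right_mult_one_mat[OF A])
  finally have "A = V * root_diag n * mat_adjoint V" by simp
  thus ?thesis using that[OF uV conj_inverse[OF uV A AV root_diag_carrier]] by blast
qed

section \<open>The joint spectrum\<close>

lemma not_invertible_iff_det:
  fixes X :: "complex mat"
  assumes X: "X \<in> carrier_mat n n"
  shows "\<not> invertible_mat X \<longleftrightarrow> det X = 0"
proof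
  assume "\<not> invertible_mat X"
  show "det X = 0"
  proof (rule ccontr)
    assume "det X \<noteq> 0"
    then obtain Y where Y: "Y \<in> carrier_mat n n" "Y * X = 1\<^sub>m n"
      using det_non_zero_imp_unit[OF X, of "()"] by (auto simp: Units_def ring_mat_def)
    hence "X * Y = 1\<^sub>m n" using mat_mult_left_right_inverse[OF Y(1) X] by simp
    hence "invertible_mat X" using X Y unfolding invertible_mat_def inverts_mat_def by auto
    thus False using \<open>\<not> invertible_mat X\<close> by simp
  qed
next
  assume d: "det X = 0"
  show "\<not> invertible_mat X"
  proof
    assume "invertible_mat X"
    then obtain Y where Y: "X * Y = 1\<^sub>m n" "Y * X = 1\<^sub>m (dim_row Y)"
      using X unfolding invertible_mat_def inverts_mat_def by auto
    have "Y \<in> carrier_mat n n"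
      using Y X by (metis carrier_matD(2) carrier_matI index_mult_mat(3) index_one_mat(3))
    hence "det X * det Y = 1" using det_mult[OF X, of Y] Y(1) by simp
    thus False using d by simp
  qed
qed

lemma square_linear_carrier [simp]:
  assumes "X \<in> carrier_mat n n"
  shows "c \<cdot>\<^sub>m X \<in> carrier_mat n n"
    and "Y \<in> carrier_mat n n \<Longrightarrow> X + Y \<in> carrier_mat n n" "Y \<in> carrier_mat n n \<Longrightarrow> X - Y \<in> carrier_mat n n"
  using assms by (auto intro: minus_carrier_mat)

definition pencil3 :: "complex mat \<Rightarrow> complex mat \<Rightarrow> complex \<Rightarrow> complex \<Rightarrow> complex \<Rightarrow> complex mat" where
  "pencil3 A B x y z = x \<cdot>\<^sub>m A + y \<cdot>\<^sub>m B + z \<cdot>\<^sub>m (A * B)"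

lemma pencil3_carrier [simp]:
  "A \<in> carrier_mat n n \<Longrightarrow> B \<in> carrier_mat n n \<Longrightarrow> pencil3 A B x y z \<in> carrier_mat n n"
  by (simp add: pencil3_def)

context
  fixes n :: nat and A B :: "complex mat"
  assumes A: "A \<in> carrier_mat n n" and B: "B \<in> carrier_mat n n" and n: "n > 0"
    and spectrum: "joint_spectrum n [A, B, A * B] =
      {vec_of_list [x, y, z] | x y z. x ^ n + y ^ n + (-1) ^ (n - 1) * z ^ n = 1}"
begin

lemma det_pencil_eq_0_iff:
  "det (pencil3 A B x y z - 1\<^sub>m n) = 0 \<longleftrightarrow> x ^ n + y ^ n + (-1) ^ (n - 1) * z ^ n = 1"
proof -
  let ?v = "vec_of_list [x, y, z]"
  have "matrix_pencil n [A, B, A * B] ?v = pencil3 A B x y z"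
    unfolding matrix_pencil_def pencil3_def using A B
    by (intro eq_matI) (auto simp: numeral_3_eq_3 vec_of_list_index)
  moreover have "?v \<in> carrier_vec (length [A, B, A * B])" by (intro carrier_vecI) simp
  moreover have "pencil3 A B x y z - 1\<^sub>m n \<in> carrier_mat n n" using A B by simp
  ultimately have "det (pencil3 A B x y z - 1\<^sub>m n) = 0 \<longleftrightarrow> ?v \<in> joint_spectrum n [A, B, A * B]"
    unfolding joint_spectrum_def by (simp add: not_invertible_iff_det del: vec_of_list_Cons)
  also have "\<dots> \<longleftrightarrow> x ^ n + y ^ n + (-1) ^ (n - 1) * z ^ n = 1"
  proof -
    have "?v = vec_of_list [x', y', z'] \<longleftrightarrow> x' = x \<and> y' = y \<and> z' = z" for x' y' z'
      by (metis list.inject list_vec)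
    thus ?thesis unfolding spectrum mem_Collect_eq by (simp only:) blast
  qed
  finally show ?thesis .
qed

lemma smult_pencil: "t \<cdot>\<^sub>m pencil3 A B x y z = pencil3 A B (t * x) (t * y) (t * z)"
  using A B by (intro eq_matI) (auto simp: pencil3_def algebra_simps)

text \<open>By homogeneity of the pencil its nonzero eigenvalues are the \<open>n\<close>-th roots of \<open>s\<close>. For \<open>s \<noteq> 0\<close> these are
\<open>n\<close> different numbers, so the characteristic polynomial is \<open>X\<^sup>n - s\<close>.\<close>

lemma det_pencil:
  assumes s: "x ^ n + y ^ n + (-1) ^ (n - 1) * z ^ n = s" "s \<noteq> 0"
  shows "det (1\<^sub>m n - pencil3 A B x y z) = 1 - s"
proof -
  define M where "M = pencil3 A B x y z"
  have M: "M \<in> carrier_mat n n" using A B by (simp add: M_def)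
  have root: "poly (char_poly M) t = 0 \<longleftrightarrow> t ^ n = s" if "t \<noteq> 0" for t
  proof -
    have "char_matrix M t = t \<cdot>\<^sub>m (pencil3 A B (x / t) (y / t) (z / t) - 1\<^sub>m n)"
    proof (rule square_eqI)
      fix i j assume ij: "i < n" "j < n"
      define N where "N = pencil3 A B (x / t) (y / t) (z / t)"
      have N: "N \<in> carrier_mat n n" using A B by (simp add: N_def)
      have MN: "M = t \<cdot>\<^sub>m N" unfolding N_def smult_pencil M_def using that by simp
      show "char_matrix M t $$ (i, j) = (t \<cdot>\<^sub>m (pencil3 A B (x / t) (y / t) (z / t) - 1\<^sub>m n)) $$ (i, j)"
        unfolding N_def[symmetric] MN using ij N by (simp add: char_matrix_def right_diff_distrib)
    next
      show "t \<cdot>\<^sub>m (pencil3 A B (x / t) (y / t) (z / t) - 1\<^sub>m n) \<in> carrier_mat n n" using A B by simp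
      show "char_matrix M t \<in> carrier_mat n n" using M by (simp add: char_matrix_def)
    qed
    moreover have "poly (char_poly M) t = 0 \<longleftrightarrow> det (char_matrix M t) = 0"
      unfolding char_poly_matrix[OF M] by (rule det_0_negate[of _ n]) (use M in \<open>simp add: char_matrix_def\<close>)
    ultimately have "poly (char_poly M) t = 0 \<longleftrightarrow> det (pencil3 A B (x / t) (y / t) (z / t) - 1\<^sub>m n) = 0"
      using that A B by (simp add: det_smult)
    also have "\<dots> \<longleftrightarrow> (x / t) ^ n + (y / t) ^ n + (-1) ^ (n - 1) * (z / t) ^ n = 1"
      by (rule det_pencil_eq_0_iff)
    also have "(x / t) ^ n + (y / t) ^ n + (-1) ^ (n - 1) * (z / t) ^ n = s / t ^ n"
      unfolding s(1)[symmetric] by (simp add: power_divide add_divide_distrib)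
    also have "s / t ^ n = 1 \<longleftrightarrow> t ^ n = s" using that by auto
    finally show ?thesis .
  qed
  define q where "q = char_poly M - (monom 1 n - [:s:])"
  have roots: "poly q t = 0" if "t ^ n = s" for t
  proof -
    have "t \<noteq> 0" using that s(2) n by (auto simp: power_0_left)
    thus ?thesis using root[of t] that by (simp add: q_def poly_monom)
  qed
  have "q = 0"
  proof (rule ccontr)
    assume q: "q \<noteq> 0"
    have "degree (monom (1 :: complex) n - [:s:]) \<le> n"
      by (rule degree_diff_le) (simp_all add: degree_monom_le)
    moreover have "degree (char_poly M) \<le> n" using degree_monic_char_poly[OF M] by simp
    ultimately have "degree q \<le> n" unfolding q_def by (rule degree_diff_le[rotated])
    moreover have "coeff q n = 0"
      using degree_monic_char_poly[OF M] n by (simp add: q_def coeff_pCons split: nat.splits)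
    ultimately have "degree q < n" using eq_zero_or_degree_less[of q n] q by blast
    moreover have "n = card {t :: complex. t ^ n = s}" using card_nth_roots[OF s(2) n] by simp
    moreover have "card {t. t ^ n = s} \<le> card {t. poly q t = 0}"
      using roots poly_roots_finite[OF q] by (intro card_mono) auto
    moreover have "card {t. poly q t = 0} \<le> degree q" using q by (rule card_poly_roots_bound)
    ultimately show False by simp
  qed
  hence "poly (char_poly M) 1 = 1 - s" by (simp add: q_def poly_monom)
  moreover have "- char_matrix M 1 = 1\<^sub>m n - M"
    using M by (intro eq_matI) (auto simp: char_matrix_def)
  ultimately show ?thesis using char_poly_matrix[OF M, of 1] unfolding M_def by simp
qed

lemma eigenvectors:
  assumes j: "j < n"
  shows "\<exists>v \<in> carrier_vec n. v \<noteq> 0\<^sub>v n \<and> A *\<^sub>v v = zeta n (int j) \<cdot>\<^sub>v v"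
    and "\<exists>v \<in> carrier_vec n. v \<noteq> 0\<^sub>v n \<and> B *\<^sub>v v = zeta n (int j) \<cdot>\<^sub>v v"
proof -
  have main: "\<exists>v \<in> carrier_vec n. v \<noteq> 0\<^sub>v n \<and> C *\<^sub>v v = zeta n (int j) \<cdot>\<^sub>v v"
    if C: "C \<in> carrier_mat n n" and d: "det (cnj (zeta n (int j)) \<cdot>\<^sub>m C - 1\<^sub>m n) = 0" for C
  proof -
    define c where "c = cnj (zeta n (int j))"
    have zc: "zeta n (int j) * c = 1" by (simp add: c_def unimodular_mult_cnj)
    obtain v where v: "v \<in> carrier_vec n" "v \<noteq> 0\<^sub>v n" "(c \<cdot>\<^sub>m C - 1\<^sub>m n) *\<^sub>v v = 0\<^sub>v n"
      using d C det_0_iff_vec_prod_zero_field[of "c \<cdot>\<^sub>m C - 1\<^sub>m n" n] by (auto simp: c_def)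
    have "C *\<^sub>v v = zeta n (int j) \<cdot>\<^sub>v v"
    proof (rule eq_vecI)
      fix i assume "i < dim_vec (zeta n (int j) \<cdot>\<^sub>v v)"
      hence i: "i < n" using v(1) by simp
      have "0 = ((c \<cdot>\<^sub>m C - 1\<^sub>m n) *\<^sub>v v) $ i" using v(3) i by simp
      also have "\<dots> = (\<Sum>k<n. (c * C $$ (i, k) - (if i = k then 1 else 0)) * v $ k)"
        using C v(1) i by (subst mult_mat_vec_index) (auto intro!: sum.cong)
      also have "\<dots> = c * (\<Sum>k<n. C $$ (i, k) * v $ k) - (\<Sum>k<n. if k = i then v $ k else 0)"
        unfolding sum_distrib_left sum_subtractf[symmetric]
        by (rule sum.cong[OF refl]) (auto simp: left_diff_distrib)
      also have "\<dots> = c * (C *\<^sub>v v) $ i - v $ i" using mult_mat_vec_index[OF C v(1) i] i by simp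
      finally have "zeta n (int j) * (c * (C *\<^sub>v v) $ i) = zeta n (int j) * v $ i" by simp
      thus "(C *\<^sub>v v) $ i = (zeta n (int j) \<cdot>\<^sub>v v) $ i"
        unfolding mult.assoc[symmetric] zc using i v(1) by simp
    qed (use C v in auto)
    thus ?thesis using v by blast
  qed
  have cn: "cnj (zeta n (int j)) ^ n = 1" using zeta_pow_n[OF n] by (simp add: cnj_zeta)
  have A0: "pencil3 A B x 0 0 = x \<cdot>\<^sub>m A" "pencil3 A B 0 x 0 = x \<cdot>\<^sub>m B" for x
    using A B by (auto simp: pencil3_def intro!: eq_matI)
  show "\<exists>v \<in> carrier_vec n. v \<noteq> 0\<^sub>v n \<and> A *\<^sub>v v = zeta n (int j) \<cdot>\<^sub>v v"
    using det_pencil_eq_0_iff[of "cnj (zeta n (int j))" 0 0] cn n A0 by (intro main[OF A]) (simp add: power_0_left)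
  show "\<exists>v \<in> carrier_vec n. v \<noteq> 0\<^sub>v n \<and> B *\<^sub>v v = zeta n (int j) \<cdot>\<^sub>v v"
    using det_pencil_eq_0_iff[of 0 "cnj (zeta n (int j))" 0] cn n A0 by (intro main[OF B]) (simp add: power_0_left)
qed

text \<open>At \<open>x = 1 / \<alpha> j\<close>, \<open>y = t\<close>, \<open>z = \<kappa> t\<close> the number \<open>s\<close> in \<open>det_pencil\<close> is 1 up to a multiple of \<open>t\<^sup>n\<close>; for
small \<open>t\<close> it is not 0.\<close>

lemma det_pencil_eigenbasis:
  assumes V: "unitary_mat n V" and D: "mat_adjoint V * A * V = root_diag n" and j: "j < n"
  defines "b \<equiv> \<lambda>i k. (mat_adjoint V * B * V) $$ (i, k)"
  shows "\<exists>c. \<forall>\<^sub>F t in at 0. det (mat n n (\<lambda>(i, k).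
      (if i = k then 1 - cnj (zeta n (int j)) * zeta n (int i) else 0)
        - t * (1 + \<kappa> * zeta n (int i)) * b i k)) = t ^ n * c"
proof -
  define x where "x = cnj (zeta n (int j))"
  note v = unitary_matD[OF V]
  define e where "e = 1 + (-1) ^ (n - 1) * \<kappa> ^ n"
  have xn: "x ^ n = 1" using zeta_pow_n[OF n] by (simp add: x_def cnj_zeta)
  have mat_eq: "mat n n (\<lambda>(i, k). (if i = k then 1 - x * zeta n (int i) else 0) - t * (1 + \<kappa> * zeta n (int i)) * b i k)
      = mat_adjoint V * (1\<^sub>m n - pencil3 A B x t (t * \<kappa>)) * V" for t
  proof -
    define C where "C = (\<lambda>X. mat_adjoint V * X * V)"
    have Cc: "C X \<in> carrier_mat n n" if "X \<in> carrier_mat n n" for X using v that by (simp add: C_def)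
    have C_idx: "C X $$ (i, k) = (\<Sum>r<n. \<Sum>q<n. cnj (V $$ (q, i)) * X $$ (q, r) * V $$ (r, k))"
      if X: "X \<in> carrier_mat n n" and ik: "i < n" "k < n" for X i k
    proof -
      have "C X $$ (i, k) = (\<Sum>r<n. (mat_adjoint V * X) $$ (i, r) * V $$ (r, k))"
        unfolding C_def by (rule square_mult_index[OF square_mult_carrier[OF v(2) X] v(1) ik])
      also have "\<dots> = (\<Sum>r<n. (\<Sum>q<n. cnj (V $$ (q, i)) * X $$ (q, r)) * V $$ (r, k))"
      proof (rule sum.cong[OF refl])
        fix r assume "r \<in> {..<n}"
        hence r: "r < n" by simp
        have "(mat_adjoint V * X) $$ (i, r) = (\<Sum>q<n. cnj (V $$ (q, i)) * X $$ (q, r))"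
          unfolding square_mult_index[OF v(2) X ik(1) r]
          by (rule sum.cong[OF refl]) (simp add: mat_adjoint_index[OF v(1) ik(1)])
        thus "(mat_adjoint V * X) $$ (i, r) * V $$ (r, k) = (\<Sum>q<n. cnj (V $$ (q, i)) * X $$ (q, r)) * V $$ (r, k)"
          by simp
      qed
      finally show ?thesis by (simp only: sum_distrib_right)
    qed
    have C1: "C (1\<^sub>m n) = 1\<^sub>m n" using v by (simp add: C_def right_mult_one_mat[OF v(2)])
    have CA: "C A = root_diag n" using D by (simp add: C_def)
    have CAB: "C (A * B) = root_diag n * C B"
      unfolding CA[symmetric] unfolding C_def by (rule conj_mult_cancel[OF V A B, symmetric])
    show ?thesis
    proof (rule square_eqI)
      fix i k assume ik: "i < n" "k < n"
      have "C (1\<^sub>m n - pencil3 A B x t (t * \<kappa>)) $$ (i, k)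
          = C (1\<^sub>m n) $$ (i, k) - (x * C A $$ (i, k) + t * C B $$ (i, k) + t * \<kappa> * C (A * B) $$ (i, k))"
      proof -
        have alg: "a * (i - (x * p + t * q + t * \<kappa> * r)) * d = a * i * d - (x * (a * p * d) + t * (a * q * d) + t * \<kappa> * (a * r * d))"
          for a i p q r d :: complex by (simp add: algebra_simps)
        have "(1\<^sub>m n - pencil3 A B x t (t * \<kappa>)) $$ (q, r)
            = 1\<^sub>m n $$ (q, r) - (x * A $$ (q, r) + t * B $$ (q, r) + t * \<kappa> * (A * B) $$ (q, r))"
          if "q < n" "r < n" for q r
          using that A B by (simp add: pencil3_def)
        hence "C (1\<^sub>m n - pencil3 A B x t (t * \<kappa>)) $$ (i, k) = (\<Sum>r<n. \<Sum>q<n. cnj (V $$ (q, i)) *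
            (1\<^sub>m n $$ (q, r) - (x * A $$ (q, r) + t * B $$ (q, r) + t * \<kappa> * (A * B) $$ (q, r))) * V $$ (r, k))"
          using A B by (subst C_idx[OF _ ik]) (auto intro!: sum.cong)
        also have "\<dots> = (\<Sum>r<n. \<Sum>q<n. cnj (V $$ (q, i)) * 1\<^sub>m n $$ (q, r) * V $$ (r, k))
            - (x * (\<Sum>r<n. \<Sum>q<n. cnj (V $$ (q, i)) * A $$ (q, r) * V $$ (r, k))
              + t * (\<Sum>r<n. \<Sum>q<n. cnj (V $$ (q, i)) * B $$ (q, r) * V $$ (r, k))
              + t * \<kappa> * (\<Sum>r<n. \<Sum>q<n. cnj (V $$ (q, i)) * (A * B) $$ (q, r) * V $$ (r, k)))"
          unfolding alg sum_subtractf sum.distrib sum_distrib_left[symmetric] by (rule refl)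
        also have "\<dots> = C (1\<^sub>m n) $$ (i, k) - (x * C A $$ (i, k) + t * C B $$ (i, k) + t * \<kappa> * C (A * B) $$ (i, k))"
          using A B by (simp only: C_idx[OF _ ik] one_carrier_mat square_mult_carrier)
        finally show ?thesis .
      qed
      moreover have "(root_diag n * C B) $$ (i, k) = zeta n (int i) * C B $$ (i, k)"
        unfolding root_diag_def mat_diag_mult_left[OF Cc[OF B]] using ik by simp
      ultimately show "mat n n (\<lambda>(i, k). (if i = k then 1 - x * zeta n (int i) else 0) - t * (1 + \<kappa> * zeta n (int i)) * b i k) $$ (i, k)
          = (mat_adjoint V * (1\<^sub>m n - pencil3 A B x t (t * \<kappa>)) * V) $$ (i, k)"
        using ik unfolding C1 CA CAB unfolding C_def b_def
          by (cases "i = k") (simp_all add: root_diag_index algebra_simps)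
    qed (use v A B in simp_all)
  qed
  have det_eq: "det (mat_adjoint V * X * V) = det X" if X: "X \<in> carrier_mat n n" for X
  proof -
    have "det (mat_adjoint V * X * V) = det (mat_adjoint V) * det X * det V"
      using det_mult[OF square_mult_carrier[OF v(2) X] v(1)] det_mult[OF v(2) X] by simp
    moreover have "det (mat_adjoint V) * det V = 1" using det_mult[OF v(2,1)] v(3) by simp
    ultimately show ?thesis by (simp add: mult_ac)
  qed
  have "((\<lambda>t :: complex. 1 + t ^ n * e) \<longlongrightarrow> 1 + 0 ^ n * e) (at 0)" by (intro tendsto_intros)
  hence "((\<lambda>t :: complex. 1 + t ^ n * e) \<longlongrightarrow> 1) (at 0)" using n by (simp add: power_0_left)
  hence "\<forall>\<^sub>F t in at 0. 1 + t ^ n * e \<noteq> 0" by (rule tendsto_imp_eventually_ne) simp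
  hence "\<forall>\<^sub>F t in at 0. det (mat n n (\<lambda>(i, k). (if i = k then 1 - x * zeta n (int i) else 0)
      - t * (1 + \<kappa> * zeta n (int i)) * b i k)) = t ^ n * (- e)"
  proof eventually_elim
    case (elim t)
    have "x ^ n + t ^ n + (-1) ^ (n - 1) * (t * \<kappa>) ^ n = 1 + t ^ n * e"
      unfolding xn e_def by (simp add: power_mult_distrib algebra_simps)
    from det_pencil[OF this elim] show ?case
      unfolding mat_eq using A B by (simp add: det_eq)
  qed
  thus ?thesis unfolding x_def by blast
qed

end

section \<open>Classification of the pairs\<close>

text \<open>The squared moduli \<open>p\<close> in a row have the Fourier coefficients \<open>T b\<close>, and \<open>T 1\<close> and \<open>T 2\<close> are diagonal entries
of \<open>U D U\<^sup>*\<close> and of its square. As \<open>p\<close> is real, \<open>T (- 1)\<close> and \<open>T (- 2)\<close> vanish too, and for \<open>n \<le> 5\<close> this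
covers all residues except 0.\<close>

lemma flat_unitary_of_trace_conditions:
  fixes U :: "complex mat"
  assumes U: "unitary_mat n U" and n: "n = 3 \<or> n = 4 \<or> n = 5"
    and diag: "\<And>j. j < n \<Longrightarrow> (U * root_diag n * mat_adjoint U) $$ (j, j) = 0"
    and diag2: "\<And>j. j < n \<Longrightarrow> (\<Sum>k<n. (U * root_diag n * mat_adjoint U) $$ (j, k)
      * (U * root_diag n * mat_adjoint U) $$ (k, j)) = 0"
    and jm: "j < n" "m < n"
  shows "(cmod (U $$ (j, m)))\<^sup>2 = 1 / real n"
proof -
  note u = unitary_matD[OF U]
  have n0: "n > 0" using n by auto
  define p where "p = (\<lambda>m. U $$ (j, m) * cnj (U $$ (j, m)))"
  define T where "T = (\<lambda>b :: int. \<Sum>m<n. zeta n (b * int m) * p m)"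
  have T0: "T 0 = 1" using unitary_entries(1)[OF U jm(1,1)] by (simp add: T_def p_def)
  have T1: "T 1 = 0"
    using diag[OF jm(1)] unfolding conj_root_diag_index[OF u(1) jm(1,1)] by (simp add: T_def p_def)
  have T2: "T 2 = 0"
  proof -
    have M: "U * root_diag n * mat_adjoint U \<in> carrier_mat n n" using u by simp_all
    have c: "mat_adjoint (mat_adjoint U) = U" by (rule mat_adjoint_adjoint[OF u(1)])
    have "(U * root_diag n * mat_adjoint U) * (U * root_diag n * mat_adjoint U)
        = U * (root_diag n * root_diag n) * mat_adjoint U"
      using conj_mult_cancel[OF unitary_mat_adjoint[OF U] root_diag_carrier root_diag_carrier] unfolding c .
    hence "(U * (root_diag n * root_diag n) * mat_adjoint U) $$ (j, j) = 0"
      using diag2[OF jm(1)] square_mult_index[OF M M jm(1,1)] by (simp only:)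
    moreover have "root_diag n * root_diag n = mat_diag n (\<lambda>k. zeta n (2 * int k))"
    proof -
      have "zeta n (int k) * zeta n (int k) = zeta n (2 * int k)" for k
        using zeta_add[of n "int k" "int k"] by simp
      thus ?thesis by (simp add: root_diag_def)
    qed
    moreover have "(U * mat_diag n (\<lambda>k. zeta n (2 * int k)) * mat_adjoint U) $$ (j, j) = T 2"
    proof -
      have "(U * mat_diag n (\<lambda>k. zeta n (2 * int k)) * mat_adjoint U) $$ (j, j)
          = (\<Sum>m<n. (U * mat_diag n (\<lambda>k. zeta n (2 * int k))) $$ (j, m) * mat_adjoint U $$ (m, j))"
        using u jm by (intro square_mult_index) simp_all
      also have "\<dots> = T 2"
        unfolding T_def p_def mat_diag_mult_right[OF u(1)]
        by (rule sum.cong[OF refl]) (use jm in \<open>simp add: mat_adjoint_index[OF u(1)]\<close>)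
      finally show ?thesis .
    qed
    ultimately show ?thesis by simp
  qed
  have Tneg: "T (- b) = cnj (T b)" for b
    unfolding T_def cnj_sum by (rule sum.cong[OF refl]) (simp add: cnj_zeta p_def mult.commute)
  have Tper: "T b = T (b - int n)" for b
  proof -
    have "int n dvd b * int m - (b - int n) * int m" for m by (simp flip: left_diff_distrib)
    hence "zeta n (b * int m) = zeta n ((b - int n) * int m)" for m using zeta_eq_iff[OF n0] by blast
    thus ?thesis by (simp add: T_def)
  qed
  have Tb: "T (int b) = 0" if b: "0 < b" "b < n" for b
  proof -
    have m: "T (- 1) = 0" "T (- 2) = 0" using Tneg[of 1] Tneg[of 2] T1 T2 by simp_all
    have "(n = 3 \<or> n = 4 \<or> n = 5) \<and> (b = 1 \<or> b = 2 \<or> b = 3 \<or> b = 4)" using n b by auto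
    moreover have "T 3 = T (3 - int n)" "T 4 = T (4 - int n)" by (rule Tper)+
    ultimately show ?thesis using b T1 T2 m by (elim conjE disjE) simp_all
  qed
  have "of_nat n * p m = (\<Sum>b<n. zeta n (- (int b * int m)) * T (int b))"
    unfolding T_def by (rule fourier_inversion[OF jm(2)])
  also have "\<dots> = (\<Sum>b<n. if b = 0 then 1 else 0)"
  proof (rule sum.cong[OF refl])
    fix b assume "b \<in> {..<n}"
    thus "zeta n (- (int b * int m)) * T (int b) = (if b = 0 then 1 else 0)"
      using T0 Tb[of b] by (cases "b = 0") simp_all
  qed
  also have "\<dots> = 1" using n0 by simp
  finally have one: "of_nat n * p m = 1" .
  have "p m = (of_nat n * p m) / of_nat n" using n0 by simp
  hence "p m = 1 / of_nat n" unfolding one .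
  hence "complex_of_real ((cmod (U $$ (j, m)))\<^sup>2) = 1 / of_nat n"
    by (simp only: p_def complex_norm_square)
  hence "complex_of_real ((cmod (U $$ (j, m)))\<^sup>2) = complex_of_real (1 / real n)"
    by (simp only: of_real_divide of_real_1 of_real_of_nat_eq)
  thus ?thesis by (simp only: of_real_eq_iff)
qed

text \<open>In the eigenbasis \<open>V\<close> of \<open>A\<close> the matrix \<open>B\<close> is \<open>U D U\<^sup>*\<close>, and in the eigenbasis \<open>W\<close> of \<open>B\<close> the matrix \<open>A\<close> is
\<open>U\<^sup>* D U\<close>; the alternative of the dichotomy decides to which of the two the cyclic basis is applied.\<close>

lemma pair_dichotomy:
  fixes A B :: "complex mat"
  assumes A: "A \<in> carrier_mat n n" and B: "B \<in> carrier_mat n n" and normal: "normal_mat A"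
    and norm: "operator_norm B = 1" and n: "n = 3 \<or> n = 4 \<or> n = 5"
    and spectrum: "joint_spectrum n [A, B, A * B] =
      {vec_of_list [x, y, z] | x y z. x ^ n + y ^ n + (-1) ^ (n - 1) * z ^ n = 1}"
  shows "\<exists>P. permutation_mat n P \<and>
    (unitarily_equivalent_pairs n (A, B) (mat_adjoint P * root_diag n * P, cyclic_shift_mat n)
     \<or> n \<noteq> 3 \<and> unitarily_equivalent_pairs n (A, B) (cyclic_shift_mat n, mat_adjoint P * root_diag n * P))"
proof -
  have n0: "n > 0" and n3: "n \<ge> 3" using n by auto
  note ev = eigenvectors[OF A B n0 spectrum]
  obtain V where V: "unitary_mat n V" "mat_adjoint V * A * V = root_diag n" "A = V * root_diag n * mat_adjoint V"
    by (rule unitary_diagonalization[OF A ev(1)])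
      (assumption | rule normal_eigenvectors_orthogonal[OF A normal] that)+
  have contr: "euclidean_norm (B *\<^sub>v v) \<le> euclidean_norm v" if "v \<in> carrier_vec n" for v
    using operator_norm_bound[OF B that] norm by simp
  obtain W where W: "unitary_mat n W" "mat_adjoint W * B * W = root_diag n" "B = W * root_diag n * mat_adjoint W"
    by (rule unitary_diagonalization[OF B ev(2)])
      (assumption | rule contraction_eigenvectors_orthogonal[OF B contr] that)+
  note v = unitary_matD[OF V(1)] and w = unitary_matD[OF W(1)]
  define U where "U = mat_adjoint V * W"
  have U: "unitary_mat n U" unfolding U_def by (rule unitary_mat_mult[OF unitary_mat_adjoint[OF V(1)] W(1)])
  note u = unitary_matD[OF U]
  have adjU: "mat_adjoint U = mat_adjoint W * V"
    unfolding U_def mat_adjoint_mult[OF v(2) w(1)] mat_adjoint_adjoint[OF v(1)] by (rule refl)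
  have adj_adjU: "mat_adjoint (mat_adjoint U) = U" by (rule mat_adjoint_adjoint[OF u(1)])
  have BV: "mat_adjoint V * B * V = U * root_diag n * mat_adjoint U"
    using conj_conj[OF unitary_mat_adjoint[OF W(1)] V(1) root_diag_carrier]
    unfolding mat_adjoint_adjoint[OF w(1)] W(3)[symmetric] adjU[symmetric] adj_adjU .
  have AW: "mat_adjoint W * A * W = mat_adjoint U * root_diag n * mat_adjoint (mat_adjoint U)"
    using conj_conj[OF unitary_mat_adjoint[OF V(1)] W(1) root_diag_carrier]
    unfolding mat_adjoint_adjoint[OF v(1)] V(3)[symmetric] U_def[symmetric] adj_adjU .
  define b where "b = (\<lambda>i k. (mat_adjoint V * B * V) $$ (i, k))"
  have conds: "b j j = 0" "(\<Sum>k<n. b j k * b k j) = 0"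
      "(\<Sum>k\<in>{..<n} - {j}. b j k * b k j / (zeta n (int j) - zeta n (int k))) = 0" if j: "j < n" for j
  proof -
    have dist: "zeta n (int k) \<noteq> zeta n (int j)" if "k < n" "k \<noteq> j" for k
      using zeta_nat_inj[OF that(1) j] that(2) by blast
    have det: "\<exists>c. \<forall>\<^sub>F t in at 0. det (mat n n (\<lambda>(i, k).
        (if i = k then 1 - cnj (zeta n (int j)) * zeta n (int i) else 0)
        - t * (1 + \<kappa> * zeta n (int i)) * b i k)) = t ^ n * c" for \<kappa>
      unfolding b_def by (rule det_pencil_eigenbasis[OF A B n0 spectrum V(1,2) j])
    note pc = pencil_coefficients[of n j "\<lambda>k. zeta n (int k)" b, OF n3 j norm_zeta dist det]
    show "b j j = 0" "(\<Sum>k<n. b j k * b k j) = 0"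
      "(\<Sum>k\<in>{..<n} - {j}. b j k * b k j / (zeta n (int j) - zeta n (int k))) = 0"
      by (rule pc; assumption)+
  qed
  have flat: "(cmod (U $$ (j, m)))\<^sup>2 = 1 / real n" if "j < n" "m < n" for j m
    using flat_unitary_of_trace_conditions[OF U n _ _ that] conds(1,2) unfolding b_def BV by blast
  define h where "h = (\<lambda>j m. complex_of_real (sqrt (real n)) * U $$ (j, m))"
  have sq: "complex_of_real (sqrt (real n)) * complex_of_real (sqrt (real n)) = of_nat n"
    by (simp flip: of_real_mult)
  have uni: "cmod (h j m) = 1" if "j < n" "m < n" for j m
  proof -
    have "(cmod (h j m))\<^sup>2 = 1"
      using flat[OF that] n0 by (simp add: h_def norm_mult power_mult_distrib)
    thus ?thesis by (simp add: power2_eq_1_iff) (metis norm_ge_zero not_one_le_zero le_minus_one_simps(3))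
  qed
  have hh: "h j m * cnj (h k l) = of_nat n * (U $$ (j, m) * cnj (U $$ (k, l)))" for j m k l
    using sq by (simp add: h_def mult_ac)
  have rows: "(\<Sum>m<n. h j m * cnj (h k m)) = 0" if "j < n" "k < n" "j \<noteq> k" for j k
    unfolding hh sum_distrib_left[symmetric] using unitary_entries(1)[OF U that(1,2)] that(3) by simp
  have cols: "(\<Sum>j<n. h j m * cnj (h j l)) = 0" if "m < n" "l < n" "m \<noteq> l" for m l
    unfolding hh sum_distrib_left[symmetric] using unitary_entries(2)[OF U that(2,1)] that(3)
    by (simp add: mult.commute)
  have gs: "gram_shift n h j k = of_nat n * b j k" if "j < n" "k < n" for j k
    unfolding gram_shift_def b_def BV conj_root_diag_index[OF u(1) that] sum_distrib_left
    by (rule sum.cong[OF refl]) (simp add: hh mult_ac)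
  have gs': "gram_shift n (\<lambda>m j. cnj (h j m)) m l = of_nat n * (mat_adjoint W * A * W) $$ (m, l)"
    if "m < n" "l < n" for m l
    unfolding gram_shift_def AW conj_root_diag_index[OF u(2) that] sum_distrib_left
  proof (rule sum.cong[OF refl])
    fix j assume "j \<in> {..<n}"
    hence j: "j < n" by simp
    show "zeta n (int j) * (cnj (h j m) * cnj (cnj (h j l)))
        = of_nat n * (zeta n (int j) * (mat_adjoint U $$ (m, j) * cnj (mat_adjoint U $$ (l, j))))"
      unfolding mat_adjoint_index[OF u(1) that(1) j] mat_adjoint_index[OF u(1) that(2) j]
      using hh[of j l j m] by (simp add: mult_ac)
  qed
  have sum0: "(\<Sum>k<n. gram_shift n h j k * gram_shift n h k j) = 0" if j: "j < n" for j
  proof -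
    have "(\<Sum>k<n. gram_shift n h j k * gram_shift n h k j) = of_nat n * of_nat n * (\<Sum>k<n. b j k * b k j)"
      unfolding sum_distrib_left by (rule sum.cong[OF refl]) (simp add: gs j mult_ac)
    thus ?thesis using conds(2)[OF j] by simp
  qed
  have sum1: "(\<Sum>k\<in>{..<n} - {j}. gram_shift n h j k * gram_shift n h k j / (zeta n (int j) - zeta n (int k))) = 0"
    if j: "j < n" for j
  proof -
    have "(\<Sum>k\<in>{..<n} - {j}. gram_shift n h j k * gram_shift n h k j / (zeta n (int j) - zeta n (int k)))
        = of_nat n * of_nat n * (\<Sum>k\<in>{..<n} - {j}. b j k * b k j / (zeta n (int j) - zeta n (int k)))"
      unfolding sum_distrib_left by (rule sum.cong[OF refl]) (simp add: gs j mult_ac)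
    thus ?thesis using conds(3)[OF j] by simp
  qed
  have dich: "monomial_entries n (gram_shift n h) \<or> n \<noteq> 3 \<and> monomial_entries n (gram_shift n (\<lambda>m j. cnj (h j m)))"
    using n
  proof (elim disjE)
    assume n: "n = 3"
    have "monomial_entries 3 (gram_shift 3 h)"
      by (rule gram_shift_3_monomial; (rule uni[unfolded n] rows[unfolded n]); assumption)
    thus ?thesis unfolding n by simp
  next
    assume n: "n = 4"
    have "monomial_entries 4 (gram_shift 4 h) \<or> monomial_entries 4 (gram_shift 4 (\<lambda>m j. cnj (h j m)))"
      by (rule dichotomy_4; (rule uni[unfolded n] rows[unfolded n] sum0[unfolded n] sum1[unfolded n]); assumption)
    thus ?thesis unfolding n by simp
  next
    assume n: "n = 5"
    have "monomial_entries 5 (gram_shift 5 h) \<or> monomial_entries 5 (gram_shift 5 (\<lambda>m j. cnj (h j m)))"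
      by (rule dichotomy_5; (rule uni[unfolded n] rows[unfolded n] cols[unfolded n] sum0[unfolded n] sum1[unfolded n]);
          assumption)
    thus ?thesis unfolding n by simp
  qed
  thus ?thesis
  proof (elim disjE conjE)
    assume entries: "monomial_entries n (gram_shift n h)"
    have mono: "(U * root_diag n * mat_adjoint U) $$ (j, k) = 0 \<or> cmod ((U * root_diag n * mat_adjoint U) $$ (j, k)) = 1"
      if "j < n" "k < n" for j k
    proof -
      have "of_nat n * b j k = 0 \<or> cmod (of_nat n * b j k) = real n"
        using entries that unfolding monomial_entries_def gs[OF that, symmetric] by blast
      thus ?thesis using n0 unfolding norm_mult b_def BV by simp
    qed
    obtain P F where PF: "permutation_mat n P" "unitary_mat n F"
      "mat_adjoint F * (U * root_diag n * mat_adjoint U) * F = cyclic_shift_mat n"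
      "mat_adjoint F * root_diag n * F = mat_adjoint P * root_diag n * P"
      by (rule cyclic_basis[OF U n0 flat mono]) (assumption | rule that)+
    have "unitarily_equivalent_pairs n (A, B) (mat_adjoint P * root_diag n * P, cyclic_shift_mat n)"
      unfolding unitarily_equivalent_pairs_def split_conv
    proof (intro exI[of _ "V * F"] conjI)
      show "unitary_mat n (V * F)" by (rule unitary_mat_mult[OF V(1) PF(2)])
      show "mat_adjoint P * root_diag n * P = mat_adjoint (V * F) * A * (V * F)"
        unfolding conj_conj[OF V(1) PF(2) A, symmetric] V(2) PF(4) by (rule refl)
      show "cyclic_shift_mat n = mat_adjoint (V * F) * B * (V * F)"
        unfolding conj_conj[OF V(1) PF(2) B, symmetric] BV PF(3) by (rule refl)
    qed
    thus ?thesis using PF(1) by blast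
  next
    assume ne: "n \<noteq> 3" and entries: "monomial_entries n (gram_shift n (\<lambda>m j. cnj (h j m)))"
    have mono: "(mat_adjoint U * root_diag n * mat_adjoint (mat_adjoint U)) $$ (j, k) = 0
        \<or> cmod ((mat_adjoint U * root_diag n * mat_adjoint (mat_adjoint U)) $$ (j, k)) = 1"
      if "j < n" "k < n" for j k
    proof -
      have "of_nat n * (mat_adjoint W * A * W) $$ (j, k) = 0
          \<or> cmod (of_nat n * (mat_adjoint W * A * W) $$ (j, k)) = real n"
        using entries that unfolding monomial_entries_def gs'[OF that, symmetric] by blast
      thus ?thesis using n0 unfolding norm_mult AW by simp
    qed
    have flat': "(cmod (mat_adjoint U $$ (j, m)))\<^sup>2 = 1 / real n" if "j < n" "m < n" for j m
      unfolding mat_adjoint_index[OF u(1) that] complex_mod_cnj by (rule flat[OF that(2,1)])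
    obtain P F where PF: "permutation_mat n P" "unitary_mat n F"
      "mat_adjoint F * (mat_adjoint U * root_diag n * mat_adjoint (mat_adjoint U)) * F = cyclic_shift_mat n"
      "mat_adjoint F * root_diag n * F = mat_adjoint P * root_diag n * P"
      by (rule cyclic_basis[OF unitary_mat_adjoint[OF U] n0 flat' mono]) (assumption | rule that)+
    have "unitarily_equivalent_pairs n (A, B) (cyclic_shift_mat n, mat_adjoint P * root_diag n * P)"
      unfolding unitarily_equivalent_pairs_def split_conv
    proof (intro exI[of _ "W * F"] conjI)
      show "unitary_mat n (W * F)" by (rule unitary_mat_mult[OF W(1) PF(2)])
      show "cyclic_shift_mat n = mat_adjoint (W * F) * A * (W * F)"
        unfolding conj_conj[OF W(1) PF(2) A, symmetric] AW PF(3) by (rule refl)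
      show "mat_adjoint P * root_diag n * P = mat_adjoint (W * F) * B * (W * F)"
        unfolding conj_conj[OF W(1) PF(2) B, symmetric] W(2) PF(4) by (rule refl)
    qed
    thus ?thesis using PF(1) ne by blast
  qed
qed

text \<open>Conjugation by \<open>P\<close> turns the permuted diagonal matrix back into \<open>D\<close> and the shift into another cyclic
permutation of three points; there are only two of these.\<close>

lemma reorder_3:
  assumes P: "permutation_mat 3 P" and A: "A \<in> carrier_mat 3 3" and B: "B \<in> carrier_mat 3 3"
    and eq: "unitarily_equivalent_pairs 3 (A, B) (mat_adjoint P * root_diag 3 * P, cyclic_shift_mat 3)"
  shows "unitarily_equivalent_pairs 3 (A, B) (root_diag 3, mat_of_rows_list 3 [[0, 1, 0], [0, 0, 1], [1, 0, 0]])
    \<or> unitarily_equivalent_pairs 3 (A, B) (root_diag 3, mat_of_rows_list 3 [[0, 0, 1], [1, 0, 0], [0, 1, 0]])"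
proof -
  obtain p where p: "p permutes {..<3}" and P_def: "P = mat 3 3 (\<lambda>(i, j). if i = p j then 1 else 0)"
    using P by (auto simp: permutation_mat_def)
  have 3: "{..<3} = {0, 1, 2::nat}" by auto
  have Pc: "P \<in> carrier_mat 3 3" by (simp add: P_def)
  have pr: "p 0 \<in> {0, 1, 2}" "p 1 \<in> {0, 1, 2}" "p 2 \<in> {0, 1, 2}"
    using permutes_in_image[OF p, of 0] permutes_in_image[OF p, of 1] permutes_in_image[OF p, of 2] unfolding 3 by auto
  have pd: "p 0 \<noteq> p 1" "p 0 \<noteq> p 2" "p 1 \<noteq> p 2" using permutes_inj[OF p] by (auto simp: inj_eq)
  have uP: "unitary_mat 3 P"
  proof (rule unitary_matI[OF Pc], rule square_eqI)
    fix i j :: nat assume ij: "i < 3" "j < 3"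
    have "(mat_adjoint P * P) $$ (i, j) = (\<Sum>k<3. cnj (P $$ (k, i)) * P $$ (k, j))"
      unfolding square_mult_index[OF mat_adjoint_carrier[OF Pc] Pc ij]
      by (rule sum.cong[OF refl]) (simp add: mat_adjoint_index[OF Pc ij(1)])
    also have "\<dots> = (\<Sum>k<3. if k = p i then (if p i = p j then 1 else 0) else 0)"
      using ij by (intro sum.cong) (auto simp: P_def)
    also have "\<dots> = (if i = j then 1 else 0)"
      using permutes_in_image[OF p, of i] permutes_inj[OF p] ij by (simp add: inj_eq)
    finally show "(mat_adjoint P * P) $$ (i, j) = 1\<^sub>m 3 $$ (i, j)" using ij by simp
  qed (simp_all add: Pc)
  note q = unitary_matD[OF uP] and uQ = unitary_mat_adjoint[OF uP]
  have aa: "mat_adjoint (mat_adjoint P) = P" by (rule mat_adjoint_adjoint[OF Pc])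
  define C where "C = P * cyclic_shift_mat 3 * mat_adjoint P"
  have shift: "cyclic_shift_mat 3 \<in> carrier_mat 3 3" by (simp add: cyclic_shift_mat_def)
  obtain G where G: "unitary_mat 3 G" "mat_adjoint P * root_diag 3 * P = mat_adjoint G * A * G"
      "cyclic_shift_mat 3 = mat_adjoint G * B * G"
    using eq by (auto simp: unitarily_equivalent_pairs_def)
  have D: "root_diag 3 = P * (mat_adjoint P * root_diag 3 * P) * mat_adjoint P"
  proof -
    have "mat_adjoint (mat_adjoint P) * (mat_adjoint P * root_diag 3 * P) * mat_adjoint P
        = mat_adjoint (P * mat_adjoint P) * root_diag 3 * (P * mat_adjoint P)"
      by (rule conj_conj[OF uP uQ root_diag_carrier])
    also have "\<dots> = root_diag 3"
    proof -
      have one: "mat_adjoint (1\<^sub>m 3 :: complex mat) = 1\<^sub>m 3"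
        by (rule square_eqI[of _ 3]) (auto simp: mat_adjoint_index[OF one_carrier_mat])
      show ?thesis unfolding q(4) one
        by (simp add: left_mult_one_mat[OF root_diag_carrier] right_mult_one_mat[OF root_diag_carrier])
    qed
    finally show ?thesis unfolding aa by simp
  qed
  have pair: "unitarily_equivalent_pairs 3 (A, B) (root_diag 3, C)"
    unfolding unitarily_equivalent_pairs_def split_conv
  proof (intro exI[of _ "G * mat_adjoint P"] conjI)
    show "unitary_mat 3 (G * mat_adjoint P)" by (rule unitary_mat_mult[OF G(1) uQ])
    show "root_diag 3 = mat_adjoint (G * mat_adjoint P) * A * (G * mat_adjoint P)"
      unfolding conj_conj[OF G(1) uQ A, symmetric] G(2)[symmetric] aa by (rule D)
    show "C = mat_adjoint (G * mat_adjoint P) * B * (G * mat_adjoint P)"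
      unfolding conj_conj[OF G(1) uQ B, symmetric] G(3)[symmetric] aa C_def by (rule refl)
  qed
  have C_idx: "C $$ (i, j) = (\<Sum>l<3. (\<Sum>k<3. P $$ (i, k) * cyclic_shift_mat 3 $$ (k, l)) * P $$ (j, l))"
    if ij: "i < 3" "j < 3" for i j
    unfolding C_def square_mult_index[OF square_mult_carrier[OF Pc shift] q(2) ij]
  proof (rule sum.cong[OF refl])
    fix l :: nat assume "l \<in> {..<3}"
    hence l: "l < 3" by simp
    have "cnj (P $$ (j, l)) = P $$ (j, l)" using ij l by (simp add: P_def)
    thus "(P * cyclic_shift_mat 3) $$ (i, l) * mat_adjoint P $$ (l, j)
        = (\<Sum>k<3. P $$ (i, k) * cyclic_shift_mat 3 $$ (k, l)) * P $$ (j, l)"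
      unfolding square_mult_index[OF Pc shift ij(1) l] mat_adjoint_index[OF Pc l ij(2)] by simp
  qed
  have C: "C \<in> carrier_mat 3 3" using Pc shift by (simp add: C_def)
  have vals: "P $$ (i, k) = (if i = p k then 1 else 0)" if "i < 3" "k < 3" for i k using that by (simp add: P_def)
  have svals: "cyclic_shift_mat 3 $$ (k, l) = (if k = (l + 1) mod 3 then 1 else 0)" if "k < 3" "l < 3" for k l
    using that by (simp add: cyclic_shift_mat_def)
  \<comment> \<open>C sends the basis vector p l to the basis vector p (l + 1).\<close>
  have entry: "C $$ (i, j) = (if i = p 1 \<and> j = p 0 \<or> i = p 2 \<and> j = p 1 \<or> i = p 0 \<and> j = p 2 then 1 else 0)"
    if ij: "i < 3" "j < 3" for i j
  proof -
    have "(\<Sum>k<3. P $$ (i, k) * cyclic_shift_mat 3 $$ (k, l)) = (if i = p ((l + 1) mod 3) then 1 else 0)"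
      if l: "l < 3" for l
    proof -
      have "(\<Sum>k<3. P $$ (i, k) * cyclic_shift_mat 3 $$ (k, l))
          = (\<Sum>k<3. if k = (l + 1) mod 3 then P $$ (i, k) else 0)"
        by (rule sum.cong[OF refl]) (simp add: svals l)
      thus ?thesis using ij by (simp add: vals)
    qed
    hence "C $$ (i, j) = (\<Sum>l<3. (if i = p ((l + 1) mod 3) then 1 else 0) * (if j = p l then 1 else 0))"
      unfolding C_idx[OF ij] by (intro sum.cong) (simp_all add: vals ij)
    also have "\<dots> = (if i = p 1 \<and> j = p 0 \<or> i = p 2 \<and> j = p 1 \<or> i = p 0 \<and> j = p 2 then 1 else 0)"
      unfolding 3 using pd by (auto simp: numeral_2_eq_2)
    finally show ?thesis .
  qed
  have mem: "i = 0 \<or> i = 1 \<or> i = 2" if "i < 3" for i :: nat using that by auto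
  have "C = mat_of_rows_list 3 [[0, 1, 0], [0, 0, 1], [1, 0, 0]] \<or> C = mat_of_rows_list 3 [[0, 0, 1], [1, 0, 0], [0, 1, 0]]"
  proof (cases "(p 0, p 1, p 2) = (0, 1, 2) \<or> (p 0, p 1, p 2) = (1, 2, 0) \<or> (p 0, p 1, p 2) = (2, 0, 1)")
    case True
    have "C = mat_of_rows_list 3 [[0, 0, 1], [1, 0, 0], [0, 1, 0]]"
    proof (rule square_eqI[OF C])
      fix i j :: nat assume ij: "i < 3" "j < 3"
      show "C $$ (i, j) = mat_of_rows_list 3 [[0, 0, 1], [1, 0, 0], [0, 1, 0]] $$ (i, j)"
        unfolding entry[OF ij] using mem[OF ij(1)] mem[OF ij(2)] True
        by (elim disjE) (simp_all add: mat_of_rows_list_def)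
    qed (simp add: mat_of_rows_list_def numeral_3_eq_3)
    thus ?thesis ..
  next
    case False
    hence F: "(p 0, p 1, p 2) = (0, 2, 1) \<or> (p 0, p 1, p 2) = (1, 0, 2) \<or> (p 0, p 1, p 2) = (2, 1, 0)"
      using pr pd by (elim insertE emptyE) simp_all
    have "C = mat_of_rows_list 3 [[0, 1, 0], [0, 0, 1], [1, 0, 0]]"
    proof (rule square_eqI[OF C])
      fix i j :: nat assume ij: "i < 3" "j < 3"
      show "C $$ (i, j) = mat_of_rows_list 3 [[0, 1, 0], [0, 0, 1], [1, 0, 0]] $$ (i, j)"
        unfolding entry[OF ij] using mem[OF ij(1)] mem[OF ij(2)] F
        by (elim disjE) (simp_all add: mat_of_rows_list_def)
    qed (simp add: mat_of_rows_list_def numeral_3_eq_3)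
    thus ?thesis ..
  qed
  thus ?thesis using pair by auto
qed

lemma root_diag_3:
  "mat_of_rows_list 3 [[1, 0, 0], [0, cis (2 * pi / 3), 0], [0, 0, cis (4 * pi / 3)]] = root_diag 3"
proof (rule square_eqI[of _ 3])
  fix i j :: nat assume "i < 3" "j < 3"
  moreover from this have "i = 0 \<or> i = 1 \<or> i = 2" "j = 0 \<or> j = 1 \<or> j = 2" by auto
  ultimately show "mat_of_rows_list 3 [[1, 0, 0], [0, cis (2 * pi / 3), 0], [0, 0, cis (4 * pi / 3)]] $$ (i, j)
      = root_diag 3 $$ (i, j)"
    by (elim disjE) (simp_all add: mat_of_rows_list_def root_diag_index zeta_def)
qed (simp_all add: mat_of_rows_list_def numeral_3_eq_3)

theorem theorem1p10:
  fixes n :: nat and A B :: "complex mat"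
  assumes "A \<in> carrier_mat n n" and "B \<in> carrier_mat n n"
    and "normal_mat A"
    and "operator_norm B = 1"
    and "joint_spectrum n [A, B, A * B] =
      {vec_of_list [x, y, z] | x y z. x ^ n + y ^ n + (-1) ^ (n - 1) * z ^ n = 1}"
  shows "(n = 3 \<longrightarrow>
      unitarily_equivalent_pairs 3 (A, B)
        (mat_of_rows_list 3 [[1, 0, 0], [0, cis (2 * pi / 3), 0], [0, 0, cis (4 * pi / 3)]],
         mat_of_rows_list 3 [[0, 1, 0], [0, 0, 1], [1, 0, 0]])
    \<or> unitarily_equivalent_pairs 3 (A, B)
        (mat_of_rows_list 3 [[1, 0, 0], [0, cis (2 * pi / 3), 0], [0, 0, cis (4 * pi / 3)]],
         mat_of_rows_list 3 [[0, 0, 1], [1, 0, 0], [0, 1, 0]]))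
    \<and> (n = 4 \<or> n = 5 \<longrightarrow>
      (\<exists>P. permutation_mat n P \<and>
        (unitarily_equivalent_pairs n (A, B)
           (mat_adjoint P * roots_of_unity_diag n * P, cyclic_shift_mat n)
       \<or> unitarily_equivalent_pairs n (A, B)
           (cyclic_shift_mat n, mat_adjoint P * roots_of_unity_diag n * P))))"
proof (intro conjI impI)
  assume n: "n = 3"
  obtain P where P: "permutation_mat 3 P"
    "unitarily_equivalent_pairs 3 (A, B) (mat_adjoint P * root_diag 3 * P, cyclic_shift_mat 3)"
    using pair_dichotomy[OF assms(1-4) _ assms(5)] n by auto
  show "unitarily_equivalent_pairs 3 (A, B)
        (mat_of_rows_list 3 [[1, 0, 0], [0, cis (2 * pi / 3), 0], [0, 0, cis (4 * pi / 3)]],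
         mat_of_rows_list 3 [[0, 1, 0], [0, 0, 1], [1, 0, 0]])
    \<or> unitarily_equivalent_pairs 3 (A, B)
        (mat_of_rows_list 3 [[1, 0, 0], [0, cis (2 * pi / 3), 0], [0, 0, cis (4 * pi / 3)]],
         mat_of_rows_list 3 [[0, 0, 1], [1, 0, 0], [0, 1, 0]])"
    unfolding root_diag_3 by (rule reorder_3[OF P(1) _ _ P(2)]) (use assms(1,2) n in simp_all)
next
  assume "n = 4 \<or> n = 5"
  thus "\<exists>P. permutation_mat n P \<and>
        (unitarily_equivalent_pairs n (A, B)
           (mat_adjoint P * roots_of_unity_diag n * P, cyclic_shift_mat n)
       \<or> unitarily_equivalent_pairs n (A, B)
           (cyclic_shift_mat n, mat_adjoint P * roots_of_unity_diag n * P))"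
    unfolding root_diag_eq using pair_dichotomy[OF assms(1-4) _ assms(5)] by blast
qed

end
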